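(* Let $\mathrm T_c$ and $\mathrm T_q$ be the 2-monads on the 2-category $\mathbf{ED}$ of elementary doctrines given by the comprehension completion and the quotient completion, respectively. There exists a distributive law $\delta:\mathrm T_c\mathrm T_q\to\mathrm T_q\mathrm T_c$ of $\mathrm T_c$ over $\mathrm T_q$.
   Context: $\mathbf{InfSL}$ is the category of posets with finite meets and functions preserving finite meets. Let $\mathcal C$ be a category with binary products. An elementary doctrine on $\mathcal C$ is a functor $P:\mathcal C^{\mathrm{op}}\to\mathbf{InfSL}$ (write $P_f=P(f)$) such that for every object $A$ there is $\delta_A\in P(A\times A)$ with: (1) $\alpha\mapsto P_{\mathrm{pr}_1}(\alpha)\wedge\delta_A$ is left adjoint to $P_{\langle \mathrm{id}_A,\mathrm{id}_A\rangle}:P(A\times A)\to P(A)$; (2) for every $e=\langle \mathrm{pr}_1,\mathrm{pr}_2,\mathrm{pr}_2\rangle:X\times A\to X\times A\times A$, the assignment $\alpha\mapsto P_{\langle \mathrm{pr}_1,\mathrm{pr}_2\rangle}(\alpha)\wedge P_{\langle \mathrm{pr}_2,\mathrm{pr}_3\rangle}(\delta_A)$ is left adjoint to $P_e:P(X\times A\times A)\to P(X\times A)$. The 2-category $\mathbf{ED}$: 0-cells are elementary doctrines; a 1-cell $(F,b):P\to R$ (with $P$ on $\mathcal C$, $R$ on $\mathcal D$) is a product-preserving functor $F:\mathcal C\to\mathcal D$ with a natural transformation $b:P\Rightarrow R\circ F^{\mathrm{op}}$ such that each $b_A$ preserves finite meets and $b_{A\times A}(\delta_A)=R_{\langle F\mathrm{pr}_1,F\mathrm{pr}_2\rangle}(\delta_{FA})$;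 a 2-cell $(F,b)\Rightarrow(G,c)$ is a natural transformation $\theta:F\Rightarrow G$ with $b_A(\alpha)\le R_{\theta_A}(c_A(\alpha))$ for all $A$ and $\alpha\in P(A)$. The 2-monad $\mathrm{T}_c$: for $P$ on $\mathcal C$, $\mathcal G_P$ is the category of pairs $(A,\alpha)$ with $\alpha\in P(A)$, an arrow $f:(A,\alpha)\to(B,\beta)$ being an arrow $f:A\to B$ of $\mathcal C$ with $\alpha\le P_f(\beta)$; $\mathrm{T}_c(P)=P_c:\mathcal G_P^{\mathrm{op}}\to\mathbf{InfSL}$ is $P_c(A,\alpha)=\{\gamma\in P(A):\gamma\le\alpha\}$, $P_c(f)(\gamma)=P_f(\gamma)\wedge\alpha$, an elementary doctrine with $\delta_{(A,\alpha)}=\delta_A\wedge P_{\mathrm{pr}_1}(\alpha)\wedge P_{\mathrm{pr}_2}(\alpha)$. On a 1-cell, $\mathrm{T}_c(F,b)=(\widehat F,\widehat b)$ with $\widehat F(A,\alpha)=(FA,b_A(\alpha))$, $\widehat F(f)=F(f)$ and $\widehat b$ the restriction of $b$; on a 2-cell, $\widehat\theta_{(A,\alpha)}=\theta_A$. Its unit $P\to P_c$ is $A\mapsto(A,\top_A)$, identity on arrows and elements; its multiplication $(P_c)_c\to P_c$ is $((A,\alpha),\gamma)\mapsto(A,\gamma)$, identity on arrows and elements. A $P$-equivalence relation on $A$ is $\rho\in P(A\times A)$ with $\delta_A\le\rho$, $\rho\le P_{\langle\mathrm{pr}_2,\mathrm{pr}_1\rangle}(\rho)$ and $P_{\langle\mathrm{pr}_1,\mathrm{pr}_2\rangle}(\rho)\wedge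 P_{\langle\mathrm{pr}_2,\mathrm{pr}_3\rangle}(\rho)\le P_{\langle\mathrm{pr}_1,\mathrm{pr}_3\rangle}(\rho)$. Descent data: $\mathrm{Des}_\rho=\{\alpha\in P(A):P_{\mathrm{pr}_1}(\alpha)\wedge\rho\le P_{\mathrm{pr}_2}(\alpha)\}$. The 2-monad $\mathrm T_q$: for $P$ on $\mathcal C$, $\mathcal R_P$ is the category of pairs $(A,\rho)$ with $\rho$ a $P$-equivalence relation on $A$, an arrow $f:(A,\rho)\to(B,\sigma)$ being an arrow $f:A\to B$ of $\mathcal C$ with $\rho\le P_{f\times f}(\sigma)$. $\mathrm T_q(P)=P_q:\mathcal R_P^{\mathrm{op}}\to\mathbf{InfSL}$ is $P_q(A,\rho)=\mathrm{Des}_\rho$, $P_q(f)=P_f$, an elementary doctrine with $\delta_{(A,\rho)}=\rho$. On a 1-cell, $\mathrm T_q(F,b)=(\overline F,\overline b)$ with $\overline F(A,\rho)=(FA,R_{\langle F\mathrm{pr}_1,F\mathrm{pr}_2\rangle^{-1}}(b_{A\times A}(\rho)))$, $\overline F(f)=F(f)$, $\overline b$ the restriction of $b$; on 2-cells $\theta\mapsto\theta$. Its unit $P\to P_q$ is $A\mapsto(A,\delta_A)$, identity on arrows and elements; its multiplication $(P_q)_q\to P_q$ is $((A,\rho),\tau)\mapsto(A,\tau)$, identity on arrows and elements. Given 2-monads $(\mathrm S,\mu^S,\eta^S)$ and $(\mathrm T,\mu^T,\eta^T)$ on a 2-category, a distributive law of $\mathrm S$ over $\mathrm T$ is a (2-)natural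 transformation $\delta:\mathrm S\mathrm T\to\mathrm T\mathrm S$ such that $\delta\circ\mu^S\mathrm T=\mathrm T\mu^S\circ\delta\mathrm S\circ\mathrm S\delta$, $\ \delta\circ\mathrm S\mu^T=\mu^T\mathrm S\circ\mathrm T\delta\circ\delta\mathrm T$, $\ \delta\circ\eta^S\mathrm T=\mathrm T\eta^S$ and $\delta\circ\mathrm S\eta^T=\eta^T\mathrm S$. *)

theory Defs
  imports "HOL-Library.FuncSet" "HOL-Algebra.Galois_Connection"
begin

section \<open>Categories with chosen binary products\<close>

text \<open>Hom-sets are disjoint: every arrow determines its domain and codomain.  The chosen products
  are part of the structure, since \<open>\<delta>\<^sub>A \<in> P(A \<times> A)\<close> refers to a definite object \<open>A \<times> A\<close>.
  \<open>Comp C g f\<close> is the composite \<open>g \<circ> f\<close>.\<close>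

record ('o, 'a) pcat =
  Obj :: "'o set"
  Arr :: "'a set"
  Dom :: "'a \<Rightarrow> 'o"
  Cod :: "'a \<Rightarrow> 'o"
  Ide :: "'o \<Rightarrow> 'a"
  Comp :: "'a \<Rightarrow> 'a \<Rightarrow> 'a"
  Prod :: "'o \<Rightarrow> 'o \<Rightarrow> 'o"
  Pr1 :: "'o \<Rightarrow> 'o \<Rightarrow> 'a"
  Pr2 :: "'o \<Rightarrow> 'o \<Rightarrow> 'a"

definition hom :: "('o, 'a, 'm) pcat_scheme \<Rightarrow> 'o \<Rightarrow> 'o \<Rightarrow> 'a set" where
  "hom C A B = {f \<in> Arr C. Dom C f = A \<and> Cod C f = B}"

definition category :: "('o, 'a, 'm) pcat_scheme \<Rightarrow> bool" where
  "category C \<longleftrightarrow>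
     (\<forall>f\<in>Arr C. Dom C f \<in> Obj C \<and> Cod C f \<in> Obj C) \<and>
     (\<forall>A\<in>Obj C. Ide C A \<in> hom C A A) \<and>
     (\<forall>f\<in>Arr C. \<forall>g\<in>Arr C. Dom C g = Cod C f \<longrightarrow> Comp C g f \<in> hom C (Dom C f) (Cod C g)) \<and>
     (\<forall>f\<in>Arr C. Comp C f (Ide C (Dom C f)) = f \<and> Comp C (Ide C (Cod C f)) f = f) \<and>
     (\<forall>f\<in>Arr C. \<forall>g\<in>Arr C. \<forall>h\<in>Arr C. Dom C g = Cod C f \<and> Dom C h = Cod C g \<longrightarrow>
        Comp C h (Comp C g f) = Comp C (Comp C h g) f)"

definition is_product ::
    "('o, 'a, 'm) pcat_scheme \<Rightarrow> 'o \<Rightarrow> 'o \<Rightarrow> 'o \<Rightarrow> 'a \<Rightarrow> 'a \<Rightarrow> bool" where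
  "is_product C A B Q p q \<longleftrightarrow>
     Q \<in> Obj C \<and> p \<in> hom C Q A \<and> q \<in> hom C Q B \<and>
     (\<forall>X\<in>Obj C. \<forall>f\<in>hom C X A. \<forall>g\<in>hom C X B.
        \<exists>!h. h \<in> hom C X Q \<and> Comp C p h = f \<and> Comp C q h = g)"

definition category_with_products :: "('o, 'a, 'm) pcat_scheme \<Rightarrow> bool" where
  "category_with_products C \<longleftrightarrow> category C \<and>
     (\<forall>A\<in>Obj C. \<forall>B\<in>Obj C. is_product C A B (Prod C A B) (Pr1 C A B) (Pr2 C A B))"

text \<open>\<open>tuple C f g\<close> is \<open>\<langle>f, g\<rangle>\<close> and \<open>cross C f g\<close> is \<open>f \<times> g\<close>.\<close>

definition tuple :: "('o, 'a, 'm) pcat_scheme \<Rightarrow> 'a \<Rightarrow> 'a \<Rightarrow> 'a" where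
  "tuple C f g = (THE h. h \<in> hom C (Dom C f) (Prod C (Cod C f) (Cod C g)) \<and>
     Comp C (Pr1 C (Cod C f) (Cod C g)) h = f \<and> Comp C (Pr2 C (Cod C f) (Cod C g)) h = g)"

definition cross :: "('o, 'a, 'm) pcat_scheme \<Rightarrow> 'a \<Rightarrow> 'a \<Rightarrow> 'a" where
  "cross C f g = tuple C (Comp C f (Pr1 C (Dom C f) (Dom C g))) (Comp C g (Pr2 C (Dom C f) (Dom C g)))"

definition inv_arr :: "('o, 'a, 'm) pcat_scheme \<Rightarrow> 'a \<Rightarrow> 'a" where
  "inv_arr C f = (THE g. g \<in> hom C (Cod C f) (Dom C f) \<and>
     Comp C g f = Ide C (Dom C f) \<and> Comp C f g = Ide C (Cod C f))"

text \<open>The ternary product \<open>A \<times> B \<times> D\<close> is bracketed to the left.\<close>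

definition Prod3 :: "('o, 'a, 'm) pcat_scheme \<Rightarrow> 'o \<Rightarrow> 'o \<Rightarrow> 'o \<Rightarrow> 'o" where
  "Prod3 C A B D = Prod C (Prod C A B) D"

definition pr31 :: "('o, 'a, 'm) pcat_scheme \<Rightarrow> 'o \<Rightarrow> 'o \<Rightarrow> 'o \<Rightarrow> 'a" where
  "pr31 C A B D = Comp C (Pr1 C A B) (Pr1 C (Prod C A B) D)"

definition pr32 :: "('o, 'a, 'm) pcat_scheme \<Rightarrow> 'o \<Rightarrow> 'o \<Rightarrow> 'o \<Rightarrow> 'a" where
  "pr32 C A B D = Comp C (Pr2 C A B) (Pr1 C (Prod C A B) D)"

definition pr33 :: "('o, 'a, 'm) pcat_scheme \<Rightarrow> 'o \<Rightarrow> 'o \<Rightarrow> 'o \<Rightarrow> 'a" where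
  "pr33 C A B D = Pr2 C (Prod C A B) D"

definition is_functor ::
    "('o, 'a, 'm) pcat_scheme \<Rightarrow> ('o2, 'a2, 'm2) pcat_scheme \<Rightarrow> ('o \<Rightarrow> 'o2) \<Rightarrow> ('a \<Rightarrow> 'a2) \<Rightarrow> bool" where
  "is_functor C D Fo Fa \<longleftrightarrow>
     (\<forall>A\<in>Obj C. Fo A \<in> Obj D) \<and>
     (\<forall>f\<in>Arr C. Fa f \<in> hom D (Fo (Dom C f)) (Fo (Cod C f))) \<and>
     (\<forall>A\<in>Obj C. Fa (Ide C A) = Ide D (Fo A)) \<and>
     (\<forall>f\<in>Arr C. \<forall>g\<in>Arr C. Dom C g = Cod C f \<longrightarrow> Fa (Comp C g f) = Comp D (Fa g) (Fa f))"

text \<open>Preservation of products is up to isomorphism: the chosen product need not be sent to the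
  chosen one.\<close>

definition preserves_products ::
    "('o, 'a, 'm) pcat_scheme \<Rightarrow> ('o2, 'a2, 'm2) pcat_scheme \<Rightarrow> ('o \<Rightarrow> 'o2) \<Rightarrow> ('a \<Rightarrow> 'a2) \<Rightarrow> bool" where
  "preserves_products C D Fo Fa \<longleftrightarrow>
     (\<forall>A\<in>Obj C. \<forall>B\<in>Obj C.
        is_product D (Fo A) (Fo B) (Fo (Prod C A B)) (Fa (Pr1 C A B)) (Fa (Pr2 C A B)))"


section \<open>Elementary doctrines\<close>

definition infsl :: "'p gorder \<Rightarrow> bool" where
  "infsl L \<longleftrightarrow> lower_semilattice L \<and> weak_partial_order_top L"

definition infsl_hom :: "'p gorder \<Rightarrow> 'q gorder \<Rightarrow> ('p \<Rightarrow> 'q) \<Rightarrow> bool" where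
  "infsl_hom L M h \<longleftrightarrow>
     h \<in> carrier L \<rightarrow> carrier M \<and> h \<top>\<^bsub>L\<^esub> = \<top>\<^bsub>M\<^esub> \<and>
     (\<forall>x\<in>carrier L. \<forall>y\<in>carrier L. h (x \<sqinter>\<^bsub>L\<^esub> y) = h x \<sqinter>\<^bsub>M\<^esub> h y)"

text \<open>\<open>Fib P A\<close> is the poset \<open>P(A)\<close> and \<open>Re P f\<close> the reindexing \<open>P\<^sub>f\<close>.\<close>

record ('o, 'a, 'p) doctrine = "('o, 'a) pcat" +
  Fib :: "'o \<Rightarrow> 'p gorder"
  Re :: "'a \<Rightarrow> 'p \<Rightarrow> 'p"

definition doctrine :: "('o, 'a, 'p) doctrine \<Rightarrow> bool" where
  "doctrine P \<longleftrightarrow> category_with_products P \<and>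
     (\<forall>A\<in>Obj P. infsl (Fib P A)) \<and>
     (\<forall>f\<in>Arr P. infsl_hom (Fib P (Cod P f)) (Fib P (Dom P f)) (Re P f)) \<and>
     (\<forall>A\<in>Obj P. \<forall>\<alpha>\<in>carrier (Fib P A). Re P (Ide P A) \<alpha> = \<alpha>) \<and>
     (\<forall>f\<in>Arr P. \<forall>g\<in>Arr P. Dom P g = Cod P f \<longrightarrow>
        (\<forall>\<alpha>\<in>carrier (Fib P (Cod P g)). Re P (Comp P g f) \<alpha> = Re P f (Re P g \<alpha>)))"

definition is_delta :: "('o, 'a, 'p) doctrine \<Rightarrow> 'o \<Rightarrow> 'p \<Rightarrow> bool" where
  "is_delta P A d \<longleftrightarrow>
     d \<in> carrier (Fib P (Prod P A A)) \<and>
     galois_connection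
       \<lparr> orderA = Fib P A, orderB = Fib P (Prod P A A),
         lower = (\<lambda>\<alpha>. Re P (Pr1 P A A) \<alpha> \<sqinter>\<^bsub>Fib P (Prod P A A)\<^esub> d),
         upper = Re P (tuple P (Ide P A) (Ide P A)) \<rparr> \<and>
     (\<forall>X\<in>Obj P. galois_connection
       \<lparr> orderA = Fib P (Prod P X A), orderB = Fib P (Prod3 P X A A),
         lower = (\<lambda>\<alpha>. Re P (tuple P (pr31 P X A A) (pr32 P X A A)) \<alpha>
                        \<sqinter>\<^bsub>Fib P (Prod3 P X A A)\<^esub> Re P (tuple P (pr32 P X A A) (pr33 P X A A)) d),
         upper = Re P (tuple P (tuple P (Pr1 P X A) (Pr2 P X A)) (Pr2 P X A)) \<rparr>)"

definition elementary_doctrine :: "('o, 'a, 'p) doctrine \<Rightarrow> bool" where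
  "elementary_doctrine P \<longleftrightarrow> doctrine P \<and> (\<forall>A\<in>Obj P. \<exists>d. is_delta P A d)"

text \<open>The element is unique: \<open>\<delta>\<^sub>A = P\<^sub>p\<^sub>r\<^sub>1(\<top>) \<and> \<delta>\<^sub>A\<close> is the value at \<open>\<top>\<close> of a left adjoint.\<close>

definition delta :: "('o, 'a, 'p) doctrine \<Rightarrow> 'o \<Rightarrow> 'p" where
  "delta P A = (THE d. is_delta P A d)"


section \<open>The 2-category of elementary doctrines\<close>

text \<open>1-cells and 2-cells carry their source and target, and their maps are \<open>undefined\<close> outside
  the relevant carriers, so that equality of cells is equality in HOL.  \<open>mk1\<close> and \<open>mk2\<close> restrict
  arbitrary maps to the carriers.\<close>

record ('o, 'a, 'p) cell1 =
  Src1 :: "('o, 'a, 'p) doctrine"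
  Tgt1 :: "('o, 'a, 'p) doctrine"
  OMap :: "'o \<Rightarrow> 'o"
  AMap :: "'a \<Rightarrow> 'a"
  FMap :: "'o \<Rightarrow> 'p \<Rightarrow> 'p"

definition mk1 :: "('o, 'a, 'p) doctrine \<Rightarrow> ('o, 'a, 'p) doctrine \<Rightarrow>
    ('o \<Rightarrow> 'o) \<Rightarrow> ('a \<Rightarrow> 'a) \<Rightarrow> ('o \<Rightarrow> 'p \<Rightarrow> 'p) \<Rightarrow> ('o, 'a, 'p) cell1" where
  "mk1 P R Fo Fa b =
     \<lparr> Src1 = P, Tgt1 = R,
       OMap = (\<lambda>A\<in>Obj P. Fo A),
       AMap = (\<lambda>f\<in>Arr P. Fa f),
       FMap = (\<lambda>A\<in>Obj P. \<lambda>\<alpha>\<in>carrier (Fib P A). b A \<alpha>) \<rparr>"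

definition cell1_in ::
    "('o, 'a, 'p) doctrine \<Rightarrow> ('o, 'a, 'p) doctrine \<Rightarrow> ('o, 'a, 'p) cell1 \<Rightarrow> bool" where
  "cell1_in P R F \<longleftrightarrow>
     elementary_doctrine P \<and> elementary_doctrine R \<and>
     F = mk1 P R (OMap F) (AMap F) (FMap F) \<and>
     is_functor P R (OMap F) (AMap F) \<and>
     preserves_products P R (OMap F) (AMap F) \<and>
     (\<forall>A\<in>Obj P. infsl_hom (Fib P A) (Fib R (OMap F A)) (FMap F A)) \<and>
     (\<forall>f\<in>Arr P. \<forall>\<alpha>\<in>carrier (Fib P (Cod P f)).
        FMap F (Dom P f) (Re P f \<alpha>) = Re R (AMap F f) (FMap F (Cod P f) \<alpha>)) \<and>
     (\<forall>A\<in>Obj P. FMap F (Prod P A A) (delta P A)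
        = Re R (tuple R (AMap F (Pr1 P A A)) (AMap F (Pr2 P A A))) (delta R (OMap F A)))"

definition id1 :: "('o, 'a, 'p) doctrine \<Rightarrow> ('o, 'a, 'p) cell1" where
  "id1 P = mk1 P P (\<lambda>A. A) (\<lambda>f. f) (\<lambda>A \<alpha>. \<alpha>)"

definition comp1 :: "('o, 'a, 'p) cell1 \<Rightarrow> ('o, 'a, 'p) cell1 \<Rightarrow> ('o, 'a, 'p) cell1"
    (infixr \<open>\<odot>\<close> 75) where
  "G \<odot> F = mk1 (Src1 F) (Tgt1 G) (\<lambda>A. OMap G (OMap F A)) (\<lambda>f. AMap G (AMap F f))
     (\<lambda>A \<alpha>. FMap G (OMap F A) (FMap F A \<alpha>))"

record ('o, 'a, 'p) cell2 =
  Src2 :: "('o, 'a, 'p) cell1"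
  Tgt2 :: "('o, 'a, 'p) cell1"
  Cmp :: "'o \<Rightarrow> 'a"

definition mk2 :: "('o, 'a, 'p) cell1 \<Rightarrow> ('o, 'a, 'p) cell1 \<Rightarrow> ('o \<Rightarrow> 'a) \<Rightarrow> ('o, 'a, 'p) cell2" where
  "mk2 F G t = \<lparr> Src2 = F, Tgt2 = G, Cmp = (\<lambda>A\<in>Obj (Src1 F). t A) \<rparr>"

definition cell2_in ::
    "('o, 'a, 'p) doctrine \<Rightarrow> ('o, 'a, 'p) doctrine \<Rightarrow> ('o, 'a, 'p) cell1 \<Rightarrow> ('o, 'a, 'p) cell1 \<Rightarrow>
     ('o, 'a, 'p) cell2 \<Rightarrow> bool" where
  "cell2_in P R F G \<theta> \<longleftrightarrow>
     cell1_in P R F \<and> cell1_in P R G \<and>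
     \<theta> = mk2 F G (Cmp \<theta>) \<and>
     (\<forall>A\<in>Obj P. Cmp \<theta> A \<in> hom R (OMap F A) (OMap G A)) \<and>
     (\<forall>f\<in>Arr P. Comp R (Cmp \<theta> (Cod P f)) (AMap F f) = Comp R (AMap G f) (Cmp \<theta> (Dom P f))) \<and>
     (\<forall>A\<in>Obj P. \<forall>\<alpha>\<in>carrier (Fib P A).
        FMap F A \<alpha> \<sqsubseteq>\<^bsub>Fib R (OMap F A)\<^esub> Re R (Cmp \<theta> A) (FMap G A \<alpha>))"

definition id2 :: "('o, 'a, 'p) cell1 \<Rightarrow> ('o, 'a, 'p) cell2" where
  "id2 F = mk2 F F (\<lambda>A. Ide (Tgt1 F) (OMap F A))"

definition vcomp :: "('o, 'a, 'p) cell2 \<Rightarrow> ('o, 'a, 'p) cell2 \<Rightarrow> ('o, 'a, 'p) cell2" where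
  "vcomp \<psi> \<theta> = mk2 (Src2 \<theta>) (Tgt2 \<psi>) (\<lambda>A. Comp (Tgt1 (Src2 \<theta>)) (Cmp \<psi> A) (Cmp \<theta> A))"

definition hcomp :: "('o, 'a, 'p) cell2 \<Rightarrow> ('o, 'a, 'p) cell2 \<Rightarrow> ('o, 'a, 'p) cell2" where
  "hcomp \<psi> \<theta> = mk2 (Src2 \<psi> \<odot> Src2 \<theta>) (Tgt2 \<psi> \<odot> Tgt2 \<theta>)
     (\<lambda>A. Comp (Tgt1 (Src2 \<psi>)) (AMap (Tgt2 \<psi>) (Cmp \<theta> A)) (Cmp \<psi> (OMap (Src2 \<theta>) A)))"


section \<open>2-monads and distributive laws\<close>

record ('o, 'a, 'p) fun2 =
  on0 :: "('o, 'a, 'p) doctrine \<Rightarrow> ('o, 'a, 'p) doctrine"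
  on1 :: "('o, 'a, 'p) cell1 \<Rightarrow> ('o, 'a, 'p) cell1"
  on2 :: "('o, 'a, 'p) cell2 \<Rightarrow> ('o, 'a, 'p) cell2"

definition two_functor :: "('o, 'a, 'p, 'm) fun2_scheme \<Rightarrow> bool" where
  "two_functor T \<longleftrightarrow>
     (\<forall>P. elementary_doctrine P \<longrightarrow> elementary_doctrine (on0 T P)) \<and>
     (\<forall>P R F. cell1_in P R F \<longrightarrow> cell1_in (on0 T P) (on0 T R) (on1 T F)) \<and>
     (\<forall>P R F G \<theta>. cell2_in P R F G \<theta> \<longrightarrow>
        cell2_in (on0 T P) (on0 T R) (on1 T F) (on1 T G) (on2 T \<theta>)) \<and>
     (\<forall>P. elementary_doctrine P \<longrightarrow> on1 T (id1 P) = id1 (on0 T P)) \<and>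
     (\<forall>P R S F G. cell1_in P R F \<and> cell1_in R S G \<longrightarrow> on1 T (G \<odot> F) = on1 T G \<odot> on1 T F) \<and>
     (\<forall>P R F. cell1_in P R F \<longrightarrow> on2 T (id2 F) = id2 (on1 T F)) \<and>
     (\<forall>P R F G H \<theta> \<psi>. cell2_in P R F G \<theta> \<and> cell2_in P R G H \<psi> \<longrightarrow>
        on2 T (vcomp \<psi> \<theta>) = vcomp (on2 T \<psi>) (on2 T \<theta>)) \<and>
     (\<forall>P R S F G H K \<theta> \<psi>. cell2_in P R F G \<theta> \<and> cell2_in R S H K \<psi> \<longrightarrow>
        on2 T (hcomp \<psi> \<theta>) = hcomp (on2 T \<psi>) (on2 T \<theta>))"

definition id_fun2 :: "('o, 'a, 'p) fun2" where
  "id_fun2 = \<lparr> on0 = (\<lambda>P. P), on1 = (\<lambda>F. F), on2 = (\<lambda>\<theta>. \<theta>) \<rparr>"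

definition comp_fun2 ::
    "('o, 'a, 'p, 'm) fun2_scheme \<Rightarrow> ('o, 'a, 'p, 'n) fun2_scheme \<Rightarrow> ('o, 'a, 'p) fun2" where
  "comp_fun2 S T = \<lparr> on0 = on0 S \<circ> on0 T, on1 = on1 S \<circ> on1 T, on2 = on2 S \<circ> on2 T \<rparr>"

definition two_natural ::
    "('o, 'a, 'p, 'm) fun2_scheme \<Rightarrow> ('o, 'a, 'p, 'n) fun2_scheme \<Rightarrow>
     (('o, 'a, 'p) doctrine \<Rightarrow> ('o, 'a, 'p) cell1) \<Rightarrow> bool" where
  "two_natural S T \<sigma> \<longleftrightarrow>
     (\<forall>P. elementary_doctrine P \<longrightarrow> cell1_in (on0 S P) (on0 T P) (\<sigma> P)) \<and>
     (\<forall>P R F. cell1_in P R F \<longrightarrow> \<sigma> R \<odot> on1 S F = on1 T F \<odot> \<sigma> P) \<and>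
     (\<forall>P R F G \<theta>. cell2_in P R F G \<theta> \<longrightarrow>
        hcomp (id2 (\<sigma> R)) (on2 S \<theta>) = hcomp (on2 T \<theta>) (id2 (\<sigma> P)))"

record ('o, 'a, 'p) monad2 = "('o, 'a, 'p) fun2" +
  Unit :: "('o, 'a, 'p) doctrine \<Rightarrow> ('o, 'a, 'p) cell1"
  Mult :: "('o, 'a, 'p) doctrine \<Rightarrow> ('o, 'a, 'p) cell1"

definition two_monad :: "('o, 'a, 'p) monad2 \<Rightarrow> bool" where
  "two_monad T \<longleftrightarrow>
     two_functor T \<and>
     two_natural id_fun2 T (Unit T) \<and>
     two_natural (comp_fun2 T T) T (Mult T) \<and>
     (\<forall>P. elementary_doctrine P \<longrightarrow>
        Mult T P \<odot> Mult T (on0 T P) = Mult T P \<odot> on1 T (Mult T P) \<and>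
        Mult T P \<odot> Unit T (on0 T P) = id1 (on0 T P) \<and>
        Mult T P \<odot> on1 T (Unit T P) = id1 (on0 T P))"

definition distributive_law ::
    "('o, 'a, 'p) monad2 \<Rightarrow> ('o, 'a, 'p) monad2 \<Rightarrow>
     (('o, 'a, 'p) doctrine \<Rightarrow> ('o, 'a, 'p) cell1) \<Rightarrow> bool" where
  "distributive_law S T \<delta> \<longleftrightarrow>
     two_monad S \<and> two_monad T \<and>
     two_natural (comp_fun2 S T) (comp_fun2 T S) \<delta> \<and>
     (\<forall>P. elementary_doctrine P \<longrightarrow>
        \<delta> P \<odot> Mult S (on0 T P) = on1 T (Mult S P) \<odot> \<delta> (on0 S P) \<odot> on1 S (\<delta> P) \<and>
        \<delta> P \<odot> on1 S (Mult T P) = Mult T (on0 S P) \<odot> on1 T (\<delta> P) \<odot> \<delta> (on0 T P) \<and>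
        \<delta> P \<odot> Unit S (on0 T P) = on1 T (Unit S P) \<and>
        \<delta> P \<odot> on1 S (Unit T P) = Unit T (on0 S P))"


section \<open>A universe closed under both completions\<close>

text \<open>Both completions form pairs \<open>(A, \<alpha>)\<close> of an object and an element of a fibre.  For the
  completions to be endofunctors of one 2-category, objects and arrows are taken from types closed
  under this pairing: \<open>Ext A \<alpha>\<close> is the pair \<open>(A, \<alpha>)\<close>, and \<open>AExt X f Y\<close> is the arrow \<open>X \<rightarrow> Y\<close> of the
  completed category whose underlying arrow is \<open>f\<close>.  The parameter types are arbitrary, and
  \<open>Base\<close> and \<open>ABase\<close> embed any given types of objects and of arrows.\<close>

datatype ('o, 'p) obj = Base 'o | Ext (under: "('o, 'p) obj") (elt: 'p)

datatype ('o, 'a, 'p) arr =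
  ABase 'a | AExt (asrc: "('o, 'p) obj") (aunder: "('o, 'a, 'p) arr") (atgt: "('o, 'p) obj")

type_synonym ('o, 'a, 'p) ed = "(('o, 'p) obj, ('o, 'a, 'p) arr, 'p) doctrine"
type_synonym ('o, 'a, 'p) ed1 = "(('o, 'p) obj, ('o, 'a, 'p) arr, 'p) cell1"
type_synonym ('o, 'a, 'p) ed2 = "(('o, 'p) obj, ('o, 'a, 'p) arr, 'p) cell2"
type_synonym ('o, 'a, 'p) ed_monad = "(('o, 'p) obj, ('o, 'a, 'p) arr, 'p) monad2"

text \<open>The action on arrows (resp. on components of 2-cells) of everything that is ``the identity
  on arrows'' only re-tags domain and codomain.  The unit re-tags by a map \<open>h\<close> on objects; the
  multiplication forgets the intermediate layer.\<close>

definition unit_arr ::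
    "('o, 'a, 'p) ed \<Rightarrow> (('o, 'p) obj \<Rightarrow> ('o, 'p) obj) \<Rightarrow> ('o, 'a, 'p) arr \<Rightarrow> ('o, 'a, 'p) arr" where
  "unit_arr P h f = AExt (h (Dom P f)) f (h (Cod P f))"

definition mult_obj :: "('o, 'p) obj \<Rightarrow> ('o, 'p) obj" where
  "mult_obj X = Ext (under (under X)) (elt X)"

definition mult_arr :: "('o, 'a, 'p) arr \<Rightarrow> ('o, 'a, 'p) arr" where
  "mult_arr u = AExt (mult_obj (asrc u)) (aunder (aunder u)) (mult_obj (atgt u))"


section \<open>The comprehension completion\<close>

text \<open>The underlying chosen product of \<open>(A, \<alpha>)\<close> and \<open>(B, \<beta>)\<close> is the chosen product \<open>A \<times> B\<close>.\<close>

definition prod_c :: "('o, 'a, 'p) ed \<Rightarrow> ('o, 'p) obj \<Rightarrow> ('o, 'p) obj \<Rightarrow> ('o, 'p) obj" where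
  "prod_c P X Y = (let A = under X; B = under Y in
     Ext (Prod P A B)
       (Re P (Pr1 P A B) (elt X) \<sqinter>\<^bsub>Fib P (Prod P A B)\<^esub> Re P (Pr2 P A B) (elt Y)))"

definition Tc0 :: "('o, 'a, 'p) ed \<Rightarrow> ('o, 'a, 'p) ed" where
  "Tc0 P =
     \<lparr> Obj = {Ext A \<alpha> | A \<alpha>. A \<in> Obj P \<and> \<alpha> \<in> carrier (Fib P A)},
       Arr = {AExt (Ext A \<alpha>) f (Ext B \<beta>) | A \<alpha> f B \<beta>.
                A \<in> Obj P \<and> \<alpha> \<in> carrier (Fib P A) \<and> B \<in> Obj P \<and> \<beta> \<in> carrier (Fib P B) \<and>
                f \<in> hom P A B \<and> \<alpha> \<sqsubseteq>\<^bsub>Fib P A\<^esub> Re P f \<beta>},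
       Dom = asrc,
       Cod = atgt,
       Ide = (\<lambda>X. AExt X (Ide P (under X)) X),
       Comp = (\<lambda>v u. AExt (asrc u) (Comp P (aunder v) (aunder u)) (atgt v)),
       Prod = prod_c P,
       Pr1 = (\<lambda>X Y. AExt (prod_c P X Y) (Pr1 P (under X) (under Y)) X),
       Pr2 = (\<lambda>X Y. AExt (prod_c P X Y) (Pr2 P (under X) (under Y)) Y),
       Fib = (\<lambda>X. (Fib P (under X))
                \<lparr> carrier := {\<gamma> \<in> carrier (Fib P (under X)). \<gamma> \<sqsubseteq>\<^bsub>Fib P (under X)\<^esub> elt X} \<rparr>),
       Re = (\<lambda>u \<gamma>. Re P (aunder u) \<gamma> \<sqinter>\<^bsub>Fib P (under (asrc u))\<^esub> elt (asrc u)) \<rparr>"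

definition obj_c :: "('o, 'a, 'p) ed1 \<Rightarrow> ('o, 'p) obj \<Rightarrow> ('o, 'p) obj" where
  "obj_c F X = Ext (OMap F (under X)) (FMap F (under X) (elt X))"

definition Tc1 :: "('o, 'a, 'p) ed1 \<Rightarrow> ('o, 'a, 'p) ed1" where
  "Tc1 F = mk1 (Tc0 (Src1 F)) (Tc0 (Tgt1 F))
     (obj_c F)
     (\<lambda>u. AExt (obj_c F (asrc u)) (AMap F (aunder u)) (obj_c F (atgt u)))
     (\<lambda>X. FMap F (under X))"

definition Tc2 :: "('o, 'a, 'p) ed2 \<Rightarrow> ('o, 'a, 'p) ed2" where
  "Tc2 \<theta> = mk2 (Tc1 (Src2 \<theta>)) (Tc1 (Tgt2 \<theta>))
     (\<lambda>X. AExt (obj_c (Src2 \<theta>) X) (Cmp \<theta> (under X)) (obj_c (Tgt2 \<theta>) X))"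

definition unit_c_obj :: "('o, 'a, 'p) ed \<Rightarrow> ('o, 'p) obj \<Rightarrow> ('o, 'p) obj" where
  "unit_c_obj P A = Ext A \<top>\<^bsub>Fib P A\<^esub>"

definition Tc :: "('o, 'a, 'p) ed_monad" where
  "Tc =
     \<lparr> on0 = Tc0, on1 = Tc1, on2 = Tc2,
       Unit = (\<lambda>P. mk1 P (Tc0 P) (unit_c_obj P) (unit_arr P (unit_c_obj P)) (\<lambda>A \<alpha>. \<alpha>)),
       Mult = (\<lambda>P. mk1 (Tc0 (Tc0 P)) (Tc0 P) mult_obj mult_arr (\<lambda>X \<gamma>. \<gamma>)) \<rparr>"


section \<open>The quotient completion\<close>

definition equivalence_rel :: "('o, 'a, 'p) doctrine \<Rightarrow> 'o \<Rightarrow> 'p \<Rightarrow> bool" where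
  "equivalence_rel P A \<rho> \<longleftrightarrow>
     \<rho> \<in> carrier (Fib P (Prod P A A)) \<and>
     delta P A \<sqsubseteq>\<^bsub>Fib P (Prod P A A)\<^esub> \<rho> \<and>
     \<rho> \<sqsubseteq>\<^bsub>Fib P (Prod P A A)\<^esub> Re P (tuple P (Pr2 P A A) (Pr1 P A A)) \<rho> \<and>
     Re P (tuple P (pr31 P A A A) (pr32 P A A A)) \<rho>
       \<sqinter>\<^bsub>Fib P (Prod3 P A A A)\<^esub> Re P (tuple P (pr32 P A A A) (pr33 P A A A)) \<rho>
       \<sqsubseteq>\<^bsub>Fib P (Prod3 P A A A)\<^esub> Re P (tuple P (pr31 P A A A) (pr33 P A A A)) \<rho>"

definition Des :: "('o, 'a, 'p) doctrine \<Rightarrow> 'o \<Rightarrow> 'p \<Rightarrow> 'p set" where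
  "Des P A \<rho> = {\<alpha> \<in> carrier (Fib P A).
     Re P (Pr1 P A A) \<alpha> \<sqinter>\<^bsub>Fib P (Prod P A A)\<^esub> \<rho> \<sqsubseteq>\<^bsub>Fib P (Prod P A A)\<^esub> Re P (Pr2 P A A) \<alpha>}"

text \<open>The underlying chosen product of \<open>(A, \<rho>)\<close> and \<open>(B, \<sigma>)\<close> is \<open>A \<times> B\<close>, with the relation
  \<open>\<rho>(a, a') \<and> \<sigma>(b, b')\<close> on pairs \<open>(a, b)\<close>, \<open>(a', b')\<close>.\<close>

definition prod_q :: "('o, 'a, 'p) ed \<Rightarrow> ('o, 'p) obj \<Rightarrow> ('o, 'p) obj \<Rightarrow> ('o, 'p) obj" where
  "prod_q P X Y = (let A = under X; B = under Y in
     Ext (Prod P A B)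
       (Re P (cross P (Pr1 P A B) (Pr1 P A B)) (elt X)
         \<sqinter>\<^bsub>Fib P (Prod P (Prod P A B) (Prod P A B))\<^esub>
        Re P (cross P (Pr2 P A B) (Pr2 P A B)) (elt Y)))"

definition Tq0 :: "('o, 'a, 'p) ed \<Rightarrow> ('o, 'a, 'p) ed" where
  "Tq0 P =
     \<lparr> Obj = {Ext A \<rho> | A \<rho>. A \<in> Obj P \<and> equivalence_rel P A \<rho>},
       Arr = {AExt (Ext A \<rho>) f (Ext B \<sigma>) | A \<rho> f B \<sigma>.
                A \<in> Obj P \<and> equivalence_rel P A \<rho> \<and> B \<in> Obj P \<and> equivalence_rel P B \<sigma> \<and>
                f \<in> hom P A B \<and> \<rho> \<sqsubseteq>\<^bsub>Fib P (Prod P A A)\<^esub> Re P (cross P f f) \<sigma>},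
       Dom = asrc,
       Cod = atgt,
       Ide = (\<lambda>X. AExt X (Ide P (under X)) X),
       Comp = (\<lambda>v u. AExt (asrc u) (Comp P (aunder v) (aunder u)) (atgt v)),
       Prod = prod_q P,
       Pr1 = (\<lambda>X Y. AExt (prod_q P X Y) (Pr1 P (under X) (under Y)) X),
       Pr2 = (\<lambda>X Y. AExt (prod_q P X Y) (Pr2 P (under X) (under Y)) Y),
       Fib = (\<lambda>X. (Fib P (under X)) \<lparr> carrier := Des P (under X) (elt X) \<rparr>),
       Re = (\<lambda>u. Re P (aunder u)) \<rparr>"

definition obj_q :: "('o, 'a, 'p) ed1 \<Rightarrow> ('o, 'p) obj \<Rightarrow> ('o, 'p) obj" where
  "obj_q F X = (let P = Src1 F; R = Tgt1 F; A = under X in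
     Ext (OMap F A)
       (Re R (inv_arr R (tuple R (AMap F (Pr1 P A A)) (AMap F (Pr2 P A A))))
         (FMap F (Prod P A A) (elt X))))"

definition Tq1 :: "('o, 'a, 'p) ed1 \<Rightarrow> ('o, 'a, 'p) ed1" where
  "Tq1 F = mk1 (Tq0 (Src1 F)) (Tq0 (Tgt1 F))
     (obj_q F)
     (\<lambda>u. AExt (obj_q F (asrc u)) (AMap F (aunder u)) (obj_q F (atgt u)))
     (\<lambda>X. FMap F (under X))"

definition Tq2 :: "('o, 'a, 'p) ed2 \<Rightarrow> ('o, 'a, 'p) ed2" where
  "Tq2 \<theta> = mk2 (Tq1 (Src2 \<theta>)) (Tq1 (Tgt2 \<theta>))
     (\<lambda>X. AExt (obj_q (Src2 \<theta>) X) (Cmp \<theta> (under X)) (obj_q (Tgt2 \<theta>) X))"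

definition unit_q_obj :: "('o, 'a, 'p) ed \<Rightarrow> ('o, 'p) obj \<Rightarrow> ('o, 'p) obj" where
  "unit_q_obj P A = Ext A (delta P A)"

definition Tq :: "('o, 'a, 'p) ed_monad" where
  "Tq =
     \<lparr> on0 = Tq0, on1 = Tq1, on2 = Tq2,
       Unit = (\<lambda>P. mk1 P (Tq0 P) (unit_q_obj P) (unit_arr P (unit_q_obj P)) (\<lambda>A \<alpha>. \<alpha>)),
       Mult = (\<lambda>P. mk1 (Tq0 (Tq0 P)) (Tq0 P) mult_obj mult_arr (\<lambda>X \<gamma>. \<gamma>)) \<rparr>"

end

theory Submission
  imports Defs
begin

text \<open>
  An object of \<open>(P\<^sub>q)\<^sub>c\<close> is a subobject of a quotient: a triple \<open>((A, \<rho>), \<alpha>)\<close> with \<open>\<rho>\<close> an equivalence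
  relation on \<open>A\<close> and \<open>\<alpha>\<close> an element that descends along \<open>\<rho>\<close>. The distributive law sends it to the
  quotient of the subobject, \<open>((A, \<alpha>), \<rho> \<sqinter> (\<alpha> \<times> \<alpha>))\<close> in \<open>(P\<^sub>c)\<^sub>q\<close>, and is the identity on arrows and on
  elements of fibres. This is possible because the two objects have literally the same fibre: as
  \<open>\<alpha>\<close> descends along \<open>\<rho>\<close>, an element below \<open>\<alpha>\<close> descends along \<open>\<rho>\<close> exactly if it descends along the
  restriction of \<open>\<rho>\<close> to \<open>\<alpha>\<close> (\<open>Des_law_obj\<close>). The assignment preserves the chosen products (\<open>law_prod\<close>), so
  it is a 1-cell (\<open>law_retagging\<close>). It is natural because 1-cells commute with finite meets and
  reindexing (\<open>law_obj_natural\<close>). In each of the four axioms all 1-cells are the identity on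
  underlying arrows and on elements, so only objects have to be compared: restricting to \<open>\<top>\<close>
  does nothing, the restriction of \<open>\<delta>\<^sub>A\<close> is the equality of \<open>(A, \<alpha>)\<close>, restricting to \<open>\<alpha>\<close> and then
  to a smaller \<open>\<beta>\<close> is restricting to \<open>\<beta>\<close>, and restriction is the same operation in \<open>P\<close> and in
  \<open>P\<^sub>q\<close>.

  The larger part of the work is to show that the two completions are 2-monads
  (\<open>Tc_two_monad\<close>, \<open>Tq_two_monad\<close>). What they share, namely that only objects carry new data, is
  isolated in the locales \<open>lifted_category\<close>, \<open>lifting_two_functor\<close> and \<open>lifting_two_monad\<close>.

  Relations are handled through generalized elements. An arrow \<open>f : Y \<rightarrow> A\<close> is an element of \<open>A\<close> in
  context \<open>Y\<close>, and a relation \<open>\<rho>\<close> on \<open>A\<close> is evaluated at \<open>f, g\<close> by reindexing along \<open>\<langle>f, g\<rangle>\<close>.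
  Inequalities are tested on the elements of the fibre below the left-hand side (\<open>leI\<close>). In these
  terms the adjunctions that define equality say that it is reflexive and substitutive
  (\<open>is_delta_iff\<close>), from which the equality predicates of the completions, symmetry, transitivity and
  the equality of pairs follow by substitution as in first-order logic. A 1-cell preserves products
  only up to isomorphism, so its action on relations involves an inverse; it is characterized by
  \<open>rel_image_unique\<close> and used through the fact that pairs of elements of \<open>F A\<close> are elements of
  \<open>F (A \<times> A)\<close> (\<open>pair_factor\<close>, \<open>FMap_le_apply\<close>).
\<close>

section \<open>Finite-meet posets\<close>

lemma infsl_orderD:
  assumes "infsl L"
  shows "partial_order L"
    and "\<And>x. x \<in> carrier L \<Longrightarrow> x \<sqsubseteq>\<^bsub>L\<^esub> x"
    and "\<And>x y z. \<lbrakk>x \<sqsubseteq>\<^bsub>L\<^esub> y; y \<sqsubseteq>\<^bsub>L\<^esub> z; x \<in> carrier L; y \<in> carrier L; z \<in> carrier L\<rbrakk> \<Longrightarrow> x \<sqsubseteq>\<^bsub>L\<^esub> z"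
    and "\<And>x y. \<lbrakk>x \<sqsubseteq>\<^bsub>L\<^esub> y; y \<sqsubseteq>\<^bsub>L\<^esub> x; x \<in> carrier L; y \<in> carrier L\<rbrakk> \<Longrightarrow> x = y"
    and "\<And>x y. \<lbrakk>x \<in> carrier L; y \<in> carrier L\<rbrakk> \<Longrightarrow> x \<sqinter>\<^bsub>L\<^esub> y \<in> carrier L"
    and "\<And>x y z. \<lbrakk>x \<in> carrier L; y \<in> carrier L; z \<in> carrier L\<rbrakk> \<Longrightarrow>
      z \<sqsubseteq>\<^bsub>L\<^esub> x \<sqinter>\<^bsub>L\<^esub> y \<longleftrightarrow> z \<sqsubseteq>\<^bsub>L\<^esub> x \<and> z \<sqsubseteq>\<^bsub>L\<^esub> y"
    and "\<top>\<^bsub>L\<^esub> \<in> carrier L"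
    and "\<And>x. x \<in> carrier L \<Longrightarrow> x \<sqsubseteq>\<^bsub>L\<^esub> \<top>\<^bsub>L\<^esub>"
proof -
  interpret lower_semilattice L using assms by (simp add: infsl_def)
  interpret weak_partial_order_top L using assms by (simp add: infsl_def)
  show "partial_order L" ..
  show "\<And>x. x \<in> carrier L \<Longrightarrow> x \<sqsubseteq>\<^bsub>L\<^esub> x" by simp
  show "\<And>x y z. \<lbrakk>x \<sqsubseteq>\<^bsub>L\<^esub> y; y \<sqsubseteq>\<^bsub>L\<^esub> z; x \<in> carrier L; y \<in> carrier L; z \<in> carrier L\<rbrakk> \<Longrightarrow> x \<sqsubseteq>\<^bsub>L\<^esub> z"
    by (rule le_trans)
  show "\<And>x y. \<lbrakk>x \<sqsubseteq>\<^bsub>L\<^esub> y; y \<sqsubseteq>\<^bsub>L\<^esub> x; x \<in> carrier L; y \<in> carrier L\<rbrakk> \<Longrightarrow> x = y"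
    by (rule le_antisym)
  show "\<And>x y. \<lbrakk>x \<in> carrier L; y \<in> carrier L\<rbrakk> \<Longrightarrow> x \<sqinter>\<^bsub>L\<^esub> y \<in> carrier L" by simp
  show "\<And>x y z. \<lbrakk>x \<in> carrier L; y \<in> carrier L; z \<in> carrier L\<rbrakk> \<Longrightarrow>
      z \<sqsubseteq>\<^bsub>L\<^esub> x \<sqinter>\<^bsub>L\<^esub> y \<longleftrightarrow> z \<sqsubseteq>\<^bsub>L\<^esub> x \<and> z \<sqsubseteq>\<^bsub>L\<^esub> y"
    by (meson meet_closed meet_left meet_right meet_le le_trans)
  show "\<top>\<^bsub>L\<^esub> \<in> carrier L" by simp
  show "\<And>x. x \<in> carrier L \<Longrightarrow> x \<sqsubseteq>\<^bsub>L\<^esub> \<top>\<^bsub>L\<^esub>" by (rule top_higher)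
qed

text \<open>A fibre of the comprehension completion is a down-set of a fibre of \<open>P\<close>, one of the quotient
  completion a set of descent data. In both cases the meets are those of \<open>P\<close> because the subset is
  closed under them; only the top element may change.\<close>

lemma infsl_subposet:
  fixes L :: "'p gorder"
  assumes L: "infsl L" and sub: "S \<subseteq> carrier L"
    and meet: "\<And>x y. x \<in> S \<Longrightarrow> y \<in> S \<Longrightarrow> x \<sqinter>\<^bsub>L\<^esub> y \<in> S"
    and top: "t \<in> S" "\<And>x. x \<in> S \<Longrightarrow> x \<sqsubseteq>\<^bsub>L\<^esub> t"
  shows "infsl (L\<lparr>carrier := S\<rparr>)"
    and "\<And>x y. x \<in> S \<Longrightarrow> y \<in> S \<Longrightarrow> x \<sqinter>\<^bsub>L\<lparr>carrier := S\<rparr>\<^esub> y = x \<sqinter>\<^bsub>L\<^esub> y"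
    and "\<top>\<^bsub>L\<lparr>carrier := S\<rparr>\<^esub> = t"
proof -
  note D = infsl_orderD[OF L]
  let ?M = "L\<lparr>carrier := S\<rparr>"
  have c: "\<And>x. x \<in> S \<Longrightarrow> x \<in> carrier L" using sub by auto
  have eq: "eq L = (=)" using D(1) by (rule partial_order.eq_is_equal)
  have po: "partial_order ?M"
    by unfold_locales (auto simp: eq intro: D(2) D(4) c dest: D(3)[OF _ _ c c c])
  have gr: "greatest ?M (x \<sqinter>\<^bsub>L\<^esub> y) (Lower ?M {x, y})" if "x \<in> S" "y \<in> S" for x y
    using that D(2)[of "x \<sqinter>\<^bsub>L\<^esub> y"] D(6)[of x y] c meet[of x y]
    by (fastforce simp: greatest_def Lower_def)
  have ls: "lower_semilattice ?M"
    using po gr by (simp add: lower_semilattice_def lower_semilattice_axioms_def) blast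
  interpret M: lower_semilattice ?M by (rule ls)
  have gt: "greatest ?M t (carrier ?M)" using top by (simp add: greatest_def)
  show "infsl ?M"
    unfolding infsl_def using ls gt M.weak_partial_order_axioms
    by (auto simp: weak_partial_order_top_def weak_partial_order_top_axioms_def)
  note DM = infsl_orderD[OF this]
  show "\<And>x y. x \<in> S \<Longrightarrow> y \<in> S \<Longrightarrow> x \<sqinter>\<^bsub>?M\<^esub> y = x \<sqinter>\<^bsub>L\<^esub> y"
  proof -
    fix x y assume xy: "x \<in> S" "y \<in> S"
    have m: "x \<sqinter>\<^bsub>?M\<^esub> y \<in> S" using DM(5)[of x y] xy by simp
    show "x \<sqinter>\<^bsub>?M\<^esub> y = x \<sqinter>\<^bsub>L\<^esub> y"
      apply (rule D(4))
      using DM(6)[of x y "x \<sqinter>\<^bsub>?M\<^esub> y"] DM(6)[of x y "x \<sqinter>\<^bsub>L\<^esub> y"] D(6)[of x y "x \<sqinter>\<^bsub>?M\<^esub> y"]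
        D(6)[of x y "x \<sqinter>\<^bsub>L\<^esub> y"] D(2)  DM(2)[of "x \<sqinter>\<^bsub>?M\<^esub> y"] m xy meet[of x y] c by auto
  qed
  show "\<top>\<^bsub>?M\<^esub> = t"
    using DM(4)[of "\<top>\<^bsub>?M\<^esub>" t] top DM(7) DM(8)[of t] by simp
qed

section \<open>Categories with chosen products\<close>

locale prod_category =
  fixes C :: "('o, 'a, 'm) pcat_scheme"
  assumes category_with_products: "category_with_products C"
begin

lemma category: "category C"
  using category_with_products by (simp add: category_with_products_def)

lemma product_Prod:
  "A \<in> Obj C \<Longrightarrow> B \<in> Obj C \<Longrightarrow> is_product C A B (Prod C A B) (Pr1 C A B) (Pr2 C A B)"
  using category_with_products by (simp add: category_with_products_def)

lemma arr_simps [simp]: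
  "f \<in> Arr C \<Longrightarrow> Dom C f \<in> Obj C" "f \<in> Arr C \<Longrightarrow> Cod C f \<in> Obj C"
  "A \<in> Obj C \<Longrightarrow> Ide C A \<in> Arr C" "A \<in> Obj C \<Longrightarrow> Dom C (Ide C A) = A"
  "A \<in> Obj C \<Longrightarrow> Cod C (Ide C A) = A"
  "f \<in> Arr C \<Longrightarrow> g \<in> Arr C \<Longrightarrow> Dom C g = Cod C f \<Longrightarrow> Comp C g f \<in> Arr C"
  "f \<in> Arr C \<Longrightarrow> g \<in> Arr C \<Longrightarrow> Dom C g = Cod C f \<Longrightarrow> Dom C (Comp C g f) = Dom C f"
  "f \<in> Arr C \<Longrightarrow> g \<in> Arr C \<Longrightarrow> Dom C g = Cod C f \<Longrightarrow> Cod C (Comp C g f) = Cod C g"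
  "f \<in> Arr C \<Longrightarrow> Dom C f = A \<Longrightarrow> Comp C f (Ide C A) = f"
  "f \<in> Arr C \<Longrightarrow> Cod C f = A \<Longrightarrow> Comp C (Ide C A) f = f"
  "f \<in> Arr C \<Longrightarrow> g \<in> Arr C \<Longrightarrow> h \<in> Arr C \<Longrightarrow> Dom C g = Cod C f \<Longrightarrow> Dom C h = Cod C g \<Longrightarrow>
     Comp C (Comp C h g) f = Comp C h (Comp C g f)"
  using category unfolding category_def hom_def by auto

lemma prod_simps [simp]:
  assumes "A \<in> Obj C" "B \<in> Obj C"
  shows "Prod C A B \<in> Obj C" "Pr1 C A B \<in> Arr C" "Pr2 C A B \<in> Arr C"
    "Dom C (Pr1 C A B) = Prod C A B" "Dom C (Pr2 C A B) = Prod C A B"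
    "Cod C (Pr1 C A B) = A" "Cod C (Pr2 C A B) = B"
  using product_Prod[OF assms] by (auto simp: is_product_def hom_def)

lemma tuple_props:
  assumes "f \<in> Arr C" "g \<in> Arr C" "Dom C f = Dom C g"
  shows "tuple C f g \<in> hom C (Dom C f) (Prod C (Cod C f) (Cod C g)) \<and>
     Comp C (Pr1 C (Cod C f) (Cod C g)) (tuple C f g) = f \<and>
     Comp C (Pr2 C (Cod C f) (Cod C g)) (tuple C f g) = g"
proof -
  have "\<exists>!h. h \<in> hom C (Dom C f) (Prod C (Cod C f) (Cod C g)) \<and>
     Comp C (Pr1 C (Cod C f) (Cod C g)) h = f \<and> Comp C (Pr2 C (Cod C f) (Cod C g)) h = g"
    using product_Prod[of "Cod C f" "Cod C g"] assms by (auto simp: is_product_def hom_def)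
  from theI'[OF this] show ?thesis by (simp only: tuple_def)
qed

lemma tuple_simps [simp]:
  assumes "f \<in> Arr C" "g \<in> Arr C" "Dom C f = Dom C g"
  shows "tuple C f g \<in> Arr C" "Dom C (tuple C f g) = Dom C g"
    "Cod C (tuple C f g) = Prod C (Cod C f) (Cod C g)"
    "Cod C f = A \<Longrightarrow> Cod C g = B \<Longrightarrow> Comp C (Pr1 C A B) (tuple C f g) = f"
    "Cod C f = A \<Longrightarrow> Cod C g = B \<Longrightarrow> Comp C (Pr2 C A B) (tuple C f g) = g"
  using tuple_props[OF assms] assms(3) by (auto simp: hom_def)

lemma prod_arr_eqI:
  assumes "A \<in> Obj C" "B \<in> Obj C" "h \<in> Arr C" "k \<in> Arr C" "Dom C h = Dom C k"
    "Cod C h = Prod C A B" "Cod C k = Prod C A B"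
    "Comp C (Pr1 C A B) h = Comp C (Pr1 C A B) k" "Comp C (Pr2 C A B) h = Comp C (Pr2 C A B) k"
  shows "h = k"
proof -
  have "\<exists>!l. l \<in> hom C (Dom C h) (Prod C A B) \<and>
     Comp C (Pr1 C A B) l = Comp C (Pr1 C A B) h \<and> Comp C (Pr2 C A B) l = Comp C (Pr2 C A B) h"
    using product_Prod[of A B] assms unfolding is_product_def
    by (auto simp: hom_def)
  with assms show ?thesis by (auto simp: hom_def)
qed

lemma tuple_comp [simp]:
  assumes "f \<in> Arr C" "g \<in> Arr C" "Dom C f = Dom C g" "h \<in> Arr C" "Cod C h = Dom C g"
  shows "Comp C (tuple C f g) h = tuple C (Comp C f h) (Comp C g h)"
proof -
  have a: "Comp C (Pr1 C (Cod C f) (Cod C g)) (Comp C (tuple C f g) h) = Comp C f h"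
    using assms by (subst arr_simps(11)[symmetric]) simp_all
  have b: "Comp C (Pr2 C (Cod C f) (Cod C g)) (Comp C (tuple C f g) h) = Comp C g h"
    using assms by (subst arr_simps(11)[symmetric]) simp_all
  show ?thesis by (rule prod_arr_eqI[of "Cod C f" "Cod C g"]) (use assms a b in simp_all)
qed

lemma tuple_eta [simp]:
  assumes "A \<in> Obj C" "B \<in> Obj C" "h \<in> Arr C" "Cod C h = Prod C A B"
  shows "tuple C (Comp C (Pr1 C A B) h) (Comp C (Pr2 C A B) h) = h"
  by (rule prod_arr_eqI[of A B]) (use assms in simp_all)

lemma tuple_Pr [simp]:
  assumes "A \<in> Obj C" "B \<in> Obj C"
  shows "tuple C (Pr1 C A B) (Pr2 C A B) = Ide C (Prod C A B)"
  using tuple_eta[OF assms, of "Ide C (Prod C A B)"] assms by simp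

lemma cross_tuple:
  assumes "f \<in> Arr C" "g \<in> Arr C" "Dom C f = A" "Dom C g = B"
  shows "cross C f g = tuple C (Comp C f (Pr1 C A B)) (Comp C g (Pr2 C A B))"
  using assms by (simp add: cross_def)

lemma inv_arr_eq:
  assumes "f \<in> Arr C" "g \<in> Arr C" "Dom C g = Cod C f" "Cod C g = Dom C f"
    "Comp C g f = Ide C (Dom C f)" "Comp C f g = Ide C (Cod C f)"
  shows "inv_arr C f = g"
  unfolding inv_arr_def
proof (rule the_equality)
  show "g \<in> hom C (Cod C f) (Dom C f) \<and> Comp C g f = Ide C (Dom C f) \<and> Comp C f g = Ide C (Cod C f)"
    using assms by (simp add: hom_def)
next
  fix k assume k: "k \<in> hom C (Cod C f) (Dom C f) \<and> Comp C k f = Ide C (Dom C f) \<and> Comp C f k = Ide C (Cod C f)"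
  then have "k = Comp C k (Comp C f g)" using assms by (simp add: hom_def)
  also have "\<dots> = Comp C (Comp C k f) g"
    by (rule arr_simps(11)[symmetric]) (use assms k in \<open>auto simp: hom_def\<close>)
  also have "\<dots> = g" using assms k by (simp add: hom_def)
  finally show "k = g" .
qed

lemma inv_arr_Ide [simp]: "A \<in> Obj C \<Longrightarrow> inv_arr C (Ide C A) = Ide C A"
  by (rule inv_arr_eq) simp_all

lemma is_productE:
  assumes "is_product C A B Q p q" "f \<in> Arr C" "g \<in> Arr C" "Dom C f = Dom C g"
    "Cod C f = A" "Cod C g = B"
  obtains h where "h \<in> Arr C" "Dom C h = Dom C g" "Cod C h = Q" "Comp C p h = f" "Comp C q h = g"
proof -
  have "\<exists>!h. h \<in> hom C (Dom C g) Q \<and> Comp C p h = f \<and> Comp C q h = g"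
    using assms(1)[unfolded is_product_def] assms(2-) by (simp add: hom_def)
  with that show thesis by (auto simp: hom_def)
qed

lemma is_product_arr_eqI:
  assumes "is_product C A B Q p q" "h \<in> Arr C" "k \<in> Arr C" "Dom C h = Dom C k"
    "Cod C h = Q" "Cod C k = Q" "Comp C p h = Comp C p k" "Comp C q h = Comp C q k"
  shows "h = k"
proof -
  have "\<exists>!l. l \<in> hom C (Dom C h) Q \<and> Comp C p l = Comp C p h \<and> Comp C q l = Comp C q h"
    using assms unfolding is_product_def by (auto simp: hom_def)
  with assms show ?thesis by (auto simp: hom_def)
qed

lemma is_product_arrs:
  assumes "is_product C A B Q p q"
  shows "Q \<in> Obj C" "p \<in> Arr C" "q \<in> Arr C" "Dom C p = Q" "Dom C q = Q" "Cod C p = A" "Cod C q = B"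
    "A \<in> Obj C" "B \<in> Obj C"
  using assms by (auto simp: is_product_def hom_def)

text \<open>A 1-cell preserves products only up to the isomorphism \<open>j\<close>. The quotient completion transports
  relations along \<open>j\<close>, which its definition writes as the inverse of the comparison
  \<open>\<langle>p, q\<rangle> : Q \<rightarrow> A \<times> B\<close>.\<close>

lemma is_product_iso:
  assumes "is_product C A B Q p q"
  obtains j where "j \<in> Arr C" "Dom C j = Prod C A B" "Cod C j = Q"
    "Comp C p j = Pr1 C A B" "Comp C q j = Pr2 C A B"
    "Comp C j (tuple C p q) = Ide C Q" "Comp C (tuple C p q) j = Ide C (Prod C A B)"
    "inv_arr C (tuple C p q) = j"
proof -
  note a [simp] = is_product_arrs[OF assms]
  obtain j where j [simp]: "j \<in> Arr C" "Dom C j = Prod C A B" "Cod C j = Q"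
    "Comp C p j = Pr1 C A B" "Comp C q j = Pr2 C A B"
    by (rule is_productE[OF assms, of "Pr1 C A B" "Pr2 C A B"]) simp_all
  have x: "Comp C p (Comp C j (tuple C p q)) = p" "Comp C q (Comp C j (tuple C p q)) = q"
    by (subst arr_simps(11)[symmetric]; simp)+
  have 1: "Comp C j (tuple C p q) = Ide C Q"
    by (rule is_product_arr_eqI[OF assms]) (simp_all add: x del: arr_simps(11))
  have 2: "Comp C (tuple C p q) j = Ide C (Prod C A B)" by simp
  have "inv_arr C (tuple C p q) = j"
    by (rule inv_arr_eq) (use 1 in simp_all)
  with that 1 2 j show thesis by blast
qed

end

section \<open>Reasoning in the fibres of a doctrine\<close>

lemma galois_connectionI:
  assumes "infsl L" "infsl M" "l \<in> carrier L \<rightarrow> carrier M" "u \<in> carrier M \<rightarrow> carrier L"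
    "\<And>x y. x \<in> carrier L \<Longrightarrow> y \<in> carrier M \<Longrightarrow> l x \<sqsubseteq>\<^bsub>M\<^esub> y \<longleftrightarrow> x \<sqsubseteq>\<^bsub>L\<^esub> u y"
  shows "galois_connection \<lparr> orderA = L, orderB = M, lower = l, upper = u \<rparr>"
  using assms
  by (simp add: galois_connection_def connection_def galois_connection_axioms_def infsl_orderD(1))

locale indexed_infsl = prod_category P for P :: "('o, 'a, 'p) doctrine" +
  assumes doctrine: "doctrine P"
begin

abbreviation El :: "'o \<Rightarrow> 'p set" where "El A \<equiv> carrier (Fib P A)"

lemma infsl_Fib: "A \<in> Obj P \<Longrightarrow> infsl (Fib P A)"
  using doctrine by (simp add: doctrine_def)

lemma fib_simps [simp]:
  assumes "A \<in> Obj P"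
  shows "x \<in> El A \<Longrightarrow> x \<sqsubseteq>\<^bsub>Fib P A\<^esub> x"
    "x \<in> El A \<Longrightarrow> y \<in> El A \<Longrightarrow> x \<sqinter>\<^bsub>Fib P A\<^esub> y \<in> El A"
    "x \<in> El A \<Longrightarrow> y \<in> El A \<Longrightarrow> z \<in> El A \<Longrightarrow>
      z \<sqsubseteq>\<^bsub>Fib P A\<^esub> x \<sqinter>\<^bsub>Fib P A\<^esub> y \<longleftrightarrow> z \<sqsubseteq>\<^bsub>Fib P A\<^esub> x \<and> z \<sqsubseteq>\<^bsub>Fib P A\<^esub> y"
    "\<top>\<^bsub>Fib P A\<^esub> \<in> El A"
    "x \<in> El A \<Longrightarrow> x \<sqsubseteq>\<^bsub>Fib P A\<^esub> \<top>\<^bsub>Fib P A\<^esub>"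
  by (rule infsl_orderD[OF infsl_Fib[OF assms]]; assumption)+

lemma le_trans:
  "\<lbrakk>x \<sqsubseteq>\<^bsub>Fib P A\<^esub> y; y \<sqsubseteq>\<^bsub>Fib P A\<^esub> z; A \<in> Obj P; x \<in> El A; y \<in> El A; z \<in> El A\<rbrakk>
    \<Longrightarrow> x \<sqsubseteq>\<^bsub>Fib P A\<^esub> z"
  by (rule infsl_orderD(3)[OF infsl_Fib])

lemma le_antisym:
  "\<lbrakk>x \<sqsubseteq>\<^bsub>Fib P A\<^esub> y; y \<sqsubseteq>\<^bsub>Fib P A\<^esub> x; A \<in> Obj P; x \<in> El A; y \<in> El A\<rbrakk> \<Longrightarrow> x = y"
  by (rule infsl_orderD(4)[OF infsl_Fib])

text \<open>The Yoneda argument in a fibre: \<open>x\<close> is determined by the elements below it. Since a meet on the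
  right of \<open>\<sqsubseteq>\<close> is a conjunction, testing on elements \<open>z\<close> below turns inequalities between
  meets of reindexed elements into propositional logic. Most inequalities below are proved so.\<close>

lemma leI:
  assumes "A \<in> Obj P" "x \<in> El A" "y \<in> El A"
    "\<And>z. z \<in> El A \<Longrightarrow> z \<sqsubseteq>\<^bsub>Fib P A\<^esub> x \<Longrightarrow> z \<sqsubseteq>\<^bsub>Fib P A\<^esub> y"
  shows "x \<sqsubseteq>\<^bsub>Fib P A\<^esub> y"
  by (rule assms(4)) (use assms in simp_all)

lemma eqI:
  assumes "A \<in> Obj P" "x \<in> El A" "y \<in> El A"
    "\<And>z. z \<in> El A \<Longrightarrow> z \<sqsubseteq>\<^bsub>Fib P A\<^esub> x \<longleftrightarrow> z \<sqsubseteq>\<^bsub>Fib P A\<^esub> y"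
  shows "x = y"
  by (rule le_antisym; (rule leI)?) (use assms in simp_all)

lemma top_le_iff:
  "A \<in> Obj P \<Longrightarrow> x \<in> El A \<Longrightarrow> \<top>\<^bsub>Fib P A\<^esub> \<sqsubseteq>\<^bsub>Fib P A\<^esub> x \<longleftrightarrow> x = \<top>\<^bsub>Fib P A\<^esub>"
  by (auto intro: le_antisym[OF fib_simps(5)] le_antisym[OF _ fib_simps(5)])

lemma meet_top [simp]:
  assumes "A \<in> Obj P" "x \<in> El A"
  shows "x \<sqinter>\<^bsub>Fib P A\<^esub> \<top>\<^bsub>Fib P A\<^esub> = x" "\<top>\<^bsub>Fib P A\<^esub> \<sqinter>\<^bsub>Fib P A\<^esub> x = x"
  by (rule eqI[OF assms(1)]; use assms in auto)+

lemma meet_absorb: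
  assumes "A \<in> Obj P" "x \<in> El A" "y \<in> El A" "x \<sqsubseteq>\<^bsub>Fib P A\<^esub> y"
  shows "x \<sqinter>\<^bsub>Fib P A\<^esub> y = x"
  by (rule eqI[OF assms(1)]) (use assms le_trans[OF _ assms(4) assms(1)] in auto)

lemma meet_le:
  assumes "A \<in> Obj P" "x \<in> El A" "y \<in> El A" "c \<in> El A"
  shows "x \<sqsubseteq>\<^bsub>Fib P A\<^esub> c \<Longrightarrow> x \<sqinter>\<^bsub>Fib P A\<^esub> y \<sqsubseteq>\<^bsub>Fib P A\<^esub> c"
    and "y \<sqsubseteq>\<^bsub>Fib P A\<^esub> c \<Longrightarrow> x \<sqinter>\<^bsub>Fib P A\<^esub> y \<sqsubseteq>\<^bsub>Fib P A\<^esub> c"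
  by (rule le_trans[of A _ x]; use assms fib_simps(3)[of A x y "x \<sqinter>\<^bsub>Fib P A\<^esub> y"] in simp)
    (rule le_trans[of A _ y]; use assms fib_simps(3)[of A x y "x \<sqinter>\<^bsub>Fib P A\<^esub> y"] in simp)

lemma downset:
  assumes "A \<in> Obj P" "e \<in> El A"
  shows "infsl ((Fib P A)\<lparr>carrier := {\<gamma> \<in> El A. \<gamma> \<sqsubseteq>\<^bsub>Fib P A\<^esub> e}\<rparr>)"
    and "x \<in> El A \<Longrightarrow> x \<sqsubseteq>\<^bsub>Fib P A\<^esub> e \<Longrightarrow> y \<in> El A \<Longrightarrow> y \<sqsubseteq>\<^bsub>Fib P A\<^esub> e \<Longrightarrow>
      x \<sqinter>\<^bsub>(Fib P A)\<lparr>carrier := {\<gamma> \<in> El A. \<gamma> \<sqsubseteq>\<^bsub>Fib P A\<^esub> e}\<rparr>\<^esub> y = x \<sqinter>\<^bsub>Fib P A\<^esub> y"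
    and "\<top>\<^bsub>(Fib P A)\<lparr>carrier := {\<gamma> \<in> El A. \<gamma> \<sqsubseteq>\<^bsub>Fib P A\<^esub> e}\<rparr>\<^esub> = e"
proof -
  have "{\<gamma> \<in> El A. \<gamma> \<sqsubseteq>\<^bsub>Fib P A\<^esub> e} \<subseteq> El A" by auto
  note I = infsl_subposet[OF infsl_Fib[OF assms(1)] this, where t = e]
  show "infsl ((Fib P A)\<lparr>carrier := {\<gamma> \<in> El A. \<gamma> \<sqsubseteq>\<^bsub>Fib P A\<^esub> e}\<rparr>)"
    by (rule I(1)) (use assms in \<open>simp_all add: meet_le\<close>)
  show "\<top>\<^bsub>(Fib P A)\<lparr>carrier := {\<gamma> \<in> El A. \<gamma> \<sqsubseteq>\<^bsub>Fib P A\<^esub> e}\<rparr>\<^esub> = e"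
    by (rule I(3)) (use assms in \<open>simp_all add: meet_le\<close>)
  show "x \<in> El A \<Longrightarrow> x \<sqsubseteq>\<^bsub>Fib P A\<^esub> e \<Longrightarrow> y \<in> El A \<Longrightarrow> y \<sqsubseteq>\<^bsub>Fib P A\<^esub> e \<Longrightarrow>
      x \<sqinter>\<^bsub>(Fib P A)\<lparr>carrier := {\<gamma> \<in> El A. \<gamma> \<sqsubseteq>\<^bsub>Fib P A\<^esub> e}\<rparr>\<^esub> y = x \<sqinter>\<^bsub>Fib P A\<^esub> y"
    by (rule I(2)) (use assms in \<open>simp_all add: meet_le\<close>)
qed

declare downset(2,3) [simp]

lemma Re_hom: "f \<in> Arr P \<Longrightarrow> infsl_hom (Fib P (Cod P f)) (Fib P (Dom P f)) (Re P f)"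
  using doctrine by (simp add: doctrine_def)

lemma Re_simps [simp]:
  assumes "f \<in> Arr P" "Cod P f = B"
  shows "\<alpha> \<in> El B \<Longrightarrow> Dom P f = A \<Longrightarrow> Re P f \<alpha> \<in> El A"
    "Re P f \<top>\<^bsub>Fib P B\<^esub> = \<top>\<^bsub>Fib P (Dom P f)\<^esub>"
    "\<alpha> \<in> El B \<Longrightarrow> \<beta> \<in> El B \<Longrightarrow>
      Re P f (\<alpha> \<sqinter>\<^bsub>Fib P B\<^esub> \<beta>) = Re P f \<alpha> \<sqinter>\<^bsub>Fib P (Dom P f)\<^esub> Re P f \<beta>"
    "g \<in> Arr P \<Longrightarrow> Dom P g = B \<Longrightarrow> \<alpha> \<in> El (Cod P g) \<Longrightarrow>
      Re P f (Re P g \<alpha>) = Re P (Comp P g f) \<alpha>"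
proof -
  show "\<alpha> \<in> El B \<Longrightarrow> Dom P f = A \<Longrightarrow> Re P f \<alpha> \<in> El A"
    "Re P f \<top>\<^bsub>Fib P B\<^esub> = \<top>\<^bsub>Fib P (Dom P f)\<^esub>"
    "\<alpha> \<in> El B \<Longrightarrow> \<beta> \<in> El B \<Longrightarrow>
      Re P f (\<alpha> \<sqinter>\<^bsub>Fib P B\<^esub> \<beta>) = Re P f \<alpha> \<sqinter>\<^bsub>Fib P (Dom P f)\<^esub> Re P f \<beta>"
    using Re_hom[OF assms(1)] assms(2) by (auto simp: infsl_hom_def)
  show "g \<in> Arr P \<Longrightarrow> Dom P g = B \<Longrightarrow> \<alpha> \<in> El (Cod P g) \<Longrightarrow>
      Re P f (Re P g \<alpha>) = Re P (Comp P g f) \<alpha>"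
    using doctrine assms by (simp add: doctrine_def)
qed

lemma Re_Ide [simp]: "\<alpha> \<in> El A \<Longrightarrow> A \<in> Obj P \<Longrightarrow> Re P (Ide P A) \<alpha> = \<alpha>"
  using doctrine by (simp add: doctrine_def)

lemma Re_mono:
  assumes "f \<in> Arr P" "Cod P f = B" "\<alpha> \<in> El B" "\<beta> \<in> El B" "\<alpha> \<sqsubseteq>\<^bsub>Fib P B\<^esub> \<beta>" "Dom P f = A"
  shows "Re P f \<alpha> \<sqsubseteq>\<^bsub>Fib P A\<^esub> Re P f \<beta>"
proof -
  have [simp]: "B \<in> Obj P" "A \<in> Obj P" using assms by auto
  have "Re P f (\<alpha> \<sqinter>\<^bsub>Fib P B\<^esub> \<beta>) = Re P f \<alpha>" using meet_absorb[of B \<alpha> \<beta>] assms by simp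
  then have "Re P f \<alpha> \<sqinter>\<^bsub>Fib P A\<^esub> Re P f \<beta> = Re P f \<alpha>" using assms by simp
  moreover have "Re P f \<alpha> \<sqinter>\<^bsub>Fib P A\<^esub> Re P f \<beta> \<sqsubseteq>\<^bsub>Fib P A\<^esub> Re P f \<beta>"
    by (rule leI) (use assms in auto)
  ultimately show ?thesis by (simp only:)
qed

text \<open>This is how an entailment is used at a generalized element. Think of \<open>f\<close> as a tuple of terms in
  context \<open>A\<close>: if \<open>\<alpha>\<close> entails \<open>\<beta>\<close>, then \<open>\<beta>(f)\<close> holds wherever \<open>\<alpha>(f)\<close> does.\<close>

lemma Re_le_apply:
  "\<lbrakk>\<alpha> \<sqsubseteq>\<^bsub>Fib P B\<^esub> \<beta>; z \<sqsubseteq>\<^bsub>Fib P A\<^esub> Re P f \<alpha>; f \<in> Arr P; Dom P f = A; Cod P f = B; \<alpha> \<in> El B; \<beta> \<in> El B; z \<in> El A\<rbrakk>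
    \<Longrightarrow> z \<sqsubseteq>\<^bsub>Fib P A\<^esub> Re P f \<beta>"
  by (rule le_trans[OF _ Re_mono[of f B \<alpha> \<beta> A]]) auto

section \<open>Equality as a reflexive and substitutive relation\<close>

text \<open>A relation \<open>d\<close> on \<open>A\<close> is evaluated at arrows \<open>f, g : Y \<rightarrow> A\<close>, regarded as elements of \<open>A\<close> over
  \<open>Y\<close>; the element of the fibre over \<open>Y\<close> obtained by reindexing along \<open>\<langle>f, g\<rangle>\<close> is written
  \<open>d(f, g)\<close> below.\<close>

definition reflexive_on :: "'o \<Rightarrow> 'p \<Rightarrow> bool" where
  "reflexive_on A d \<longleftrightarrow> d \<in> El (Prod P A A) \<and>
     (\<forall>f\<in>Arr P. Cod P f = A \<longrightarrow> Re P (tuple P f f) d = \<top>\<^bsub>Fib P (Dom P f)\<^esub>)"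

text \<open>Leibniz's principle: where \<open>d(f, g)\<close> holds, \<open>\<zeta>(x, f, f)\<close> entails \<open>\<zeta>(x, f, g)\<close>.\<close>

definition substitutive_on :: "'o \<Rightarrow> 'p \<Rightarrow> bool" where
  "substitutive_on A d \<longleftrightarrow> (\<forall>X\<in>Obj P. \<forall>\<zeta>\<in>El (Prod P (Prod P X A) A).
     \<forall>x\<in>Arr P. \<forall>f\<in>Arr P. \<forall>g\<in>Arr P. \<forall>z\<in>El (Dom P f).
       Dom P x = Dom P f \<and> Dom P g = Dom P f \<and> Cod P x = X \<and> Cod P f = A \<and> Cod P g = A \<and>
       z \<sqsubseteq>\<^bsub>Fib P (Dom P f)\<^esub> Re P (tuple P (tuple P x f) f) \<zeta> \<and>
       z \<sqsubseteq>\<^bsub>Fib P (Dom P f)\<^esub> Re P (tuple P f g) d \<longrightarrow>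
       z \<sqsubseteq>\<^bsub>Fib P (Dom P f)\<^esub> Re P (tuple P (tuple P x f) g) \<zeta>)"

lemma substitutive_onD:
  assumes "substitutive_on A d" "Cod P f = A"
    "z \<sqsubseteq>\<^bsub>Fib P Y\<^esub> Re P (tuple P (tuple P x f) f) \<zeta>" "z \<sqsubseteq>\<^bsub>Fib P Y\<^esub> Re P (tuple P f g) d"
    "\<zeta> \<in> El (Prod P (Prod P (Cod P x) A) A)"
    "x \<in> Arr P" "f \<in> Arr P" "g \<in> Arr P" "z \<in> El Y"
    "Dom P x = Y" "Dom P f = Y" "Dom P g = Y" "Cod P g = A"
  shows "z \<sqsubseteq>\<^bsub>Fib P Y\<^esub> Re P (tuple P (tuple P x f) g) \<zeta>"
  using assms(1)[unfolded substitutive_on_def, rule_format, of "Cod P x" \<zeta> x f g z] assms(2-) by simp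

text \<open>Reflexivity is the unit of the first adjunction at \<open>\<top>\<close>, reindexed. Substitutivity is the counit of
  the second adjunction, reindexed along \<open>\<langle>x, f, g\<rangle>\<close>. Conversely, in each adjunction one direction of
  the Galois connection is reindexing along a diagonal, where \<open>d\<close> becomes \<open>\<top>\<close>, and the other is a
  substitution. After this lemma the adjunctions are no longer mentioned.\<close>

lemma is_delta_iff:
  assumes A [simp]: "A \<in> Obj P"
  shows "is_delta P A d \<longleftrightarrow> reflexive_on A d \<and> substitutive_on A d"
proof
  let ?AA = "Prod P A A" and ?D = "tuple P (Ide P A) (Ide P A)"
  assume d: "is_delta P A d"
  then have [simp]: "d \<in> El ?AA" by (simp add: is_delta_def)
  have g1: "galois_connection \<lparr> orderA = Fib P A, orderB = Fib P ?AA,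
         lower = (\<lambda>\<alpha>. Re P (Pr1 P A A) \<alpha> \<sqinter>\<^bsub>Fib P ?AA\<^esub> d), upper = Re P ?D \<rparr>"
    using d by (simp add: is_delta_def)
  have "\<top>\<^bsub>Fib P A\<^esub> \<sqsubseteq>\<^bsub>Fib P A\<^esub> Re P ?D d"
    using galois_connection.galois_property[OF g1, of "\<top>\<^bsub>Fib P A\<^esub>" d] by simp
  then have D: "Re P ?D d = \<top>\<^bsub>Fib P A\<^esub>" by (simp add: top_le_iff)
  have r: "Re P (tuple P f f) d = \<top>\<^bsub>Fib P (Dom P f)\<^esub>" if "f \<in> Arr P" "Cod P f = A" for f
    using arg_cong[OF D, of "Re P f"] that by simp
  then have "reflexive_on A d" by (simp add: reflexive_on_def)
  moreover have "substitutive_on A d"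
    unfolding substitutive_on_def
  proof (intro ballI impI, elim conjE)
    fix X \<zeta> x f g z
    assume X [simp]: "X \<in> Obj P" and a [simp]: "\<zeta> \<in> El (Prod P (Prod P X A) A)" "x \<in> Arr P" "f \<in> Arr P" "g \<in> Arr P"
      "z \<in> El (Dom P f)" "Dom P x = Dom P f" "Dom P g = Dom P f" "Cod P x = X" "Cod P f = A" "Cod P g = A"
      and le: "z \<sqsubseteq>\<^bsub>Fib P (Dom P f)\<^esub> Re P (tuple P (tuple P x f) f) \<zeta>" "z \<sqsubseteq>\<^bsub>Fib P (Dom P f)\<^esub> Re P (tuple P f g) d"
    let ?Q = "Prod P (Prod P X A) A" and ?e = "tuple P (tuple P (Pr1 P X A) (Pr2 P X A)) (Pr2 P X A)"
    let ?l = "\<lambda>\<alpha>. Re P (tuple P (pr31 P X A A) (pr32 P X A A)) \<alpha>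
                  \<sqinter>\<^bsub>Fib P ?Q\<^esub> Re P (tuple P (pr32 P X A A) (pr33 P X A A)) d"
    have g2: "galois_connection \<lparr> orderA = Fib P (Prod P X A), orderB = Fib P ?Q, lower = ?l, upper = Re P ?e \<rparr>"
      using d X unfolding is_delta_def Prod3_def by blast
    have "?l (Re P ?e \<zeta>) \<sqsubseteq>\<^bsub>Fib P ?Q\<^esub> \<zeta>"
      using galois_connection.galois_property[OF g2, of "Re P ?e \<zeta>" \<zeta>] by simp
    then show "z \<sqsubseteq>\<^bsub>Fib P (Dom P f)\<^esub> Re P (tuple P (tuple P x f) g) \<zeta>"
      by (rule Re_le_apply) (use le in \<open>simp_all add: pr31_def pr32_def pr33_def\<close>)
  qed
  ultimately show "reflexive_on A d \<and> substitutive_on A d" ..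
next
  let ?AA = "Prod P A A" and ?D = "tuple P (Ide P A) (Ide P A)"
  assume "reflexive_on A d \<and> substitutive_on A d"
  then have R: "reflexive_on A d" and S: "substitutive_on A d" by auto
  from R have [simp]: "d \<in> El ?AA"
      "\<And>f. f \<in> Arr P \<Longrightarrow> Cod P f = A \<Longrightarrow> Re P (tuple P f f) d = \<top>\<^bsub>Fib P (Dom P f)\<^esub>"
    by (auto simp: reflexive_on_def)
  show "is_delta P A d"
    unfolding is_delta_def Prod3_def
  proof (intro conjI ballI)
    show "d \<in> El ?AA" by simp
    show "galois_connection \<lparr> orderA = Fib P A, orderB = Fib P ?AA,
         lower = (\<lambda>\<alpha>. Re P (Pr1 P A A) \<alpha> \<sqinter>\<^bsub>Fib P ?AA\<^esub> d), upper = Re P ?D \<rparr>"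
    proof (rule galois_connectionI, simp_all add: infsl_Fib)
      fix \<alpha> \<beta> assume [simp]: "\<alpha> \<in> El A" "\<beta> \<in> El ?AA"
      show "Re P (Pr1 P A A) \<alpha> \<sqinter>\<^bsub>Fib P ?AA\<^esub> d \<sqsubseteq>\<^bsub>Fib P ?AA\<^esub> \<beta> \<longleftrightarrow> \<alpha> \<sqsubseteq>\<^bsub>Fib P A\<^esub> Re P ?D \<beta>"
      proof
        assume "Re P (Pr1 P A A) \<alpha> \<sqinter>\<^bsub>Fib P ?AA\<^esub> d \<sqsubseteq>\<^bsub>Fib P ?AA\<^esub> \<beta>"
        then show "\<alpha> \<sqsubseteq>\<^bsub>Fib P A\<^esub> Re P ?D \<beta>" by (rule Re_le_apply) simp_all
      next
        assume le: "\<alpha> \<sqsubseteq>\<^bsub>Fib P A\<^esub> Re P ?D \<beta>"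
        show "Re P (Pr1 P A A) \<alpha> \<sqinter>\<^bsub>Fib P ?AA\<^esub> d \<sqsubseteq>\<^bsub>Fib P ?AA\<^esub> \<beta>"
        proof (rule leI, simp_all, elim conjE)
          fix z assume [simp]: "z \<in> El ?AA" "z \<sqsubseteq>\<^bsub>Fib P ?AA\<^esub> Re P (Pr1 P A A) \<alpha>" "z \<sqsubseteq>\<^bsub>Fib P ?AA\<^esub> d"
          have 1: "z \<sqsubseteq>\<^bsub>Fib P ?AA\<^esub> Re P (Pr1 P A A) (Re P ?D \<beta>)"
            by (rule Re_le_apply[OF le]) simp_all
          \<comment> \<open>Substitute in \<open>\<beta>(a, -)\<close>, with \<open>X = A\<close> and \<open>x = f = a\<close>.\<close>
          let ?z = "Re P (tuple P (Comp P (Pr1 P A A) (Pr1 P ?AA A)) (Pr2 P ?AA A)) \<beta>"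
          have "z \<sqsubseteq>\<^bsub>Fib P ?AA\<^esub> Re P (tuple P (tuple P (Pr1 P A A) (Pr1 P A A)) (Pr2 P A A)) ?z"
            by (rule substitutive_onD[OF S]) (use 1 in simp_all)
          then show "z \<sqsubseteq>\<^bsub>Fib P ?AA\<^esub> \<beta>" by simp
        qed
      qed
    qed
    fix X assume X [simp]: "X \<in> Obj P"
    let ?Q = "Prod P (Prod P X A) A" and ?e = "tuple P (tuple P (Pr1 P X A) (Pr2 P X A)) (Pr2 P X A)"
    let ?l = "\<lambda>\<alpha>. Re P (tuple P (pr31 P X A A) (pr32 P X A A)) \<alpha>
                  \<sqinter>\<^bsub>Fib P ?Q\<^esub> Re P (tuple P (pr32 P X A A) (pr33 P X A A)) d"
    show "galois_connection \<lparr> orderA = Fib P (Prod P X A), orderB = Fib P ?Q, lower = ?l, upper = Re P ?e \<rparr>"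
    proof (rule galois_connectionI, simp_all add: infsl_Fib pr31_def pr32_def pr33_def)
      fix \<alpha> \<beta> assume [simp]: "\<alpha> \<in> El (Prod P X A)" "\<beta> \<in> El ?Q"
      let ?m = "Re P (Pr1 P (Prod P X A) A) \<alpha> \<sqinter>\<^bsub>Fib P ?Q\<^esub>
        Re P (tuple P (Comp P (Pr2 P X A) (Pr1 P (Prod P X A) A)) (Pr2 P (Prod P X A) A)) d"
      let ?e' = "tuple P (Ide P (Prod P X A)) (Pr2 P X A)"
      show "?m \<sqsubseteq>\<^bsub>Fib P ?Q\<^esub> \<beta> \<longleftrightarrow> \<alpha> \<sqsubseteq>\<^bsub>Fib P (Prod P X A)\<^esub> Re P ?e' \<beta>"
      proof
        assume "?m \<sqsubseteq>\<^bsub>Fib P ?Q\<^esub> \<beta>"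
        then show "\<alpha> \<sqsubseteq>\<^bsub>Fib P (Prod P X A)\<^esub> Re P ?e' \<beta>" by (rule Re_le_apply) simp_all
      next
        assume le: "\<alpha> \<sqsubseteq>\<^bsub>Fib P (Prod P X A)\<^esub> Re P ?e' \<beta>"
        show "?m \<sqsubseteq>\<^bsub>Fib P ?Q\<^esub> \<beta>"
        proof (rule leI, simp_all, elim conjE)
          fix z assume [simp]: "z \<in> El ?Q" "z \<sqsubseteq>\<^bsub>Fib P ?Q\<^esub> Re P (Pr1 P (Prod P X A) A) \<alpha>"
            "z \<sqsubseteq>\<^bsub>Fib P ?Q\<^esub> Re P (tuple P (Comp P (Pr2 P X A) (Pr1 P (Prod P X A) A)) (Pr2 P (Prod P X A) A)) d"
          have 1: "z \<sqsubseteq>\<^bsub>Fib P ?Q\<^esub> Re P (Pr1 P (Prod P X A) A) (Re P ?e' \<beta>)"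
            by (rule Re_le_apply[OF le]) simp_all
          have "z \<sqsubseteq>\<^bsub>Fib P ?Q\<^esub> Re P (tuple P (tuple P (Comp P (Pr1 P X A) (Pr1 P (Prod P X A) A))
             (Comp P (Pr2 P X A) (Pr1 P (Prod P X A) A))) (Pr2 P (Prod P X A) A)) \<beta>"
            by (rule substitutive_onD[OF S]) (use 1 in simp_all)
          then show "z \<sqsubseteq>\<^bsub>Fib P ?Q\<^esub> \<beta>" by simp
        qed
      qed
    qed
  qed
qed

text \<open>Here \<open>\<zeta>(u(y, a))\<close> is any property of a term in a variable \<open>a\<close> of \<open>A\<close> and the context \<open>Y\<close>. The
  principle for \<open>\<zeta>(x, a, a')\<close> applies to it with \<open>X = Y\<close> and the property \<open>\<zeta>(u(y, a'))\<close> of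
  \<open>((y, a), a')\<close>, which does not depend on \<open>a\<close>.\<close>

lemma substitutive_on_context:
  assumes S: "substitutive_on A d" and A: "Cod P f = A"
    and u: "u \<in> Arr P" "Dom P u = Prod P Y A" "\<zeta> \<in> El (Cod P u)"
    and le: "z \<sqsubseteq>\<^bsub>Fib P Y\<^esub> Re P (Comp P u (tuple P (Ide P Y) f)) \<zeta>" "z \<sqsubseteq>\<^bsub>Fib P Y\<^esub> Re P (tuple P f g) d"
    and fg: "f \<in> Arr P" "g \<in> Arr P" "z \<in> El Y" "Dom P f = Y" "Dom P g = Y" "Cod P g = A"
  shows "z \<sqsubseteq>\<^bsub>Fib P Y\<^esub> Re P (Comp P u (tuple P (Ide P Y) g)) \<zeta>"
proof -
  have [simp]: "A \<in> Obj P" "Y \<in> Obj P" using fg A by auto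
  let ?k = "Comp P u (tuple P (Comp P (Pr1 P Y A) (Pr1 P (Prod P Y A) A)) (Pr2 P (Prod P Y A) A))"
  have "z \<sqsubseteq>\<^bsub>Fib P Y\<^esub> Re P (tuple P (tuple P (Ide P Y) f) g) (Re P ?k \<zeta>)"
    by (rule substitutive_onD[OF S A]) (use u le fg A in simp_all)
  then show ?thesis using u fg A by simp
qed

text \<open>If \<open>d\<close> is substitutive and \<open>d'\<close> reflexive, replace the second argument in \<open>d'(a, a)\<close>: this gives
  \<open>d \<sqsubseteq> d'\<close>.\<close>

lemma delta_unique:
  assumes A [simp]: "A \<in> Obj P" and d: "is_delta P A d" "is_delta P A d'"
  shows "d = d'"
proof -
  have *: "d \<sqsubseteq>\<^bsub>Fib P (Prod P A A)\<^esub> d'" if d: "is_delta P A d" "is_delta P A d'" for d d'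
  proof (rule leI, simp)
    let ?AA = "Prod P A A"
    have S: "substitutive_on A d" using d is_delta_iff by simp
    have [simp]: "d \<in> El ?AA" "d' \<in> El ?AA" using d by (simp_all add: is_delta_def)
    have [simp]: "\<And>f. f \<in> Arr P \<Longrightarrow> Cod P f = A \<Longrightarrow> Re P (tuple P f f) d' = \<top>\<^bsub>Fib P (Dom P f)\<^esub>"
      using d is_delta_iff by (simp add: reflexive_on_def)
    show "d \<in> El ?AA" "d' \<in> El ?AA" by simp_all
    fix z assume z [simp]: "z \<in> El ?AA" and le: "z \<sqsubseteq>\<^bsub>Fib P ?AA\<^esub> d"
    have "z \<sqsubseteq>\<^bsub>Fib P ?AA\<^esub> Re P (tuple P (tuple P (Pr1 P A A) (Pr1 P A A)) (Pr2 P A A))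
        (Re P (tuple P (Comp P (Pr1 P A A) (Pr1 P ?AA A)) (Pr2 P ?AA A)) d')"
      by (rule substitutive_onD[OF S]) (use le in simp_all)
    then show "z \<sqsubseteq>\<^bsub>Fib P ?AA\<^esub> d'" by simp
  qed
  have "d \<in> El (Prod P A A)" "d' \<in> El (Prod P A A)" using d by (simp_all add: is_delta_def)
  then show ?thesis by (intro le_antisym[OF *[OF d] *[OF d(2,1)]]) simp_all
qed

section \<open>Equivalence relations and descent on generalized elements\<close>

lemma reflexive_onD:
  assumes "reflexive_on A d"
  shows "d \<in> El (Prod P A A)"
    "f \<in> Arr P \<Longrightarrow> Cod P f = A \<Longrightarrow> Re P (tuple P f f) d = \<top>\<^bsub>Fib P (Dom P f)\<^esub>"
  using assms by (auto simp: reflexive_on_def)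

lemma equivalence_rel_el: "equivalence_rel P A \<rho> \<Longrightarrow> \<rho> \<in> El (Prod P A A)"
  by (simp add: equivalence_rel_def)

text \<open>The laws of an equivalence relation and the descent condition are stated on the generic elements
  (the projections). The next lemmas give them the form in which they are used: at arbitrary
  arrows into \<open>A\<close>.\<close>

lemma equivalence_rel_sym:
  assumes "equivalence_rel P A \<rho>" "z \<sqsubseteq>\<^bsub>Fib P Y\<^esub> Re P (tuple P f g) \<rho>" "z \<in> El Y"
    "f \<in> Arr P" "g \<in> Arr P" "Dom P f = Y" "Dom P g = Y" "Cod P f = A" "Cod P g = A"
  shows "z \<sqsubseteq>\<^bsub>Fib P Y\<^esub> Re P (tuple P g f) \<rho>"
proof -
  have [simp]: "A \<in> Obj P" "Y \<in> Obj P" "\<rho> \<in> El (Prod P A A)" using assms by (auto simp: equivalence_rel_def)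
  have "\<rho> \<sqsubseteq>\<^bsub>Fib P (Prod P A A)\<^esub> Re P (tuple P (Pr2 P A A) (Pr1 P A A)) \<rho>"
    using assms(1) by (simp add: equivalence_rel_def)
  then have "z \<sqsubseteq>\<^bsub>Fib P Y\<^esub> Re P (tuple P f g) (Re P (tuple P (Pr2 P A A) (Pr1 P A A)) \<rho>)"
    by (rule Re_le_apply) (use assms in simp_all)
  then show ?thesis using assms by simp
qed

lemma equivalence_rel_trans:
  assumes "equivalence_rel P A \<rho>"
    "z \<sqsubseteq>\<^bsub>Fib P Y\<^esub> Re P (tuple P f g) \<rho>" "z \<sqsubseteq>\<^bsub>Fib P Y\<^esub> Re P (tuple P g h) \<rho>" "z \<in> El Y"
    "f \<in> Arr P" "g \<in> Arr P" "h \<in> Arr P" "Dom P f = Y" "Dom P g = Y" "Dom P h = Y"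
    "Cod P f = A" "Cod P g = A" "Cod P h = A"
  shows "z \<sqsubseteq>\<^bsub>Fib P Y\<^esub> Re P (tuple P f h) \<rho>"
proof -
  have [simp]: "A \<in> Obj P" "Y \<in> Obj P" "\<rho> \<in> El (Prod P A A)" using assms by (auto simp: equivalence_rel_def)
  have "Re P (tuple P (pr31 P A A A) (pr32 P A A A)) \<rho>
       \<sqinter>\<^bsub>Fib P (Prod3 P A A A)\<^esub> Re P (tuple P (pr32 P A A A) (pr33 P A A A)) \<rho>
       \<sqsubseteq>\<^bsub>Fib P (Prod3 P A A A)\<^esub> Re P (tuple P (pr31 P A A A) (pr33 P A A A)) \<rho>"
    using assms(1) by (simp add: equivalence_rel_def)
  then have "z \<sqsubseteq>\<^bsub>Fib P Y\<^esub> Re P (tuple P (tuple P f g) h) (Re P (tuple P (pr31 P A A A) (pr33 P A A A)) \<rho>)"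
    by (rule Re_le_apply) (use assms in \<open>simp_all add: Prod3_def pr31_def pr32_def pr33_def\<close>)
  then show ?thesis using assms by (simp add: Prod3_def pr31_def pr32_def pr33_def)
qed

lemma DesD:
  assumes "\<alpha> \<in> Des P A \<rho>" "z \<sqsubseteq>\<^bsub>Fib P Y\<^esub> Re P f \<alpha>" "z \<sqsubseteq>\<^bsub>Fib P Y\<^esub> Re P (tuple P f g) \<rho>"
    "z \<in> El Y" "\<rho> \<in> El (Prod P A A)" "f \<in> Arr P" "g \<in> Arr P" "Dom P f = Y" "Dom P g = Y"
    "Cod P f = A" "Cod P g = A"
  shows "z \<sqsubseteq>\<^bsub>Fib P Y\<^esub> Re P g \<alpha>"
proof -
  have [simp]: "A \<in> Obj P" "Y \<in> Obj P" "\<alpha> \<in> El A" using assms by (auto simp: Des_def)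
  have "Re P (Pr1 P A A) \<alpha> \<sqinter>\<^bsub>Fib P (Prod P A A)\<^esub> \<rho> \<sqsubseteq>\<^bsub>Fib P (Prod P A A)\<^esub> Re P (Pr2 P A A) \<alpha>"
    using assms(1) by (simp add: Des_def)
  then have "z \<sqsubseteq>\<^bsub>Fib P Y\<^esub> Re P (tuple P f g) (Re P (Pr2 P A A) \<alpha>)"
    by (rule Re_le_apply) (use assms in simp_all)
  then show ?thesis using assms by simp
qed

lemma DesI:
  assumes "A \<in> Obj P" "\<alpha> \<in> El A" "\<rho> \<in> El (Prod P A A)"
    "\<And>z. z \<in> El (Prod P A A) \<Longrightarrow> z \<sqsubseteq>\<^bsub>Fib P (Prod P A A)\<^esub> Re P (Pr1 P A A) \<alpha> \<Longrightarrow>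
      z \<sqsubseteq>\<^bsub>Fib P (Prod P A A)\<^esub> \<rho> \<Longrightarrow> z \<sqsubseteq>\<^bsub>Fib P (Prod P A A)\<^esub> Re P (Pr2 P A A) \<alpha>"
  shows "\<alpha> \<in> Des P A \<rho>"
  unfolding Des_def mem_Collect_eq
  by (intro conjI assms(1,2), rule leI) (use assms in simp_all)

lemma Des_el: "\<alpha> \<in> Des P A \<rho> \<Longrightarrow> \<alpha> \<in> El A"
  by (simp add: Des_def)

lemma le_Re_cross_apply:
  assumes "\<rho> \<sqsubseteq>\<^bsub>Fib P (Prod P A A)\<^esub> Re P (cross P f f) \<sigma>" "f \<in> Arr P" "Dom P f = A" "Cod P f = B"
    "\<rho> \<in> El (Prod P A A)" "\<sigma> \<in> El (Prod P B B)"
    "z \<sqsubseteq>\<^bsub>Fib P Y\<^esub> Re P (tuple P h k) \<rho>" "z \<in> El Y"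
    "h \<in> Arr P" "k \<in> Arr P" "Dom P h = Y" "Dom P k = Y" "Cod P h = A" "Cod P k = A"
  shows "z \<sqsubseteq>\<^bsub>Fib P Y\<^esub> Re P (tuple P (Comp P f h) (Comp P f k)) \<sigma>"
proof -
  have [simp]: "A \<in> Obj P" "B \<in> Obj P" using assms by auto
  have "z \<sqsubseteq>\<^bsub>Fib P Y\<^esub> Re P (tuple P h k) (Re P (cross P f f) \<sigma>)"
    by (rule Re_le_apply[OF assms(1)]) (use assms in \<open>simp_all add: cross_tuple\<close>)
  then show ?thesis using assms by (simp add: cross_tuple)
qed

lemma le_Re_crossI:
  assumes "f \<in> Arr P" "Dom P f = A" "Cod P f = B" "\<rho> \<in> El (Prod P A A)" "\<sigma> \<in> El (Prod P B B)"
    "\<And>z. z \<in> El (Prod P A A) \<Longrightarrow> z \<sqsubseteq>\<^bsub>Fib P (Prod P A A)\<^esub> \<rho> \<Longrightarrow>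
      z \<sqsubseteq>\<^bsub>Fib P (Prod P A A)\<^esub> Re P (tuple P (Comp P f (Pr1 P A A)) (Comp P f (Pr2 P A A))) \<sigma>"
  shows "\<rho> \<sqsubseteq>\<^bsub>Fib P (Prod P A A)\<^esub> Re P (cross P f f) \<sigma>"
proof -
  have [simp]: "A \<in> Obj P" "B \<in> Obj P" using assms by auto
  show ?thesis by (rule leI) (use assms in \<open>simp_all add: cross_tuple\<close>)
qed

end

locale elem_doctrine = indexed_infsl +
  assumes has_delta: "A \<in> Obj P \<Longrightarrow> \<exists>d. is_delta P A d"
begin

lemma elementary_doctrine: "elementary_doctrine P"
  using doctrine has_delta by (simp add: elementary_doctrine_def)

lemma is_delta_delta: "A \<in> Obj P \<Longrightarrow> is_delta P A (delta P A)"
  unfolding delta_def by (rule theI', rule ex_ex1I, erule has_delta, rule delta_unique)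

lemma delta_refl_subst:
  assumes "A \<in> Obj P"
  shows "reflexive_on A (delta P A)" "substitutive_on A (delta P A)"
  using is_delta_delta[OF assms] is_delta_iff[OF assms] by auto

lemma delta_simps [simp]:
  "A \<in> Obj P \<Longrightarrow> delta P A \<in> El (Prod P A A)"
  "f \<in> Arr P \<Longrightarrow> g \<in> Arr P \<Longrightarrow> Dom P f = Dom P g \<Longrightarrow> f = g \<Longrightarrow> Cod P f = A \<Longrightarrow> 
     Re P (tuple P f g) (delta P A) = \<top>\<^bsub>Fib P (Dom P f)\<^esub>"
proof -
  show "A \<in> Obj P \<Longrightarrow> delta P A \<in> El (Prod P A A)"
    by (rule reflexive_onD(1)[OF delta_refl_subst(1)])
  assume "f \<in> Arr P" "Cod P f = A" "f = g"
  then show "Re P (tuple P f g) (delta P A) = \<top>\<^bsub>Fib P (Dom P f)\<^esub>"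
    using reflexive_onD(2)[OF delta_refl_subst(1)[OF arr_simps(2)[of f]], of f] by blast
qed

lemmas delta_subst = substitutive_on_context[OF delta_refl_subst(2)]

text \<open>Equality is the least reflexive relation: from \<open>\<rho>(a, a)\<close> and \<open>a = b\<close> substitution gives
  \<open>\<rho>(a, b)\<close>.\<close>

lemma delta_le_iff_reflexive:
  assumes "A \<in> Obj P" "\<rho> \<in> El (Prod P A A)"
  shows "delta P A \<sqsubseteq>\<^bsub>Fib P (Prod P A A)\<^esub> \<rho> \<longleftrightarrow> reflexive_on A \<rho>"
proof
  assume le: "delta P A \<sqsubseteq>\<^bsub>Fib P (Prod P A A)\<^esub> \<rho>"
  show "reflexive_on A \<rho>"
    unfolding reflexive_on_def
  proof (intro conjI assms ballI impI)
    fix f assume f: "f \<in> Arr P" "Cod P f = A"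
    have "\<top>\<^bsub>Fib P (Dom P f)\<^esub> \<sqsubseteq>\<^bsub>Fib P (Dom P f)\<^esub> Re P (tuple P f f) \<rho>"
      by (rule Re_le_apply[OF le]) (use f assms in simp_all)
    then show "Re P (tuple P f f) \<rho> = \<top>\<^bsub>Fib P (Dom P f)\<^esub>"
      using f assms by (simp add: top_le_iff)
  qed
next
  assume r: "reflexive_on A \<rho>"
  note [simp] = assms reflexive_onD(2)[OF r]
  show "delta P A \<sqsubseteq>\<^bsub>Fib P (Prod P A A)\<^esub> \<rho>"
  proof (rule leI, simp_all)
    let ?AA = "Prod P A A"
    fix z assume [simp]: "z \<in> El ?AA" "z \<sqsubseteq>\<^bsub>Fib P ?AA\<^esub> delta P A"
    have "z \<sqsubseteq>\<^bsub>Fib P ?AA\<^esub> Re P (Comp P (tuple P (Comp P (Pr1 P A A) (Pr1 P ?AA A)) (Pr2 P ?AA A))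
        (tuple P (Ide P ?AA) (Pr2 P A A))) \<rho>"
      by (rule delta_subst[of A "Pr1 P A A"]) simp_all
    then show "z \<sqsubseteq>\<^bsub>Fib P ?AA\<^esub> \<rho>" by simp
  qed
qed

lemma equivalence_relI:
  assumes "A \<in> Obj P" "reflexive_on A \<rho>"
    "\<And>z Y f g. \<lbrakk>z \<sqsubseteq>\<^bsub>Fib P Y\<^esub> Re P (tuple P f g) \<rho>; z \<in> El Y;
      f \<in> Arr P; g \<in> Arr P; Dom P f = Y; Dom P g = Y; Cod P f = A; Cod P g = A\<rbrakk>
      \<Longrightarrow> z \<sqsubseteq>\<^bsub>Fib P Y\<^esub> Re P (tuple P g f) \<rho>"
    "\<And>z Y f g h. \<lbrakk>z \<sqsubseteq>\<^bsub>Fib P Y\<^esub> Re P (tuple P f g) \<rho>; z \<sqsubseteq>\<^bsub>Fib P Y\<^esub> Re P (tuple P g h) \<rho>; z \<in> El Y;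
      f \<in> Arr P; g \<in> Arr P; h \<in> Arr P; Dom P f = Y; Dom P g = Y; Dom P h = Y;
      Cod P f = A; Cod P g = A; Cod P h = A\<rbrakk>
      \<Longrightarrow> z \<sqsubseteq>\<^bsub>Fib P Y\<^esub> Re P (tuple P f h) \<rho>"
  shows "equivalence_rel P A \<rho>"
proof -
  note [simp] = assms(1) reflexive_onD(1)[OF assms(2)]
  have "\<rho> \<sqsubseteq>\<^bsub>Fib P (Prod P A A)\<^esub> Re P (tuple P (Pr2 P A A) (Pr1 P A A)) \<rho>"
    by (rule assms(3)) simp_all
  moreover have "Re P (tuple P (pr31 P A A A) (pr32 P A A A)) \<rho>
       \<sqinter>\<^bsub>Fib P (Prod3 P A A A)\<^esub> Re P (tuple P (pr32 P A A A) (pr33 P A A A)) \<rho>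
       \<sqsubseteq>\<^bsub>Fib P (Prod3 P A A A)\<^esub> Re P (tuple P (pr31 P A A A) (pr33 P A A A)) \<rho>"
  proof (rule leI)
    fix z assume "z \<in> El (Prod3 P A A A)"
      "z \<sqsubseteq>\<^bsub>Fib P (Prod3 P A A A)\<^esub> Re P (tuple P (pr31 P A A A) (pr32 P A A A)) \<rho>
       \<sqinter>\<^bsub>Fib P (Prod3 P A A A)\<^esub> Re P (tuple P (pr32 P A A A) (pr33 P A A A)) \<rho>"
    then show "z \<sqsubseteq>\<^bsub>Fib P (Prod3 P A A A)\<^esub> Re P (tuple P (pr31 P A A A) (pr33 P A A A)) \<rho>"
      by (rule_tac assms(4)[where g = "pr32 P A A A"]) (simp_all add: Prod3_def pr31_def pr32_def pr33_def)
  qed (simp_all add: Prod3_def pr31_def pr32_def pr33_def)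
  ultimately show ?thesis
    unfolding equivalence_rel_def by (simp add: delta_le_iff_reflexive assms(2))
qed

lemma equivalence_rel_refl:
  assumes "equivalence_rel P A \<rho>" "f \<in> Arr P" "Cod P f = A"
  shows "Re P (tuple P f f) \<rho> = \<top>\<^bsub>Fib P (Dom P f)\<^esub>"
proof -
  have "A \<in> Obj P" using assms by auto
  then have "reflexive_on A \<rho>" using assms(1) delta_le_iff_reflexive[of A \<rho>] by (simp add: equivalence_rel_def)
  then show ?thesis using assms(2,3) by (rule reflexive_onD(2))
qed

lemma equivalence_rel_reflexive_on:
  "A \<in> Obj P \<Longrightarrow> equivalence_rel P A \<rho> \<Longrightarrow> reflexive_on A \<rho>"
  by (simp add: reflexive_on_def equivalence_rel_refl equivalence_rel_el)

text \<open>Symmetry substitutes in \<open>\<delta>(-, f)\<close>, transitivity in \<open>\<delta>(f, -)\<close>.\<close>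

lemma delta_equivalence_rel:
  assumes A [simp]: "A \<in> Obj P"
  shows "equivalence_rel P A (delta P A)"
proof (rule equivalence_relI)
  show "reflexive_on A (delta P A)" by (rule delta_refl_subst) simp
next
  fix z Y f g
  assume le: "z \<sqsubseteq>\<^bsub>Fib P Y\<^esub> Re P (tuple P f g) (delta P A)" and [simp]: "z \<in> El Y"
    "f \<in> Arr P" "g \<in> Arr P" and a: "Dom P f = Y" "Dom P g = Y" "Cod P f = A" "Cod P g = A"
  then have [simp]: "Y \<in> Obj P" by auto
  have "z \<sqsubseteq>\<^bsub>Fib P Y\<^esub> Re P (Comp P (tuple P (Pr2 P Y A) (Comp P f (Pr1 P Y A))) (tuple P (Ide P Y) g)) (delta P A)"
    by (rule delta_subst[of A f]) (use le a in simp_all)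
  then show "z \<sqsubseteq>\<^bsub>Fib P Y\<^esub> Re P (tuple P g f) (delta P A)" using a by simp
next
  fix z Y f g h
  assume le: "z \<sqsubseteq>\<^bsub>Fib P Y\<^esub> Re P (tuple P f g) (delta P A)" "z \<sqsubseteq>\<^bsub>Fib P Y\<^esub> Re P (tuple P g h) (delta P A)"
    and [simp]: "z \<in> El Y"
    "f \<in> Arr P" "g \<in> Arr P" "h \<in> Arr P"
    and a: "Dom P f = Y" "Dom P g = Y" "Dom P h = Y" "Cod P f = A" "Cod P g = A" "Cod P h = A"
  then have [simp]: "Y \<in> Obj P" by auto
  have "z \<sqsubseteq>\<^bsub>Fib P Y\<^esub> Re P (Comp P (tuple P (Comp P f (Pr1 P Y A)) (Pr2 P Y A)) (tuple P (Ide P Y) h)) (delta P A)"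
    by (rule delta_subst[of A g]) (use le a in simp_all)
  then show "z \<sqsubseteq>\<^bsub>Fib P Y\<^esub> Re P (tuple P f h) (delta P A)" using a by simp
qed simp

text \<open>Descent along equality is the instance of substitution in which the property is \<open>\<alpha>\<close> itself.
  Hence the unit of the quotient completion can be the identity on fibres.\<close>

lemma Des_delta:
  assumes A [simp]: "A \<in> Obj P"
  shows "Des P A (delta P A) = El A"
proof
  show "Des P A (delta P A) \<subseteq> El A" by (auto simp: Des_def)
  show "El A \<subseteq> Des P A (delta P A)"
  proof
    fix \<alpha> assume [simp]: "\<alpha> \<in> El A"
    show "\<alpha> \<in> Des P A (delta P A)"
    proof (rule DesI)
      let ?AA = "Prod P A A"
      fix z assume [simp]: "z \<in> El ?AA" "z \<sqsubseteq>\<^bsub>Fib P ?AA\<^esub> Re P (Pr1 P A A) \<alpha>" "z \<sqsubseteq>\<^bsub>Fib P ?AA\<^esub> delta P A"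
      have "z \<sqsubseteq>\<^bsub>Fib P ?AA\<^esub> Re P (Comp P (Pr2 P ?AA A) (tuple P (Ide P ?AA) (Pr2 P A A))) \<alpha>"
        by (rule delta_subst[of A "Pr1 P A A"]) simp_all
      then show "z \<sqsubseteq>\<^bsub>Fib P ?AA\<^esub> Re P (Pr2 P A A) \<alpha>" by simp
    qed simp_all
  qed
qed

text \<open>Substituting first \<open>a'\<close> for \<open>a\<close> and then \<open>b'\<close> for \<open>b\<close> in \<open>(a, b) = (a, b)\<close> gives
  \<open>(a, b) = (a', b')\<close>; the other inequality holds because the right-hand side is reflexive. This is
  what makes the unit \<open>A \<mapsto> (A, \<delta>\<^sub>A)\<close> preserve products.\<close>

lemma delta_Prod:
  assumes [simp]: "A \<in> Obj P" "B \<in> Obj P" and AB: "Prod P A B = AB"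
  shows "delta P AB = Re P (cross P (Pr1 P A B) (Pr1 P A B)) (delta P A)
     \<sqinter>\<^bsub>Fib P (Prod P AB AB)\<^esub> Re P (cross P (Pr2 P A B) (Pr2 P A B)) (delta P B)"
proof -
  have [simp]: "AB \<in> Obj P" using prod_simps(1)[of A B] AB by simp
  note cr = cross_tuple[of _ _ AB AB]
  let ?QQ = "Prod P AB AB" and ?p = "Pr1 P A B" and ?q = "Pr2 P A B"
  let ?d = "Re P (cross P ?p ?p) (delta P A) \<sqinter>\<^bsub>Fib P ?QQ\<^esub> Re P (cross P ?q ?q) (delta P B)"
  have [simp]: "Dom P ?p = AB" "Dom P ?q = AB" by (simp_all add: AB)
  have [simp]: "?d \<in> El ?QQ" by (simp add: cr)
  have "reflexive_on AB ?d"
    unfolding reflexive_on_def by (auto simp: cr)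
  then have 1: "delta P AB \<sqsubseteq>\<^bsub>Fib P ?QQ\<^esub> ?d" by (simp add: delta_le_iff_reflexive)
  have 2: "?d \<sqsubseteq>\<^bsub>Fib P ?QQ\<^esub> delta P AB"
  proof (rule leI)
    let ?a = "Comp P ?p (Pr1 P AB AB)" and ?b = "Comp P ?q (Pr1 P AB AB)"
    let ?a' = "Comp P ?p (Pr2 P AB AB)" and ?b' = "Comp P ?q (Pr2 P AB AB)"
    fix z assume z [simp]: "z \<in> El ?QQ" and "z \<sqsubseteq>\<^bsub>Fib P ?QQ\<^esub> ?d"
    then have le [simp]: "z \<sqsubseteq>\<^bsub>Fib P ?QQ\<^esub> Re P (tuple P ?a ?a') (delta P A)"
      "z \<sqsubseteq>\<^bsub>Fib P ?QQ\<^esub> Re P (tuple P ?b ?b') (delta P B)" by (simp_all add: cr)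
    have [simp]: "tuple P ?a ?b = Pr1 P AB AB" "tuple P ?a' ?b' = Pr2 P AB AB"
      by (rule tuple_eta; simp add: AB)+
    \<comment> \<open>Substitute \<open>a'\<close> for \<open>a\<close> in \<open>(a, b) = (-, b)\<close>, then \<open>b'\<close> for \<open>b\<close> in \<open>(a, b) = (a', -)\<close>.\<close>
    have "z \<sqsubseteq>\<^bsub>Fib P ?QQ\<^esub> Re P (Comp P (tuple P (Comp P (Pr1 P AB AB) (Pr1 P ?QQ A)) (tuple P (Pr2 P ?QQ A) (Comp P ?b (Pr1 P ?QQ A))))
       (tuple P (Ide P ?QQ) ?a')) (delta P AB)"
      by (rule delta_subst[of A ?a]) (simp_all add: AB)
    then have 3: "z \<sqsubseteq>\<^bsub>Fib P ?QQ\<^esub> Re P (tuple P (Pr1 P AB AB) (tuple P ?a' ?b)) (delta P AB)"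
      by (simp add: AB)
    have "z \<sqsubseteq>\<^bsub>Fib P ?QQ\<^esub> Re P (Comp P (tuple P (Comp P (Pr1 P AB AB) (Pr1 P ?QQ B)) (tuple P (Comp P ?a' (Pr1 P ?QQ B)) (Pr2 P ?QQ B)))
       (tuple P (Ide P ?QQ) ?b')) (delta P AB)"
      by (rule delta_subst[of B ?b]) (use 3 in \<open>simp_all add: AB\<close>)
    then show "z \<sqsubseteq>\<^bsub>Fib P ?QQ\<^esub> delta P AB" by (simp add: AB)
  qed simp_all
  show ?thesis by (rule le_antisym[OF 1 2]) simp_all
qed

end

lemma doctrineD: "doctrine P \<Longrightarrow> indexed_infsl P"
proof -
  assume d: "doctrine P"
  then have "category_with_products P" unfolding doctrine_def by blast
  with d show "indexed_infsl P"
    by (intro indexed_infsl.intro prod_category.intro indexed_infsl_axioms.intro)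
qed

lemma elementary_doctrineD: "elementary_doctrine P \<Longrightarrow> elem_doctrine P"
  unfolding elementary_doctrine_def elem_doctrine_def elem_doctrine_axioms_def
  using doctrineD by blast

section \<open>Categories of objects with structure\<close>

text \<open>In both completions an object is a pair of an object of \<open>P\<close> and some structure on it, and an arrow
  is an arrow of \<open>P\<close> that respects the structure. All equations between arrows are therefore
  inherited from \<open>P\<close>; what remains are closure conditions on the class of arrows. The last one says
  that an arrow into a product is admissible when its two components are.\<close>

locale lifted_category = prod_category C
  for C :: "(('o, 'p) obj, ('o, 'a, 'p) arr, 'm) pcat_scheme" +
  fixes D :: "(('o, 'p) obj, ('o, 'a, 'p) arr, 'n) pcat_scheme"
  assumes Obj_under: "X \<in> Obj D \<Longrightarrow> under X \<in> Obj C"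
    and Arr_D: "u \<in> Arr D \<Longrightarrow> \<exists>X f Y. u = AExt X f Y"
    and AExt_D: "AExt X f Y \<in> Arr D \<Longrightarrow> X \<in> Obj D \<and> Y \<in> Obj D \<and>
      f \<in> Arr C \<and> Dom C f = under X \<and> Cod C f = under Y"
    and sel_D: "Dom D = asrc" "Cod D = atgt" "Ide D = (\<lambda>X. AExt X (Ide C (under X)) X)"
      "Comp D = (\<lambda>v u. AExt (asrc u) (Comp C (aunder v) (aunder u)) (atgt v))"
      "Pr1 D = (\<lambda>X Y. AExt (Prod D X Y) (Pr1 C (under X) (under Y)) X)"
      "Pr2 D = (\<lambda>X Y. AExt (Prod D X Y) (Pr2 C (under X) (under Y)) Y)"
    and Ide_D: "X \<in> Obj D \<Longrightarrow> AExt X (Ide C (under X)) X \<in> Arr D"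
    and Comp_D: "AExt X f Y \<in> Arr D \<Longrightarrow> AExt Y g Z \<in> Arr D \<Longrightarrow> AExt X (Comp C g f) Z \<in> Arr D"
    and Prod_D: "X \<in> Obj D \<Longrightarrow> Y \<in> Obj D \<Longrightarrow> Prod D X Y \<in> Obj D"
    and under_Prod: "under (Prod D X Y) = Prod C (under X) (under Y)"
    and Pr_D: "X \<in> Obj D \<Longrightarrow> Y \<in> Obj D \<Longrightarrow> Pr1 D X Y \<in> Arr D"
      "X \<in> Obj D \<Longrightarrow> Y \<in> Obj D \<Longrightarrow> Pr2 D X Y \<in> Arr D"
    and tuple_D_arr: "\<lbrakk>AExt Z (Comp C (Pr1 C (under X) (under Y)) h) X \<in> Arr D;
      AExt Z (Comp C (Pr2 C (under X) (under Y)) h) Y \<in> Arr D;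
      h \<in> Arr C; Dom C h = under Z; Cod C h = Prod C (under X) (under Y)\<rbrakk>
      \<Longrightarrow> AExt Z h (Prod D X Y) \<in> Arr D"
begin

lemma Arr_DE:
  assumes "u \<in> Arr D"
  obtains X f Y where "u = AExt X f Y" "X \<in> Obj D" "Y \<in> Obj D" "f \<in> Arr C"
    "Dom C f = under X" "Cod C f = under Y"
  using Arr_D[OF assms] AExt_D assms by blast

lemma category_D: "category D"
  unfolding category_def hom_def
proof (intro conjI ballI impI)
  fix u assume u: "u \<in> Arr D"
  show "Dom D u \<in> Obj D" "Cod D u \<in> Obj D" "Comp D u (Ide D (Dom D u)) = u" "Comp D (Ide D (Cod D u)) u = u"
    by (rule Arr_DE[OF u]; simp add: sel_D)+
next
  fix X assume "X \<in> Obj D"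
  then show "Ide D X \<in> {f \<in> Arr D. Dom D f = X \<and> Cod D f = X}" by (simp add: sel_D Ide_D)
next
  fix u v assume u: "u \<in> Arr D" and v: "v \<in> Arr D" and uv: "Dom D v = Cod D u"
  show "Comp D v u \<in> {f \<in> Arr D. Dom D f = Dom D u \<and> Cod D f = Cod D v}"
    by (rule Arr_DE[OF u], rule Arr_DE[OF v]) (use u v uv in \<open>auto simp: sel_D intro: Comp_D\<close>)
next
  fix u v w assume u: "u \<in> Arr D" and v: "v \<in> Arr D" and w: "w \<in> Arr D"
    and uvw: "Dom D v = Cod D u \<and> Dom D w = Cod D v"
  show "Comp D w (Comp D v u) = Comp D (Comp D w v) u"
    by (rule Arr_DE[OF u], rule Arr_DE[OF v], rule Arr_DE[OF w]) (use uvw in \<open>auto simp: sel_D\<close>)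
qed

text \<open>The product of underlying objects need not be a chosen one: the completion of a 1-cell sends chosen
  products to lifts of products that are preserved only up to isomorphism.\<close>

lemma is_product_D:
  assumes XY: "X \<in> Obj D" "Y \<in> Obj D" and Q: "Q \<in> Obj D"
    and prod: "is_product C (under X) (under Y) (under Q) p q"
    and p: "AExt Q p X \<in> Arr D" and q: "AExt Q q Y \<in> Arr D"
    and arr: "\<And>Z h. \<lbrakk>AExt Z (Comp C p h) X \<in> Arr D; AExt Z (Comp C q h) Y \<in> Arr D;
      h \<in> Arr C; Dom C h = under Z; Cod C h = under Q\<rbrakk> \<Longrightarrow> AExt Z h Q \<in> Arr D"
  shows "is_product D X Y Q (AExt Q p X) (AExt Q q Y)"
  unfolding is_product_def hom_def
proof (intro conjI ballI)
  show "Q \<in> Obj D" by fact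
  show "AExt Q p X \<in> {f \<in> Arr D. Dom D f = Q \<and> Cod D f = X}"
    "AExt Q q Y \<in> {f \<in> Arr D. Dom D f = Q \<and> Cod D f = Y}" using p q by (simp_all add: sel_D)
  fix Z u v assume Z: "Z \<in> Obj D" and "u \<in> {f \<in> Arr D. Dom D f = Z \<and> Cod D f = X}"
    "v \<in> {f \<in> Arr D. Dom D f = Z \<and> Cod D f = Y}"
  then have "u \<in> Arr D" "v \<in> Arr D" and uv: "asrc u = Z" "atgt u = X" "asrc v = Z" "atgt v = Y"
    by (auto simp: sel_D)
  then obtain f g where u: "u = AExt Z f X" and v: "v = AExt Z g Y"
    and uD: "AExt Z f X \<in> Arr D" and vD: "AExt Z g Y \<in> Arr D"
    by (metis Arr_D arr.sel)
  note f = AExt_D[OF uD] and g = AExt_D[OF vD]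
  obtain h where h: "h \<in> Arr C" "Dom C h = under Z" "Cod C h = under Q"
    "Comp C p h = f" "Comp C q h = g"
    by (rule is_productE[OF prod, of f g]) (use f g in auto)
  have hD: "AExt Z h Q \<in> Arr D" by (rule arr) (use h uD vD in simp_all)
  show "\<exists>!w. w \<in> {f \<in> Arr D. Dom D f = Z \<and> Cod D f = Q} \<and>
      Comp D (AExt Q p X) w = u \<and> Comp D (AExt Q q Y) w = v"
  proof (rule ex1I[of _ "AExt Z h Q"])
    show "AExt Z h Q \<in> {f \<in> Arr D. Dom D f = Z \<and> Cod D f = Q} \<and>
      Comp D (AExt Q p X) (AExt Z h Q) = u \<and> Comp D (AExt Q q Y) (AExt Z h Q) = v"
      using hD h u v by (simp add: sel_D)
    fix w assume w: "w \<in> {f \<in> Arr D. Dom D f = Z \<and> Cod D f = Q} \<and>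
      Comp D (AExt Q p X) w = u \<and> Comp D (AExt Q q Y) w = v"
    then have "w \<in> Arr D" by simp
    then obtain Z' k Q' where w': "w = AExt Z' k Q'" and k: "k \<in> Arr C" "Dom C k = under Z'" "Cod C k = under Q'"
      by (rule Arr_DE)
    have "k = h"
      by (rule is_product_arr_eqI[OF prod]) (use w w' k h u v in \<open>auto simp: sel_D\<close>)
    then show "w = AExt Z h Q" using w w' by (simp add: sel_D)
  qed
qed

lemma prod_category_D: "prod_category D"
  unfolding prod_category_def category_with_products_def
proof (intro conjI ballI category_D)
  fix X Y assume XY: "X \<in> Obj D" "Y \<in> Obj D"
  then show "is_product D X Y (Prod D X Y) (Pr1 D X Y) (Pr2 D X Y)"
    unfolding sel_D
    by (intro is_product_D Prod_D tuple_D_arr)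
      (use Pr_D[OF XY] in \<open>simp_all add: under_Prod sel_D(5,6) Obj_under product_Prod\<close>)
qed

lemma tuple_D:
  assumes u: "AExt X f Y \<in> Arr D" and v: "AExt X g Z \<in> Arr D"
  shows "tuple D (AExt X f Y) (AExt X g Z) = AExt X (tuple C f g) (Prod D Y Z)"
    and "AExt X (tuple C f g) (Prod D Y Z) \<in> Arr D"
proof -
  interpret D: prod_category D by (rule prod_category_D)
  note f = AExt_D[OF u] and g = AExt_D[OF v]
  show t: "AExt X (tuple C f g) (Prod D Y Z) \<in> Arr D"
    by (rule tuple_D_arr) (use f g u v in simp_all)
  have t': "tuple D (AExt X f Y) (AExt X g Z) \<in> Arr D"
    "Dom D (tuple D (AExt X f Y) (AExt X g Z)) = X"
    "Cod D (tuple D (AExt X f Y) (AExt X g Z)) = Prod D Y Z"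
    "Comp D (Pr1 D Y Z) (tuple D (AExt X f Y) (AExt X g Z)) = AExt X f Y"
    "Comp D (Pr2 D Y Z) (tuple D (AExt X f Y) (AExt X g Z)) = AExt X g Z"
    using D.tuple_props[OF u v] by (simp_all add: sel_D hom_def)
  show "tuple D (AExt X f Y) (AExt X g Z) = AExt X (tuple C f g) (Prod D Y Z)"
    by (rule D.prod_arr_eqI[of Y Z])
      (use f g t t' in \<open>simp_all add: sel_D(1,2)\<close>, simp_all add: sel_D(4-6))
qed

lemma cross_D:
  assumes u: "AExt X f Y \<in> Arr D" and v: "AExt Z g W \<in> Arr D"
  shows "cross D (AExt X f Y) (AExt Z g W) = AExt (Prod D X Z) (cross C f g) (Prod D Y W)"
    and "AExt (Prod D X Z) (cross C f g) (Prod D Y W) \<in> Arr D"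
proof -
  note f = AExt_D[OF u] and g = AExt_D[OF v]
  have p: "AExt (Prod D X Z) (Pr1 C (under X) (under Z)) X \<in> Arr D"
    "AExt (Prod D X Z) (Pr2 C (under X) (under Z)) Z \<in> Arr D"
    using Pr_D[of X Z] f g by (simp_all add: sel_D(5,6))
  note t = tuple_D[OF Comp_D[OF p(1) u] Comp_D[OF p(2) v]]
  show "cross D (AExt X f Y) (AExt Z g W) = AExt (Prod D X Z) (cross C f g) (Prod D Y W)"
    using t(1) f g by (simp add: cross_def sel_D)
  show "AExt (Prod D X Z) (cross C f g) (Prod D Y W) \<in> Arr D"
    using t(2) f g by (simp add: cross_def)
qed

end

section \<open>The comprehension completion\<close>

locale ed_doctrine = elem_doctrine P for P :: "('o, 'a, 'p) ed"

lemma Tc0_sel [simp]: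
  "Dom (Tc0 P) = asrc" "Cod (Tc0 P) = atgt" "Ide (Tc0 P) = (\<lambda>X. AExt X (Ide P (under X)) X)"
  "Comp (Tc0 P) = (\<lambda>v u. AExt (asrc u) (Comp P (aunder v) (aunder u)) (atgt v))"
  "Prod (Tc0 P) = prod_c P"
  "Pr1 (Tc0 P) = (\<lambda>X Y. AExt (prod_c P X Y) (Pr1 P (under X) (under Y)) X)"
  "Pr2 (Tc0 P) = (\<lambda>X Y. AExt (prod_c P X Y) (Pr2 P (under X) (under Y)) Y)"
  "Re (Tc0 P) (AExt X f Y) \<gamma> = Re P f \<gamma> \<sqinter>\<^bsub>Fib P (under X)\<^esub> elt X"
  "Fib (Tc0 P) X = (Fib P (under X))
      \<lparr>carrier := {\<gamma> \<in> carrier (Fib P (under X)). \<gamma> \<sqsubseteq>\<^bsub>Fib P (under X)\<^esub> elt X}\<rparr>"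
  by (simp_all add: Tc0_def)

lemma Tc0_Obj: "X \<in> Obj (Tc0 P) \<longleftrightarrow> X = Ext (under X) (elt X) \<and> under X \<in> Obj P \<and> elt X \<in> carrier (Fib P (under X))"
  by (cases X) (auto simp: Tc0_def)

lemma Tc0_ObjD [simp]:
  "X \<in> Obj (Tc0 P) \<Longrightarrow> under X \<in> Obj P" "X \<in> Obj (Tc0 P) \<Longrightarrow> elt X \<in> carrier (Fib P (under X))"
  "X \<in> Obj (Tc0 P) \<Longrightarrow> Ext (under X) (elt X) = X"
  "Ext A \<alpha> \<in> Obj (Tc0 P) \<longleftrightarrow> A \<in> Obj P \<and> \<alpha> \<in> carrier (Fib P A)"
  using Tc0_Obj[of X P] Tc0_Obj[of "Ext A \<alpha>"] by auto

lemma Tc0_Arr: "AExt X f Y \<in> Arr (Tc0 P) \<longleftrightarrow> X \<in> Obj (Tc0 P) \<and> Y \<in> Obj (Tc0 P) \<and> f \<in> Arr P \<and>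
    Dom P f = under X \<and> Cod P f = under Y \<and> elt X \<sqsubseteq>\<^bsub>Fib P (under X)\<^esub> Re P f (elt Y)"
  by (cases X; cases Y) (auto simp: Tc0_def hom_def)

lemma Tc0_Arr_AExt: "u \<in> Arr (Tc0 P) \<Longrightarrow> \<exists>X f Y. u = AExt X f Y"
  by (auto simp: Tc0_def)

lemma prod_c_sel [simp]:
  "under (prod_c P X Y) = Prod P (under X) (under Y)"
  "elt (prod_c P X Y) = Re P (Pr1 P (under X) (under Y)) (elt X)
     \<sqinter>\<^bsub>Fib P (Prod P (under X) (under Y))\<^esub> Re P (Pr2 P (under X) (under Y)) (elt Y)"
  by (simp_all add: prod_c_def Let_def)

context ed_doctrine
begin

lemma prod_c_Obj [simp]: "X \<in> Obj (Tc0 P) \<Longrightarrow> Y \<in> Obj (Tc0 P) \<Longrightarrow> prod_c P X Y \<in> Obj (Tc0 P)"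
  by (simp add: prod_c_def Let_def)

lemma Tc0_lifted: "lifted_category P (Tc0 P)"
proof
  fix X Y Z and f g :: "('o, 'a, 'p) arr"
  assume "AExt X f Y \<in> Arr (Tc0 P)" "AExt Y g Z \<in> Arr (Tc0 P)"
  then have a [simp]: "X \<in> Obj (Tc0 P)" "Y \<in> Obj (Tc0 P)" "Z \<in> Obj (Tc0 P)" "f \<in> Arr P" "Dom P f = under X" "Cod P f = under Y"
    "g \<in> Arr P" "Dom P g = under Y" "Cod P g = under Z"
    and le: "elt X \<sqsubseteq>\<^bsub>Fib P (under X)\<^esub> Re P f (elt Y)" "elt Y \<sqsubseteq>\<^bsub>Fib P (under Y)\<^esub> Re P g (elt Z)"
    by (auto simp: Tc0_Arr)
  have "elt X \<sqsubseteq>\<^bsub>Fib P (under X)\<^esub> Re P f (Re P g (elt Z))" by (rule Re_le_apply[OF le(2,1)]) simp_all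
  then show "AExt X (Comp P g f) Z \<in> Arr (Tc0 P)" by (simp add: Tc0_Arr)
qed (auto simp: Tc0_Arr dest: Tc0_Arr_AExt, (rule leI, simp_all)+)

lemmas Tc0_tuple = lifted_category.tuple_D[OF Tc0_lifted, simplified]
lemmas Tc0_cross = lifted_category.cross_D[OF Tc0_lifted, simplified]

lemma Tc0_fibre:
  assumes [simp]: "X \<in> Obj (Tc0 P)"
  shows "infsl (Fib (Tc0 P) X)"
    and "\<And>x y. \<lbrakk>x \<in> El (under X); x \<sqsubseteq>\<^bsub>Fib P (under X)\<^esub> elt X; y \<in> El (under X); y \<sqsubseteq>\<^bsub>Fib P (under X)\<^esub> elt X\<rbrakk>
      \<Longrightarrow> x \<sqinter>\<^bsub>Fib (Tc0 P) X\<^esub> y = x \<sqinter>\<^bsub>Fib P (under X)\<^esub> y"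
    and "\<top>\<^bsub>Fib (Tc0 P) X\<^esub> = elt X"
  by (simp_all add: downset(1))

lemma Tc0_doctrine: "doctrine (Tc0 P)"
  unfolding doctrine_def
proof (intro conjI ballI impI)
  show "category_with_products (Tc0 P)"
    using lifted_category.prod_category_D[OF Tc0_lifted] by (simp add: prod_category_def)
next
  fix X assume "X \<in> Obj (Tc0 P)"
  then show "infsl (Fib (Tc0 P) X)" by (rule Tc0_fibre(1))
next
  fix u assume u: "u \<in> Arr (Tc0 P)"
  then obtain X f Y where u': "u = AExt X f Y" using Tc0_Arr_AExt by blast
  with u have [simp]: "X \<in> Obj (Tc0 P)" "Y \<in> Obj (Tc0 P)" "f \<in> Arr P" "Dom P f = under X" "Cod P f = under Y"
    and le [simp]: "elt X \<sqsubseteq>\<^bsub>Fib P (under X)\<^esub> Re P f (elt Y)" by (auto simp: Tc0_Arr)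
  show "infsl_hom (Fib (Tc0 P) (Cod (Tc0 P) u)) (Fib (Tc0 P) (Dom (Tc0 P) u)) (Re (Tc0 P) u)"
    unfolding infsl_hom_def u' Tc0_sel(1,2) arr.sel
  proof (intro conjI funcsetI ballI)
    fix \<gamma> assume "\<gamma> \<in> carrier (Fib (Tc0 P) Y)"
    then have [simp]: "\<gamma> \<in> El (under Y)" by simp
    have "Re P f \<gamma> \<sqinter>\<^bsub>Fib P (under X)\<^esub> elt X \<sqsubseteq>\<^bsub>Fib P (under X)\<^esub> elt X"
      by (rule leI) simp_all
    then show "Re (Tc0 P) (AExt X f Y) \<gamma> \<in> carrier (Fib (Tc0 P) X)" by simp
  next
    show "Re (Tc0 P) (AExt X f Y) \<top>\<^bsub>Fib (Tc0 P) Y\<^esub> = \<top>\<^bsub>Fib (Tc0 P) X\<^esub>"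
      unfolding Tc0_fibre(3)[OF \<open>X \<in> _\<close>] Tc0_fibre(3)[OF \<open>Y \<in> _\<close>] Tc0_sel(8)
      by (rule eqI[of "under X"]) (use le_trans[OF _ le] in auto)
  next
    fix \<gamma> \<gamma>' assume a: "\<gamma> \<in> carrier (Fib (Tc0 P) Y)" "\<gamma>' \<in> carrier (Fib (Tc0 P) Y)"
    then have [simp]: "\<gamma> \<in> El (under Y)" "\<gamma>' \<in> El (under Y)" by simp_all
    have m: "Re P f \<delta> \<sqinter>\<^bsub>Fib P (under X)\<^esub> elt X \<sqsubseteq>\<^bsub>Fib P (under X)\<^esub> elt X" if "\<delta> \<in> El (under Y)" for \<delta>
      by (rule leI) (use that in simp_all)
    have e1: "\<gamma> \<sqinter>\<^bsub>Fib (Tc0 P) Y\<^esub> \<gamma>' = \<gamma> \<sqinter>\<^bsub>Fib P (under Y)\<^esub> \<gamma>'"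
      by (rule Tc0_fibre(2)) (use a in simp_all)
    have e2: "(Re P f \<gamma> \<sqinter>\<^bsub>Fib P (under X)\<^esub> elt X) \<sqinter>\<^bsub>Fib (Tc0 P) X\<^esub> (Re P f \<gamma>' \<sqinter>\<^bsub>Fib P (under X)\<^esub> elt X)
      = (Re P f \<gamma> \<sqinter>\<^bsub>Fib P (under X)\<^esub> elt X) \<sqinter>\<^bsub>Fib P (under X)\<^esub> (Re P f \<gamma>' \<sqinter>\<^bsub>Fib P (under X)\<^esub> elt X)"
      by (rule Tc0_fibre(2)) (simp_all add: m)
    show "Re (Tc0 P) (AExt X f Y) (\<gamma> \<sqinter>\<^bsub>Fib (Tc0 P) Y\<^esub> \<gamma>') =
      Re (Tc0 P) (AExt X f Y) \<gamma> \<sqinter>\<^bsub>Fib (Tc0 P) X\<^esub> Re (Tc0 P) (AExt X f Y) \<gamma>'"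
      unfolding e1 Tc0_sel(8) e2 by (rule eqI[of "under X"]) auto
  qed
next
  fix X \<gamma> assume [simp]: "X \<in> Obj (Tc0 P)" and "\<gamma> \<in> carrier (Fib (Tc0 P) X)"
  then show "Re (Tc0 P) (Ide (Tc0 P) X) \<gamma> = \<gamma>" by (simp add: meet_absorb)
next
  fix u v \<gamma> assume u: "u \<in> Arr (Tc0 P)" and v: "v \<in> Arr (Tc0 P)" and uv: "Dom (Tc0 P) v = Cod (Tc0 P) u"
    and \<gamma>: "\<gamma> \<in> carrier (Fib (Tc0 P) (Cod (Tc0 P) v))"
  from u uv obtain X f Y where u': "u = AExt X f Y" "asrc v = Y" using Tc0_Arr_AExt by fastforce
  with v obtain g Z where v': "v = AExt Y g Z" using Tc0_Arr_AExt by fastforce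
  have [simp]: "X \<in> Obj (Tc0 P)" "Y \<in> Obj (Tc0 P)" "Z \<in> Obj (Tc0 P)" "f \<in> Arr P" "Dom P f = under X" "Cod P f = under Y"
    "g \<in> Arr P" "Dom P g = under Y" "Cod P g = under Z" "\<gamma> \<in> El (under Z)"
    and le: "elt X \<sqsubseteq>\<^bsub>Fib P (under X)\<^esub> Re P f (elt Y)"
    using u v \<gamma> by (auto simp: Tc0_Arr u' v')
  show "Re (Tc0 P) (Comp (Tc0 P) v u) \<gamma> = Re (Tc0 P) u (Re (Tc0 P) v \<gamma>)"
    unfolding u' v' by simp (rule eqI[of "under X"], use le_trans[OF _ le] in auto)
qed

text \<open>An arrow \<open>f : (Y, \<eta>) \<rightarrow> (A, \<alpha>)\<close> satisfies \<open>\<eta> \<sqsubseteq> f\<^sup>*\<alpha>\<close>. So over \<open>(Y, \<eta>)\<close>, where only elements below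
  \<open>\<eta>\<close> matter, the conjunct \<open>\<alpha> \<times> \<alpha>\<close> is true at every pair of arrows, and the claim reduces to the
  properties of \<open>\<delta>\<^sub>A\<close>.\<close>

lemma Tc0_delta_raw:
  assumes X [simp]: "X \<in> Obj (Tc0 P)"
  shows "is_delta (Tc0 P) X (delta P (under X) \<sqinter>\<^bsub>Fib P (Prod P (under X) (under X))\<^esub> elt (prod_c P X X))"
proof -
  interpret c: indexed_infsl "Tc0 P" by (rule doctrineD[OF Tc0_doctrine])
  let ?A = "under X"
  let ?AA = "Prod P ?A ?A" and ?e = "elt (prod_c P X X)"
  let ?d = "delta P (under X) \<sqinter>\<^bsub>Fib P ?AA\<^esub> ?e"
  have XX: "prod_c P X X \<in> Obj (Tc0 P)" by simp
  have [simp]: "?e \<in> El ?AA" using XX Tc0_ObjD(2) by fastforce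
  have d: "?d \<in> El ?AA" "?d \<sqsubseteq>\<^bsub>Fib P ?AA\<^esub> ?e"
    by (simp, rule leI) (simp_all del: prod_c_sel)
  have "c.reflexive_on X ?d"
    unfolding c.reflexive_on_def
  proof (intro conjI ballI impI)
    show "?d \<in> carrier (Fib (Tc0 P) (Prod (Tc0 P) X X))" using d by simp
  next
    fix u assume u: "u \<in> Arr (Tc0 P)" "Cod (Tc0 P) u = X"
    then obtain Y f where u': "u = AExt Y f X" using Tc0_Arr_AExt by fastforce
    note uu = u(1)[unfolded u']
    have [simp]: "Y \<in> Obj (Tc0 P)" "f \<in> Arr P" "Dom P f = under Y" "Cod P f = under X"
      and le: "elt Y \<sqsubseteq>\<^bsub>Fib P (under Y)\<^esub> Re P f (elt X)" using uu by (auto simp: Tc0_Arr)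
    show "Re (Tc0 P) (tuple (Tc0 P) u u) ?d = \<top>\<^bsub>Fib (Tc0 P) (Dom (Tc0 P) u)\<^esub>"
      unfolding u' Tc0_tuple(1)[OF uu uu] Tc0_sel(1) arr.sel Tc0_fibre(3)[OF \<open>Y \<in> _\<close>] Tc0_sel(8)
      by (rule eqI[of "under Y"]) (use le_trans[OF _ le] in auto)
  qed
  moreover have "c.substitutive_on X ?d"
    unfolding c.substitutive_on_def
  proof (intro ballI impI, elim conjE)
    fix W \<zeta> w u v z
    assume W [simp]: "W \<in> Obj (Tc0 P)" and \<zeta>: "\<zeta> \<in> carrier (Fib (Tc0 P) (Prod (Tc0 P) (Prod (Tc0 P) W X) X))"
      and w: "w \<in> Arr (Tc0 P)" and u: "u \<in> Arr (Tc0 P)" and v: "v \<in> Arr (Tc0 P)"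
      and z: "z \<in> carrier (Fib (Tc0 P) (Dom (Tc0 P) u))"
      and ty: "Dom (Tc0 P) w = Dom (Tc0 P) u" "Dom (Tc0 P) v = Dom (Tc0 P) u"
        "Cod (Tc0 P) w = W" "Cod (Tc0 P) u = X" "Cod (Tc0 P) v = X"
      and le: "z \<sqsubseteq>\<^bsub>Fib (Tc0 P) (Dom (Tc0 P) u)\<^esub> Re (Tc0 P) (tuple (Tc0 P) (tuple (Tc0 P) w u) u) \<zeta>"
        "z \<sqsubseteq>\<^bsub>Fib (Tc0 P) (Dom (Tc0 P) u)\<^esub> Re (Tc0 P) (tuple (Tc0 P) u v) ?d"
    obtain Y f where u': "u = AExt Y f X" using Tc0_Arr_AExt[OF u] ty by auto
    obtain g where v': "v = AExt Y g X" using Tc0_Arr_AExt[OF v] ty u' by auto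
    obtain x where w': "w = AExt Y x W" using Tc0_Arr_AExt[OF w] ty u' by auto
    note T = w[unfolded w'] u[unfolded u'] v[unfolded v']
    have [simp]: "Y \<in> Obj (Tc0 P)" "f \<in> Arr P" "Dom P f = under Y" "Cod P f = under X"
      "g \<in> Arr P" "Dom P g = under Y" "Cod P g = under X"
      "x \<in> Arr P" "Dom P x = under Y" "Cod P x = under W"
      using T by (auto simp: Tc0_Arr)
    note t1 = Tc0_tuple[OF T(1,2)]
    note t2 = Tc0_tuple(1)[OF t1(2) T(2)] Tc0_tuple(1)[OF t1(2) T(3)] Tc0_tuple(1)[OF T(2,3)]
    have [simp]: "\<zeta> \<in> El (Prod P (Prod P (under W) (under X)) (under X))" "z \<in> El (under Y)" using \<zeta> z by (simp_all add: u')
    have l: "z \<sqsubseteq>\<^bsub>Fib P (under Y)\<^esub> Re P (tuple P (tuple P x f) f) \<zeta>" "z \<sqsubseteq>\<^bsub>Fib P (under Y)\<^esub> elt Y"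
      "z \<sqsubseteq>\<^bsub>Fib P (under Y)\<^esub> Re P (tuple P f g) (delta P (under X))"
      using le by (simp_all add: u' v' w' t1 t2 d)
    have "z \<sqsubseteq>\<^bsub>Fib P (under Y)\<^esub> Re P (tuple P (tuple P x f) g) \<zeta>"
      by (rule substitutive_onD[OF delta_refl_subst(2)[of "under X"] _ l(1,3)]) simp_all
    with l(2) show "z \<sqsubseteq>\<^bsub>Fib (Tc0 P) (Dom (Tc0 P) u)\<^esub> Re (Tc0 P) (tuple (Tc0 P) (tuple (Tc0 P) w u) v) \<zeta>"
      by (simp add: u' v' w' t1 t2)
  qed
  ultimately show ?thesis using c.is_delta_iff[of X] by simp
qed

lemma Tc0_elementary: "elementary_doctrine (Tc0 P)"
  unfolding elementary_doctrine_def using Tc0_doctrine Tc0_delta_raw by blast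

lemma Tc0_delta: 
  assumes "X \<in> Obj (Tc0 P)"
  shows "delta (Tc0 P) X = delta P (under X) \<sqinter>\<^bsub>Fib P (Prod P (under X) (under X))\<^esub> elt (prod_c P X X)"
proof -
  interpret c: elem_doctrine "Tc0 P" by (rule elementary_doctrineD[OF Tc0_elementary])
  show ?thesis using c.is_delta_delta[OF assms] Tc0_delta_raw[OF assms] c.delta_unique[OF assms] by blast
qed

end

section \<open>The quotient completion\<close>

lemma Tq0_sel [simp]:
  "Dom (Tq0 P) = asrc" "Cod (Tq0 P) = atgt" "Ide (Tq0 P) = (\<lambda>X. AExt X (Ide P (under X)) X)"
  "Comp (Tq0 P) = (\<lambda>v u. AExt (asrc u) (Comp P (aunder v) (aunder u)) (atgt v))"
  "Prod (Tq0 P) = prod_q P"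
  "Pr1 (Tq0 P) = (\<lambda>X Y. AExt (prod_q P X Y) (Pr1 P (under X) (under Y)) X)"
  "Pr2 (Tq0 P) = (\<lambda>X Y. AExt (prod_q P X Y) (Pr2 P (under X) (under Y)) Y)"
  "Re (Tq0 P) (AExt X f Y) = Re P f"
  "Fib (Tq0 P) X = (Fib P (under X))\<lparr>carrier := Des P (under X) (elt X)\<rparr>"
  by (simp_all add: Tq0_def)

lemma Tq0_Obj: "X \<in> Obj (Tq0 P) \<longleftrightarrow> X = Ext (under X) (elt X) \<and> under X \<in> Obj P \<and> equivalence_rel P (under X) (elt X)"
  by (cases X) (auto simp: Tq0_def)

lemma Tq0_ObjD [simp]:
  "X \<in> Obj (Tq0 P) \<Longrightarrow> under X \<in> Obj P" "X \<in> Obj (Tq0 P) \<Longrightarrow> equivalence_rel P (under X) (elt X)"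
  "X \<in> Obj (Tq0 P) \<Longrightarrow> elt X \<in> carrier (Fib P (Prod P (under X) (under X)))"
  "X \<in> Obj (Tq0 P) \<Longrightarrow> Ext (under X) (elt X) = X"
  "Ext A \<rho> \<in> Obj (Tq0 P) \<longleftrightarrow> A \<in> Obj P \<and> equivalence_rel P A \<rho>"
  using Tq0_Obj[of X P] Tq0_Obj[of "Ext A \<rho>"] by (auto simp: equivalence_rel_def)

lemma Tq0_Arr: "AExt X f Y \<in> Arr (Tq0 P) \<longleftrightarrow> X \<in> Obj (Tq0 P) \<and> Y \<in> Obj (Tq0 P) \<and> f \<in> Arr P \<and>
    Dom P f = under X \<and> Cod P f = under Y \<and>
    elt X \<sqsubseteq>\<^bsub>Fib P (Prod P (under X) (under X))\<^esub> Re P (cross P f f) (elt Y)"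
  by (cases X; cases Y) (auto simp: Tq0_def hom_def)

lemma Tq0_Arr_AExt: "u \<in> Arr (Tq0 P) \<Longrightarrow> \<exists>X f Y. u = AExt X f Y"
  by (auto simp: Tq0_def)

lemma prod_q_sel:
  "under (prod_q P X Y) = Prod P (under X) (under Y)"
  "elt (prod_q P X Y) = Re P (cross P (Pr1 P (under X) (under Y)) (Pr1 P (under X) (under Y))) (elt X)
     \<sqinter>\<^bsub>Fib P (Prod P (Prod P (under X) (under Y)) (Prod P (under X) (under Y)))\<^esub>
     Re P (cross P (Pr2 P (under X) (under Y)) (Pr2 P (under X) (under Y))) (elt Y)"
  by (simp_all add: prod_q_def Let_def)

declare prod_q_sel(1) [simp]

context ed_doctrine
begin

text \<open>The condition \<open>\<rho> \<sqsubseteq> (f \<times> f)\<^sup>*\<sigma>\<close> says that \<open>\<rho>(h, k)\<close> entails \<open>\<sigma>(f h, f k)\<close> for all \<open>h, k\<close>. With this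
  and the converse below, arrows of the quotient completion are handled by evaluating relations.\<close>

lemma Tq0_Arr_apply:
  assumes "AExt X f Y \<in> Arr (Tq0 P)" "z \<sqsubseteq>\<^bsub>Fib P V\<^esub> Re P (tuple P h k) (elt X)" "z \<in> El V"
    "h \<in> Arr P" "k \<in> Arr P" "Dom P h = V" "Dom P k = V" "Cod P h = under X" "Cod P k = under X"
  shows "z \<sqsubseteq>\<^bsub>Fib P V\<^esub> Re P (tuple P (Comp P f h) (Comp P f k)) (elt Y)"
  by (rule le_Re_cross_apply[of "under X" "elt X" _ "elt Y" "under Y"]) (use assms in \<open>auto simp: Tq0_Arr\<close>)

lemma Tq0_ArrI:
  assumes [simp]: "X \<in> Obj (Tq0 P)" "Y \<in> Obj (Tq0 P)" "f \<in> Arr P" "Dom P f = under X" "Cod P f = under Y"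
    and le: "\<And>z V h k. \<lbrakk>z \<sqsubseteq>\<^bsub>Fib P V\<^esub> Re P (tuple P h k) (elt X); V \<in> Obj P; z \<in> El V;
      h \<in> Arr P; k \<in> Arr P; Dom P h = V; Dom P k = V; Cod P h = under X; Cod P k = under X\<rbrakk>
      \<Longrightarrow> z \<sqsubseteq>\<^bsub>Fib P V\<^esub> Re P (tuple P (Comp P f h) (Comp P f k)) (elt Y)"
  shows "AExt X f Y \<in> Arr (Tq0 P)"
proof -
  have "elt X \<sqsubseteq>\<^bsub>Fib P (Prod P (under X) (under X))\<^esub> Re P (cross P f f) (elt Y)"
  proof (rule le_Re_crossI[of _ _ "under Y"])
    fix z assume "z \<in> El (Prod P (under X) (under X))" "z \<sqsubseteq>\<^bsub>Fib P (Prod P (under X) (under X))\<^esub> elt X"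
    then show "z \<sqsubseteq>\<^bsub>Fib P (Prod P (under X) (under X))\<^esub>
        Re P (tuple P (Comp P f (Pr1 P (under X) (under X))) (Comp P f (Pr2 P (under X) (under X)))) (elt Y)"
      by (intro le) simp_all
  qed simp_all
  then show ?thesis by (simp add: Tq0_Arr)
qed

lemma Re_elt_prod_q [simp]:
  assumes "X \<in> Obj (Tq0 P)" "Y \<in> Obj (Tq0 P)"
    "h \<in> Arr P" "k \<in> Arr P" "Dom P h = Dom P k"
    "Cod P h = Prod P (under X) (under Y)" "Cod P k = Prod P (under X) (under Y)"
  shows "Re P (tuple P h k) (elt (prod_q P X Y)) =
     Re P (tuple P (Comp P (Pr1 P (under X) (under Y)) h) (Comp P (Pr1 P (under X) (under Y)) k)) (elt X)
     \<sqinter>\<^bsub>Fib P (Dom P k)\<^esub>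
     Re P (tuple P (Comp P (Pr2 P (under X) (under Y)) h) (Comp P (Pr2 P (under X) (under Y)) k)) (elt Y)"
  using assms by (simp add: prod_q_sel cross_tuple)

lemma elt_prod_q_El:
  "X \<in> Obj (Tq0 P) \<Longrightarrow> Y \<in> Obj (Tq0 P) \<Longrightarrow>
    elt (prod_q P X Y) \<in> El (Prod P (Prod P (under X) (under Y)) (Prod P (under X) (under Y)))"
  by (simp add: prod_q_sel cross_tuple)

lemma Tq0_refl [simp]:
  "X \<in> Obj (Tq0 P) \<Longrightarrow> f \<in> Arr P \<Longrightarrow> Cod P f = under X \<Longrightarrow>
    Re P (tuple P f f) (elt X) = \<top>\<^bsub>Fib P (Dom P f)\<^esub>"
  by (rule equivalence_rel_refl[OF Tq0_ObjD(2)])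

lemma prod_q_Obj [simp]:
  assumes X [simp]: "X \<in> Obj (Tq0 P)" and Y [simp]: "Y \<in> Obj (Tq0 P)"
  shows "prod_q P X Y \<in> Obj (Tq0 P)"
proof -
  let ?A = "under X" and ?B = "under Y"
  note [simp] = elt_prod_q_El
  have "equivalence_rel P (Prod P ?A ?B) (elt (prod_q P X Y))"
  proof (rule equivalence_relI)
    show "reflexive_on (Prod P ?A ?B) (elt (prod_q P X Y))"
      by (auto simp: reflexive_on_def)
  next
    fix z V f g assume "z \<sqsubseteq>\<^bsub>Fib P V\<^esub> Re P (tuple P f g) (elt (prod_q P X Y))" "z \<in> El V"
      "f \<in> Arr P" "g \<in> Arr P" "Dom P f = V" "Dom P g = V" "Cod P f = Prod P ?A ?B" "Cod P g = Prod P ?A ?B"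
    moreover from this have "V \<in> Obj P" by auto
    ultimately show "z \<sqsubseteq>\<^bsub>Fib P V\<^esub> Re P (tuple P g f) (elt (prod_q P X Y))"
      by (auto intro: equivalence_rel_sym[OF Tq0_ObjD(2)[OF X]] equivalence_rel_sym[OF Tq0_ObjD(2)[OF Y]])
  next
    fix z V f g h assume "z \<sqsubseteq>\<^bsub>Fib P V\<^esub> Re P (tuple P f g) (elt (prod_q P X Y))"
      "z \<sqsubseteq>\<^bsub>Fib P V\<^esub> Re P (tuple P g h) (elt (prod_q P X Y))" and z: "z \<in> El V"
      and a: "f \<in> Arr P" "g \<in> Arr P" "h \<in> Arr P" "Dom P f = V" "Dom P g = V" "Dom P h = V"
      "Cod P f = Prod P ?A ?B" "Cod P g = Prod P ?A ?B" "Cod P h = Prod P ?A ?B"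
    moreover from this have "V \<in> Obj P" by auto
    ultimately show "z \<sqsubseteq>\<^bsub>Fib P V\<^esub> Re P (tuple P f h) (elt (prod_q P X Y))"
      using equivalence_rel_trans[OF Tq0_ObjD(2)[OF X], of V z "Comp P (Pr1 P ?A ?B) f" "Comp P (Pr1 P ?A ?B) g" "Comp P (Pr1 P ?A ?B) h"]
        equivalence_rel_trans[OF Tq0_ObjD(2)[OF Y], of V z "Comp P (Pr2 P ?A ?B) f" "Comp P (Pr2 P ?A ?B) g" "Comp P (Pr2 P ?A ?B) h"]
      by simp
  qed simp
  then show ?thesis unfolding Tq0_Obj[of "prod_q P X Y"] by (simp add: prod_q_def Let_def)
qed

lemma Tq0_lifted: "lifted_category P (Tq0 P)"
proof
  fix X Y Z and f g :: "('o, 'a, 'p) arr"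
  assume u: "AExt X f Y \<in> Arr (Tq0 P)" and v: "AExt Y g Z \<in> Arr (Tq0 P)"
  then have a [simp]: "X \<in> Obj (Tq0 P)" "Y \<in> Obj (Tq0 P)" "Z \<in> Obj (Tq0 P)" "f \<in> Arr P" "Dom P f = under X" "Cod P f = under Y"
    "g \<in> Arr P" "Dom P g = under Y" "Cod P g = under Z"
    by (auto simp: Tq0_Arr)
  show "AExt X (Comp P g f) Z \<in> Arr (Tq0 P)"
  proof (rule Tq0_ArrI)
    fix z V h k assume "z \<sqsubseteq>\<^bsub>Fib P V\<^esub> Re P (tuple P h k) (elt X)"
      and [simp]: "V \<in> Obj P" "z \<in> El V" "h \<in> Arr P" "k \<in> Arr P" "Dom P h = V" "Dom P k = V" "Cod P h = under X" "Cod P k = under X"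
    from Tq0_Arr_apply[OF v Tq0_Arr_apply[OF u this(1)]]
    show "z \<sqsubseteq>\<^bsub>Fib P V\<^esub> Re P (tuple P (Comp P (Comp P g f) h) (Comp P (Comp P g f) k)) (elt Z)" by simp
  qed simp_all
next
  fix X Y Z and h :: "('o, 'a, 'p) arr"
  assume u: "AExt Z (Comp P (Pr1 P (under X) (under Y)) h) X \<in> Arr (Tq0 P)"
    "AExt Z (Comp P (Pr2 P (under X) (under Y)) h) Y \<in> Arr (Tq0 P)"
    and h [simp]: "h \<in> Arr P" "Dom P h = under Z" "Cod P h = Prod P (under X) (under Y)"
  then have [simp]: "X \<in> Obj (Tq0 P)" "Y \<in> Obj (Tq0 P)" "Z \<in> Obj (Tq0 P)" by (auto simp: Tq0_Arr)
  show "AExt Z h (Prod (Tq0 P) X Y) \<in> Arr (Tq0 P)"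
    unfolding Tq0_sel
    by (rule Tq0_ArrI) (use Tq0_Arr_apply[OF u(1)] Tq0_Arr_apply[OF u(2)] in simp_all)
next
  fix X assume [simp]: "X \<in> Obj (Tq0 P)"
  show "AExt X (Ide P (under X)) X \<in> Arr (Tq0 P)" by (rule Tq0_ArrI) simp_all
next
  fix X Y assume [simp]: "X \<in> Obj (Tq0 P)" "Y \<in> Obj (Tq0 P)"
  show "Pr1 (Tq0 P) X Y \<in> Arr (Tq0 P)" "Pr2 (Tq0 P) X Y \<in> Arr (Tq0 P)"
    unfolding Tq0_sel by (rule Tq0_ArrI; simp)+
qed (auto simp: Tq0_Arr dest: Tq0_Arr_AExt)

lemmas Tq0_tuple = lifted_category.tuple_D[OF Tq0_lifted, simplified]
lemmas Tq0_cross = lifted_category.cross_D[OF Tq0_lifted, simplified]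

lemma Des_meet_top:
  assumes [simp]: "A \<in> Obj P" "\<rho> \<in> El (Prod P A A)"
  shows "\<top>\<^bsub>Fib P A\<^esub> \<in> Des P A \<rho>"
    and "\<alpha> \<in> Des P A \<rho> \<Longrightarrow> \<beta> \<in> Des P A \<rho> \<Longrightarrow> \<alpha> \<sqinter>\<^bsub>Fib P A\<^esub> \<beta> \<in> Des P A \<rho>"
proof -
  show "\<top>\<^bsub>Fib P A\<^esub> \<in> Des P A \<rho>" by (rule DesI) simp_all
  assume d: "\<alpha> \<in> Des P A \<rho>" "\<beta> \<in> Des P A \<rho>"
  then have [simp]: "\<alpha> \<in> El A" "\<beta> \<in> El A" by (simp_all add: Des_el)
  show "\<alpha> \<sqinter>\<^bsub>Fib P A\<^esub> \<beta> \<in> Des P A \<rho>"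
  proof (rule DesI)
    fix z assume "z \<in> El (Prod P A A)" "z \<sqsubseteq>\<^bsub>Fib P (Prod P A A)\<^esub> Re P (Pr1 P A A) (\<alpha> \<sqinter>\<^bsub>Fib P A\<^esub> \<beta>)"
      "z \<sqsubseteq>\<^bsub>Fib P (Prod P A A)\<^esub> \<rho>"
    then show "z \<sqsubseteq>\<^bsub>Fib P (Prod P A A)\<^esub> Re P (Pr2 P A A) (\<alpha> \<sqinter>\<^bsub>Fib P A\<^esub> \<beta>)"
      using DesD[OF d(1), of "Prod P A A" z "Pr1 P A A" "Pr2 P A A"] DesD[OF d(2), of "Prod P A A" z "Pr1 P A A" "Pr2 P A A"]
      by simp
  qed simp_all
qed

lemma Des_infsl:
  assumes "A \<in> Obj P" "\<rho> \<in> El (Prod P A A)"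
  shows "infsl ((Fib P A)\<lparr>carrier := Des P A \<rho>\<rparr>)"
    and "x \<in> Des P A \<rho> \<Longrightarrow> y \<in> Des P A \<rho> \<Longrightarrow>
      x \<sqinter>\<^bsub>(Fib P A)\<lparr>carrier := Des P A \<rho>\<rparr>\<^esub> y = x \<sqinter>\<^bsub>Fib P A\<^esub> y"
    and "\<top>\<^bsub>(Fib P A)\<lparr>carrier := Des P A \<rho>\<rparr>\<^esub> = \<top>\<^bsub>Fib P A\<^esub>"
proof -
  have "Des P A \<rho> \<subseteq> El A" by (auto simp: Des_def)
  note I = infsl_subposet[OF infsl_Fib[OF assms(1)] this, where t = "\<top>\<^bsub>Fib P A\<^esub>"]
  note D = Des_meet_top[OF assms]
  show "infsl ((Fib P A)\<lparr>carrier := Des P A \<rho>\<rparr>)" "\<top>\<^bsub>(Fib P A)\<lparr>carrier := Des P A \<rho>\<rparr>\<^esub> = \<top>\<^bsub>Fib P A\<^esub>"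
    by (rule I; use assms in \<open>simp add: D Des_el\<close>)+
  show "x \<in> Des P A \<rho> \<Longrightarrow> y \<in> Des P A \<rho> \<Longrightarrow>
      x \<sqinter>\<^bsub>(Fib P A)\<lparr>carrier := Des P A \<rho>\<rparr>\<^esub> y = x \<sqinter>\<^bsub>Fib P A\<^esub> y"
    by (rule I(2)) (use assms in \<open>simp_all add: D Des_el\<close>)
qed

declare Des_infsl(2,3) [simp]

text \<open>If \<open>\<gamma>\<close> holds at \<open>f a\<close> and \<open>\<rho>(a, a')\<close>, then \<open>\<sigma>(f a, f a')\<close>, so \<open>\<gamma>\<close> holds at \<open>f a'\<close>.\<close>

lemma Des_Re:
  assumes u: "AExt X f Y \<in> Arr (Tq0 P)" and d: "\<gamma> \<in> Des P (under Y) (elt Y)"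
  shows "Re P f \<gamma> \<in> Des P (under X) (elt X)"
proof -
  have [simp]: "X \<in> Obj (Tq0 P)" "Y \<in> Obj (Tq0 P)" "f \<in> Arr P" "Dom P f = under X" "Cod P f = under Y"
    using u by (auto simp: Tq0_Arr)
  have [simp]: "\<gamma> \<in> El (under Y)" using d by (rule Des_el)
  let ?AA = "Prod P (under X) (under X)"
  show ?thesis
  proof (rule DesI)
    fix z assume z: "z \<in> El ?AA" "z \<sqsubseteq>\<^bsub>Fib P ?AA\<^esub> Re P (Pr1 P (under X) (under X)) (Re P f \<gamma>)" "z \<sqsubseteq>\<^bsub>Fib P ?AA\<^esub> elt X"
    have "z \<sqsubseteq>\<^bsub>Fib P ?AA\<^esub> Re P (tuple P (Comp P f (Pr1 P (under X) (under X))) (Comp P f (Pr2 P (under X) (under X)))) (elt Y)"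
      by (rule Tq0_Arr_apply[OF u]) (use z in simp_all)
    from DesD[OF d _ this] z show "z \<sqsubseteq>\<^bsub>Fib P ?AA\<^esub> Re P (Pr2 P (under X) (under X)) (Re P f \<gamma>)" by simp
  qed simp_all
qed

lemma Tq0_fibre:
  assumes [simp]: "X \<in> Obj (Tq0 P)"
  shows "infsl (Fib (Tq0 P) X)"
    and "\<And>x y. \<lbrakk>x \<in> Des P (under X) (elt X); y \<in> Des P (under X) (elt X)\<rbrakk>
      \<Longrightarrow> x \<sqinter>\<^bsub>Fib (Tq0 P) X\<^esub> y = x \<sqinter>\<^bsub>Fib P (under X)\<^esub> y"
    and "\<top>\<^bsub>Fib (Tq0 P) X\<^esub> = \<top>\<^bsub>Fib P (under X)\<^esub>"
  by (simp_all add: Des_infsl(1))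

lemma Tq0_doctrine: "doctrine (Tq0 P)"
  unfolding doctrine_def
proof (intro conjI ballI impI)
  show "category_with_products (Tq0 P)"
    using lifted_category.prod_category_D[OF Tq0_lifted] by (simp add: prod_category_def)
next
  fix X assume "X \<in> Obj (Tq0 P)"
  then show "infsl (Fib (Tq0 P) X)" by (rule Tq0_fibre(1))
next
  fix u assume u: "u \<in> Arr (Tq0 P)"
  then obtain X f Y where u': "u = AExt X f Y" using Tq0_Arr_AExt by blast
  note uu = u[unfolded u']
  then have [simp]: "X \<in> Obj (Tq0 P)" "Y \<in> Obj (Tq0 P)" "f \<in> Arr P" "Dom P f = under X" "Cod P f = under Y"
    by (auto simp: Tq0_Arr)
  show "infsl_hom (Fib (Tq0 P) (Cod (Tq0 P) u)) (Fib (Tq0 P) (Dom (Tq0 P) u)) (Re (Tq0 P) u)"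
    unfolding infsl_hom_def u' Tq0_sel(1,2) arr.sel
  proof (intro conjI funcsetI ballI)
    fix \<gamma> assume "\<gamma> \<in> carrier (Fib (Tq0 P) Y)"
    then show "Re (Tq0 P) (AExt X f Y) \<gamma> \<in> carrier (Fib (Tq0 P) X)" using Des_Re[OF uu] by simp
  next
    show "Re (Tq0 P) (AExt X f Y) \<top>\<^bsub>Fib (Tq0 P) Y\<^esub> = \<top>\<^bsub>Fib (Tq0 P) X\<^esub>"
      unfolding Tq0_fibre(3)[OF \<open>X \<in> _\<close>] Tq0_fibre(3)[OF \<open>Y \<in> _\<close>] Tq0_sel(8) by simp
  next
    fix \<gamma> \<gamma>' assume "\<gamma> \<in> carrier (Fib (Tq0 P) Y)" "\<gamma>' \<in> carrier (Fib (Tq0 P) Y)"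
    then have a: "\<gamma> \<in> Des P (under Y) (elt Y)" "\<gamma>' \<in> Des P (under Y) (elt Y)" by simp_all
    then have [simp]: "\<gamma> \<in> El (under Y)" "\<gamma>' \<in> El (under Y)" by (simp_all add: Des_el)
    show "Re (Tq0 P) (AExt X f Y) (\<gamma> \<sqinter>\<^bsub>Fib (Tq0 P) Y\<^esub> \<gamma>') =
      Re (Tq0 P) (AExt X f Y) \<gamma> \<sqinter>\<^bsub>Fib (Tq0 P) X\<^esub> Re (Tq0 P) (AExt X f Y) \<gamma>'"
      unfolding Tq0_sel(8) Tq0_fibre(2)[OF \<open>Y \<in> _\<close> a] Tq0_fibre(2)[OF \<open>X \<in> _\<close> Des_Re[OF uu a(1)] Des_Re[OF uu a(2)]]
      by simp
  qed
next
  fix X \<gamma> assume "X \<in> Obj (Tq0 P)" and "\<gamma> \<in> carrier (Fib (Tq0 P) X)"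
  then show "Re (Tq0 P) (Ide (Tq0 P) X) \<gamma> = \<gamma>" by (simp add: Des_el)
next
  fix u v \<gamma> assume u: "u \<in> Arr (Tq0 P)" and v: "v \<in> Arr (Tq0 P)" and uv: "Dom (Tq0 P) v = Cod (Tq0 P) u"
    and \<gamma>: "\<gamma> \<in> carrier (Fib (Tq0 P) (Cod (Tq0 P) v))"
  from u uv obtain X f Y where u': "u = AExt X f Y" "asrc v = Y" using Tq0_Arr_AExt by fastforce
  with v obtain g Z where v': "v = AExt Y g Z" using Tq0_Arr_AExt by fastforce
  show "Re (Tq0 P) (Comp (Tq0 P) v u) \<gamma> = Re (Tq0 P) u (Re (Tq0 P) v \<gamma>)"
    using u v \<gamma> unfolding u' v' by (auto simp: Tq0_Arr Des_el)
qed

text \<open>Substitutivity of \<open>\<rho>\<close> is the descent of \<open>\<zeta>\<close> along the product relation on \<open>(X \<times> A) \<times> A\<close>: if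
  \<open>\<rho>(f, g)\<close> holds, that relation holds between \<open>(x, f, f)\<close> and \<open>(x, f, g)\<close>. That \<open>\<rho>\<close> itself is an
  element of the fibre over \<open>(A, \<rho>) \<times> (A, \<rho>)\<close> is a consequence of symmetry and transitivity.\<close>

lemma Tq0_delta_raw:
  assumes X [simp]: "X \<in> Obj (Tq0 P)"
  shows "is_delta (Tq0 P) X (elt X)"
proof -
  interpret q: indexed_infsl "Tq0 P" by (rule doctrineD[OF Tq0_doctrine])
  let ?A = "under X"
  let ?AA = "Prod P ?A ?A"
  have XX [simp]: "prod_q P X X \<in> Obj (Tq0 P)" by simp
  note eqX = Tq0_ObjD(2)[OF X]
  have d: "elt X \<in> Des P ?AA (elt (prod_q P X X))"
  proof (rule DesI)
    let ?Q = "Prod P ?AA ?AA"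
    let ?a = "Comp P (Pr1 P ?A ?A) (Pr1 P ?AA ?AA)" and ?b = "Comp P (Pr2 P ?A ?A) (Pr1 P ?AA ?AA)"
    let ?a' = "Comp P (Pr1 P ?A ?A) (Pr2 P ?AA ?AA)" and ?b' = "Comp P (Pr2 P ?A ?A) (Pr2 P ?AA ?AA)"
    fix z assume [simp]: "z \<in> El ?Q"
      and z1: "z \<sqsubseteq>\<^bsub>Fib P ?Q\<^esub> Re P (Pr1 P ?AA ?AA) (elt X)" and z2: "z \<sqsubseteq>\<^bsub>Fib P ?Q\<^esub> elt (prod_q P X X)"
    have t: "tuple P ?a ?b = Pr1 P ?AA ?AA" "tuple P ?a' ?b' = Pr2 P ?AA ?AA" by simp_all
    have "z \<sqsubseteq>\<^bsub>Fib P ?Q\<^esub> Re P (tuple P (Pr1 P ?AA ?AA) (Pr2 P ?AA ?AA)) (elt (prod_q P X X))"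
      using z2 elt_prod_q_El[OF X X] by simp
    then have z3: "z \<sqsubseteq>\<^bsub>Fib P ?Q\<^esub> Re P (tuple P ?a ?a') (elt X)" "z \<sqsubseteq>\<^bsub>Fib P ?Q\<^esub> Re P (tuple P ?b ?b') (elt X)"
      by (simp_all del: tuple_Pr)
    \<comment> \<open>The chain \<open>a'\<close>, \<open>a\<close>, \<open>b\<close>, \<open>b'\<close>, with the middle link given by \<open>\<rho>(a, b)\<close>.\<close>
    have "z \<sqsubseteq>\<^bsub>Fib P ?Q\<^esub> Re P (tuple P ?a' ?a) (elt X)"
      by (rule equivalence_rel_sym[OF eqX z3(1)]) simp_all
    from equivalence_rel_trans[OF eqX this, of ?b] z1 have "z \<sqsubseteq>\<^bsub>Fib P ?Q\<^esub> Re P (tuple P ?a' ?b) (elt X)" by (simp add: t(1))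
    from equivalence_rel_trans[OF eqX this z3(2)] show "z \<sqsubseteq>\<^bsub>Fib P ?Q\<^esub> Re P (Pr2 P ?AA ?AA) (elt X)" by simp
  qed (simp_all add: elt_prod_q_El)
  have "q.reflexive_on X (elt X)"
    unfolding q.reflexive_on_def
  proof (intro conjI ballI impI)
    show "elt X \<in> carrier (Fib (Tq0 P) (Prod (Tq0 P) X X))" using d by simp
  next
    fix u assume u: "u \<in> Arr (Tq0 P)" "Cod (Tq0 P) u = X"
    then obtain Y f where u': "u = AExt Y f X" using Tq0_Arr_AExt by fastforce
    note uu = u(1)[unfolded u']
    have [simp]: "Y \<in> Obj (Tq0 P)" "f \<in> Arr P" "Dom P f = under Y" "Cod P f = under X"
      using uu by (auto simp: Tq0_Arr)
    show "Re (Tq0 P) (tuple (Tq0 P) u u) (elt X) = \<top>\<^bsub>Fib (Tq0 P) (Dom (Tq0 P) u)\<^esub>"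
      unfolding u' Tq0_tuple(1)[OF uu uu] Tq0_sel(1) arr.sel Tq0_fibre(3)[OF \<open>Y \<in> _\<close>] Tq0_sel(8) by simp
  qed
  moreover have "q.substitutive_on X (elt X)"
    unfolding q.substitutive_on_def
  proof (intro ballI impI, elim conjE)
    fix W \<zeta> w u v z
    assume W [simp]: "W \<in> Obj (Tq0 P)" and \<zeta>: "\<zeta> \<in> carrier (Fib (Tq0 P) (Prod (Tq0 P) (Prod (Tq0 P) W X) X))"
      and w: "w \<in> Arr (Tq0 P)" and u: "u \<in> Arr (Tq0 P)" and v: "v \<in> Arr (Tq0 P)"
      and z: "z \<in> carrier (Fib (Tq0 P) (Dom (Tq0 P) u))"
      and ty: "Dom (Tq0 P) w = Dom (Tq0 P) u" "Dom (Tq0 P) v = Dom (Tq0 P) u"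
        "Cod (Tq0 P) w = W" "Cod (Tq0 P) u = X" "Cod (Tq0 P) v = X"
      and le: "z \<sqsubseteq>\<^bsub>Fib (Tq0 P) (Dom (Tq0 P) u)\<^esub> Re (Tq0 P) (tuple (Tq0 P) (tuple (Tq0 P) w u) u) \<zeta>"
        "z \<sqsubseteq>\<^bsub>Fib (Tq0 P) (Dom (Tq0 P) u)\<^esub> Re (Tq0 P) (tuple (Tq0 P) u v) (elt X)"
    obtain Y f where u': "u = AExt Y f X" using Tq0_Arr_AExt[OF u] ty by auto
    obtain g where v': "v = AExt Y g X" using Tq0_Arr_AExt[OF v] ty u' by auto
    obtain x where w': "w = AExt Y x W" using Tq0_Arr_AExt[OF w] ty u' by auto
    note T = w[unfolded w'] u[unfolded u'] v[unfolded v']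
    have [simp]: "Y \<in> Obj (Tq0 P)" "f \<in> Arr P" "Dom P f = under Y" "Cod P f = under X"
      "g \<in> Arr P" "Dom P g = under Y" "Cod P g = under X"
      "x \<in> Arr P" "Dom P x = under Y" "Cod P x = under W"
      using T by (auto simp: Tq0_Arr)
    note t1 = Tq0_tuple[OF T(1,2)]
    note t2 = Tq0_tuple(1)[OF t1(2) T(2)] Tq0_tuple(1)[OF t1(2) T(3)] Tq0_tuple(1)[OF T(2,3)]
    have z' [simp]: "z \<in> El (under Y)" using z by (simp add: u' Des_el)
    have \<zeta>': "\<zeta> \<in> Des P (Prod P (Prod P (under W) (under X)) (under X)) (elt (prod_q P (prod_q P W X) X))"
      using \<zeta> by simp
    have l: "z \<sqsubseteq>\<^bsub>Fib P (under Y)\<^esub> Re P (tuple P (tuple P x f) f) \<zeta>"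
      "z \<sqsubseteq>\<^bsub>Fib P (under Y)\<^esub> Re P (tuple P f g) (elt X)"
      using le by (simp_all add: u' v' w' t1 t2)
    have "z \<sqsubseteq>\<^bsub>Fib P (under Y)\<^esub> Re P (tuple P (tuple P (tuple P x f) f) (tuple P (tuple P x f) g)) (elt (prod_q P (prod_q P W X) X))"
      using l by simp
    from DesD[OF \<zeta>' l(1) this] elt_prod_q_El[of "prod_q P W X" X]
    have "z \<sqsubseteq>\<^bsub>Fib P (under Y)\<^esub> Re P (tuple P (tuple P x f) g) \<zeta>" by simp
    then show "z \<sqsubseteq>\<^bsub>Fib (Tq0 P) (Dom (Tq0 P) u)\<^esub> Re (Tq0 P) (tuple (Tq0 P) (tuple (Tq0 P) w u) v) \<zeta>"
      by (simp add: u' v' w' t1 t2)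
  qed
  ultimately show ?thesis using q.is_delta_iff[of X] by simp
qed

lemma Tq0_elementary: "elementary_doctrine (Tq0 P)"
  unfolding elementary_doctrine_def using Tq0_doctrine Tq0_delta_raw by blast

lemma Tq0_delta: 
  assumes "X \<in> Obj (Tq0 P)"
  shows "delta (Tq0 P) X = elt X"
proof -
  interpret q: elem_doctrine "Tq0 P" by (rule elementary_doctrineD[OF Tq0_elementary])
  show ?thesis using q.is_delta_delta[OF assms] Tq0_delta_raw[OF assms] q.delta_unique[OF assms] by blast
qed

end

section \<open>1-cells and images of relations\<close>

lemma mk1_sel [simp]:
  "Src1 (mk1 P R Fo Fa b) = P" "Tgt1 (mk1 P R Fo Fa b) = R"
  "A \<in> Obj P \<Longrightarrow> OMap (mk1 P R Fo Fa b) A = Fo A"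
  "f \<in> Arr P \<Longrightarrow> AMap (mk1 P R Fo Fa b) f = Fa f"
  "A \<in> Obj P \<Longrightarrow> \<alpha> \<in> carrier (Fib P A) \<Longrightarrow> FMap (mk1 P R Fo Fa b) A \<alpha> = b A \<alpha>"
  by (simp_all add: mk1_def)

lemma mk1_eqI:
  assumes "\<And>A. A \<in> Obj P \<Longrightarrow> Fo A = Fo' A" "\<And>f. f \<in> Arr P \<Longrightarrow> Fa f = Fa' f"
    "\<And>A \<alpha>. A \<in> Obj P \<Longrightarrow> \<alpha> \<in> carrier (Fib P A) \<Longrightarrow> b A \<alpha> = b' A \<alpha>"
  shows "mk1 P R Fo Fa b = mk1 P R Fo' Fa' b'"
  using assms by (auto simp: mk1_def restrict_def fun_eq_iff)

lemma mk1_mk1: "mk1 P R (OMap (mk1 P R Fo Fa b)) (AMap (mk1 P R Fo Fa b)) (FMap (mk1 P R Fo Fa b)) = mk1 P R Fo Fa b"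
  by (rule mk1_eqI) simp_all

lemma cell1_mk1I:
  assumes P: "elementary_doctrine P" and R: "elementary_doctrine R"
    and func: "is_functor P R Fo Fa" and prod: "preserves_products P R Fo Fa"
    and hom: "\<And>A. A \<in> Obj P \<Longrightarrow> infsl_hom (Fib P A) (Fib R (Fo A)) (b A)"
    and nat: "\<And>f \<alpha>. f \<in> Arr P \<Longrightarrow> \<alpha> \<in> carrier (Fib P (Cod P f)) \<Longrightarrow>
        b (Dom P f) (Re P f \<alpha>) = Re R (Fa f) (b (Cod P f) \<alpha>)"
    and delta: "\<And>A. A \<in> Obj P \<Longrightarrow> b (Prod P A A) (delta P A)
        = Re R (tuple R (Fa (Pr1 P A A)) (Fa (Pr2 P A A))) (delta R (Fo A))"
  shows "cell1_in P R (mk1 P R Fo Fa b)"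
proof -
  interpret P: elem_doctrine P by (rule elementary_doctrineD[OF P])
  have "infsl_hom (Fib P A) (Fib R (Fo A)) (restrict (b A) (carrier (Fib P A)))" if "A \<in> Obj P" for A
    using hom[OF that] that by (auto simp: infsl_hom_def)
  moreover have "FMap (mk1 P R Fo Fa b) A = restrict (b A) (carrier (Fib P A))" if "A \<in> Obj P" for A
    using that by (simp add: mk1_def)
  moreover have "is_functor P R (OMap (mk1 P R Fo Fa b)) (AMap (mk1 P R Fo Fa b))"
    using func unfolding is_functor_def by simp
  moreover have "preserves_products P R (OMap (mk1 P R Fo Fa b)) (AMap (mk1 P R Fo Fa b))"
    using prod unfolding preserves_products_def by simp
  ultimately show ?thesis
    unfolding cell1_in_def using P R nat delta by (simp add: mk1_mk1)
qed

lemma cell1_strictI: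
  assumes P: "elementary_doctrine P" and R: "elementary_doctrine R"
    and func: "is_functor P R Fo Fa"
    and prod: "\<And>A B. A \<in> Obj P \<Longrightarrow> B \<in> Obj P \<Longrightarrow> Fo (Prod P A B) = Prod R (Fo A) (Fo B) \<and>
      Fa (Pr1 P A B) = Pr1 R (Fo A) (Fo B) \<and> Fa (Pr2 P A B) = Pr2 R (Fo A) (Fo B)"
    and hom: "\<And>A. A \<in> Obj P \<Longrightarrow> infsl_hom (Fib P A) (Fib R (Fo A)) (b A)"
    and nat: "\<And>f \<alpha>. f \<in> Arr P \<Longrightarrow> \<alpha> \<in> carrier (Fib P (Cod P f)) \<Longrightarrow>
        b (Dom P f) (Re P f \<alpha>) = Re R (Fa f) (b (Cod P f) \<alpha>)"
    and delta: "\<And>A. A \<in> Obj P \<Longrightarrow> b (Prod P A A) (delta P A) = delta R (Fo A)"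
  shows "cell1_in P R (mk1 P R Fo Fa b)"
proof -
  interpret P: elem_doctrine P by (rule elementary_doctrineD[OF P])
  interpret R: elem_doctrine R by (rule elementary_doctrineD[OF R])
  have ob: "\<And>A. A \<in> Obj P \<Longrightarrow> Fo A \<in> Obj R" using func by (simp add: is_functor_def)
  show ?thesis
    by (rule cell1_mk1I[OF P R func _ hom nat])
      (simp_all add: preserves_products_def prod ob R.product_Prod delta)
qed

lemma (in lifted_category) is_functorI:
  assumes E: "prod_category E"
    and ob: "\<And>A. A \<in> Obj E \<Longrightarrow> Fo A \<in> Obj D"
    and ar: "\<And>f. f \<in> Arr E \<Longrightarrow> AExt (Fo (Dom E f)) (U f) (Fo (Cod E f)) \<in> Arr D"
    and id: "\<And>A. A \<in> Obj E \<Longrightarrow> U (Ide E A) = Ide C (under (Fo A))"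
    and comp: "\<And>f g. f \<in> Arr E \<Longrightarrow> g \<in> Arr E \<Longrightarrow> Dom E g = Cod E f \<Longrightarrow>
      U (Comp E g f) = Comp C (U g) (U f)"
    and Fa: "\<And>f. f \<in> Arr E \<Longrightarrow> Fa f = AExt (Fo (Dom E f)) (U f) (Fo (Cod E f))"
  shows "is_functor E D Fo Fa"
proof -
  interpret E: prod_category E by (rule E)
  show ?thesis
    unfolding is_functor_def hom_def by (simp add: ob ar id comp Fa sel_D)
qed

lemma cell1_inD:
  assumes "cell1_in P R F"
  shows "elementary_doctrine P" "elementary_doctrine R" "Src1 F = P" "Tgt1 F = R"
    "F = mk1 P R (OMap F) (AMap F) (FMap F)"
proof -
  show eq: "F = mk1 P R (OMap F) (AMap F) (FMap F)" and "elementary_doctrine P" "elementary_doctrine R"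
    using assms by (simp_all add: cell1_in_def)
  show "Src1 F = P" "Tgt1 F = R" by (subst eq, simp)+
qed

text \<open>The relation part of the object \<open>obj_q F (A, \<rho>)\<close>.\<close>

definition rel_image :: "('o, 'a, 'p) ed1 \<Rightarrow> ('o, 'p) obj \<Rightarrow> 'p \<Rightarrow> 'p" where
  "rel_image F A \<rho> = Re (Tgt1 F)
     (inv_arr (Tgt1 F) (tuple (Tgt1 F) (AMap F (Pr1 (Src1 F) A A)) (AMap F (Pr2 (Src1 F) A A))))
     (FMap F (Prod (Src1 F) A A) \<rho>)"

lemma obj_q_sel [simp]:
  "under (obj_q F X) = OMap F (under X)" "elt (obj_q F X) = rel_image F (under X) (elt X)"
  by (simp_all add: obj_q_def rel_image_def Let_def)

lemma obj_c_sel [simp]: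
  "under (obj_c F X) = OMap F (under X)" "elt (obj_c F X) = FMap F (under X) (elt X)"
  by (simp_all add: obj_c_def)

locale ed_cell = P: ed_doctrine P + R: ed_doctrine R
  for P R :: "('o, 'a, 'p) ed" +
  fixes F :: "('o, 'a, 'p) ed1"
  assumes cell: "cell1_in P R F"
begin

lemma Src_Tgt [simp]: "Src1 F = P" "Tgt1 F = R"
  using cell1_inD[OF cell] by simp_all

lemma functor_simps [simp]:
  "A \<in> Obj P \<Longrightarrow> OMap F A \<in> Obj R"
  "f \<in> Arr P \<Longrightarrow> AMap F f \<in> Arr R"
  "f \<in> Arr P \<Longrightarrow> Dom R (AMap F f) = OMap F (Dom P f)"
  "f \<in> Arr P \<Longrightarrow> Cod R (AMap F f) = OMap F (Cod P f)"
  "A \<in> Obj P \<Longrightarrow> AMap F (Ide P A) = Ide R (OMap F A)"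
  "f \<in> Arr P \<Longrightarrow> g \<in> Arr P \<Longrightarrow> Dom P g = Cod P f \<Longrightarrow> AMap F (Comp P g f) = Comp R (AMap F g) (AMap F f)"
proof -
  have "is_functor P R (OMap F) (AMap F)" using cell by (simp add: cell1_in_def)
  then show "A \<in> Obj P \<Longrightarrow> OMap F A \<in> Obj R"
  "f \<in> Arr P \<Longrightarrow> AMap F f \<in> Arr R"
  "f \<in> Arr P \<Longrightarrow> Dom R (AMap F f) = OMap F (Dom P f)"
  "f \<in> Arr P \<Longrightarrow> Cod R (AMap F f) = OMap F (Cod P f)"
  "A \<in> Obj P \<Longrightarrow> AMap F (Ide P A) = Ide R (OMap F A)"
  "f \<in> Arr P \<Longrightarrow> g \<in> Arr P \<Longrightarrow> Dom P g = Cod P f \<Longrightarrow> AMap F (Comp P g f) = Comp R (AMap F g) (AMap F f)"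
    by (simp_all add: is_functor_def hom_def)
qed

lemma image_product:
  "A \<in> Obj P \<Longrightarrow> B \<in> Obj P \<Longrightarrow>
    is_product R (OMap F A) (OMap F B) (OMap F (Prod P A B)) (AMap F (Pr1 P A B)) (AMap F (Pr2 P A B))"
  using cell by (simp add: cell1_in_def preserves_products_def)

lemma FMap_hom: "A \<in> Obj P \<Longrightarrow> infsl_hom (Fib P A) (Fib R (OMap F A)) (FMap F A)"
  using cell by (simp add: cell1_in_def)

lemma FMap_simps [simp]:
  "A \<in> Obj P \<Longrightarrow> \<alpha> \<in> P.El A \<Longrightarrow> OMap F A = B \<Longrightarrow> FMap F A \<alpha> \<in> R.El B"
  "A \<in> Obj P \<Longrightarrow> FMap F A \<top>\<^bsub>Fib P A\<^esub> = \<top>\<^bsub>Fib R (OMap F A)\<^esub>"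
  "A \<in> Obj P \<Longrightarrow> \<alpha> \<in> P.El A \<Longrightarrow> \<beta> \<in> P.El A \<Longrightarrow>
    FMap F A (\<alpha> \<sqinter>\<^bsub>Fib P A\<^esub> \<beta>) = FMap F A \<alpha> \<sqinter>\<^bsub>Fib R (OMap F A)\<^esub> FMap F A \<beta>"
  using FMap_hom[of A] by (auto simp: infsl_hom_def)

lemma FMap_Re:
  "f \<in> Arr P \<Longrightarrow> Dom P f = A \<Longrightarrow> \<alpha> \<in> P.El (Cod P f) \<Longrightarrow>
    FMap F A (Re P f \<alpha>) = Re R (AMap F f) (FMap F (Cod P f) \<alpha>)"
  using cell by (auto simp: cell1_in_def)

lemmas FMap_Re_simps [simp] =
  FMap_Re[where f = "Pr1 P B C" for B C] FMap_Re[where f = "Pr2 P B C" for B C]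
  FMap_Re[where f = "Comp P g h" for g h]

lemma FMap_mono:
  assumes "\<alpha> \<sqsubseteq>\<^bsub>Fib P A\<^esub> \<beta>" "A \<in> Obj P" "\<alpha> \<in> P.El A" "\<beta> \<in> P.El A" "OMap F A = B"
  shows "FMap F A \<alpha> \<sqsubseteq>\<^bsub>Fib R B\<^esub> FMap F A \<beta>"
proof -
  have B: "B \<in> Obj R" using assms by auto
  have "FMap F A (\<alpha> \<sqinter>\<^bsub>Fib P A\<^esub> \<beta>) = FMap F A \<alpha>" using P.meet_absorb[of A \<alpha> \<beta>] assms by simp
  then have e: "FMap F A \<alpha> \<sqinter>\<^bsub>Fib R B\<^esub> FMap F A \<beta> = FMap F A \<alpha>" using assms by simp
  have "FMap F A \<alpha> \<sqinter>\<^bsub>Fib R B\<^esub> FMap F A \<beta> \<sqsubseteq>\<^bsub>Fib R B\<^esub> FMap F A \<beta>"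
    by (rule R.leI) (use assms B in simp_all)
  then show ?thesis unfolding e .
qed

lemma FMap_delta:
  "A \<in> Obj P \<Longrightarrow> FMap F (Prod P A A) (delta P A)
        = Re R (tuple R (AMap F (Pr1 P A A)) (AMap F (Pr2 P A A))) (delta R (OMap F A))"
  using cell by (simp add: cell1_in_def)

lemma rel_image_El [simp]:
  assumes "A \<in> Obj P" "\<rho> \<in> P.El (Prod P A A)"
  shows "rel_image F A \<rho> \<in> R.El (Prod R (OMap F A) (OMap F A))"
  by (rule R.is_product_iso[OF image_product[OF assms(1,1)]]) (use assms in \<open>simp add: rel_image_def\<close>)

lemma Re_rel_image:
  assumes [simp]: "A \<in> Obj P" "\<rho> \<in> P.El (Prod P A A)"
  shows "Re R (tuple R (AMap F (Pr1 P A A)) (AMap F (Pr2 P A A))) (rel_image F A \<rho>) = FMap F (Prod P A A) \<rho>"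
  by (rule R.is_product_iso[OF image_product[OF assms(1,1)]])
    (simp add: rel_image_def del: R.tuple_comp)

text \<open>The inverse comparison in the definition of \<open>rel_image\<close> is eliminated here: the image relation is
  the only relation on \<open>F A\<close> that becomes \<open>F \<rho>\<close> when reindexed to \<open>F (A \<times> A)\<close>. Equations between
  image relations are proved through this characterization.\<close>

lemma rel_image_unique:
  assumes [simp]: "A \<in> Obj P" "\<rho>' \<in> R.El (Prod R (OMap F A) (OMap F A))"
    and eq: "Re R (tuple R (AMap F (Pr1 P A A)) (AMap F (Pr2 P A A))) \<rho>' = FMap F (Prod P A A) \<rho>"
  shows "rel_image F A \<rho> = \<rho>'"
  by (rule R.is_product_iso[OF image_product[OF assms(1,1)]])
    (simp add: rel_image_def eq[symmetric] del: R.tuple_comp)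

lemma FMap_tuple [simp]:
  assumes [simp]: "f \<in> Arr P" "g \<in> Arr P" "Dom P f = B" "Dom P g = B" "Cod P g = Cod P f"
    "\<rho> \<in> P.El (Prod P (Cod P f) (Cod P f))"
  shows "FMap F B (Re P (tuple P f g) \<rho>) = Re R (tuple R (AMap F f) (AMap F g)) (rel_image F (Cod P f) \<rho>)"
proof -
  let ?A = "Cod P f"
  have "AMap F (Comp P (Pr1 P ?A ?A) (tuple P f g)) = AMap F f" "AMap F (Comp P (Pr2 P ?A ?A) (tuple P f g)) = AMap F g"
    by simp_all
  then have [simp]: "Comp R (AMap F (Pr1 P ?A ?A)) (AMap F (tuple P f g)) = AMap F f"
    "Comp R (AMap F (Pr2 P ?A ?A)) (AMap F (tuple P f g)) = AMap F g"
    by (subst (asm) (1 2) functor_simps(6); simp)+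
  show ?thesis by (simp add: FMap_Re Re_rel_image[symmetric])
qed

text \<open>Every pair of elements of \<open>F A\<close> and \<open>F B\<close> comes from a single element of \<open>F (A \<times> B)\<close>, since \<open>F\<close>
  preserves products. For \<open>A = B\<close>, evaluating the image of \<open>\<rho>\<close> at the pair is reindexing
  \<open>F \<rho>\<close> along that element.\<close>

lemma pair_factor:
  assumes "a \<in> Arr R" "b \<in> Arr R" "Dom R a = Z" "Dom R b = Z" "Cod R a = OMap F A" "Cod R b = OMap F B"
    "A \<in> Obj P" "B \<in> Obj P"
  obtains m where "m \<in> Arr R" "Dom R m = Z" "Cod R m = OMap F (Prod P A B)"
    "a = Comp R (AMap F (Pr1 P A B)) m" "b = Comp R (AMap F (Pr2 P A B)) m"
  by (rule R.is_productE[OF image_product[OF assms(7,8)] assms(1,2)]) (use assms that in auto)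

text \<open>Together with the factorization of pairs this transfers Horn clauses about relations from \<open>P\<close>
  to their images: factor the arguments through \<open>F\<close> of the context, apply \<open>F\<close> to the entailment
  between elements of that fibre of \<open>P\<close>, and reindex.\<close>

lemma FMap_le_apply:
  assumes "\<alpha> \<sqsubseteq>\<^bsub>Fib P A\<^esub> \<beta>" "z \<sqsubseteq>\<^bsub>Fib R Z\<^esub> Re R m (FMap F A \<alpha>)" "A \<in> Obj P" "\<alpha> \<in> P.El A" "\<beta> \<in> P.El A"
    "m \<in> Arr R" "Dom R m = Z" "Cod R m = OMap F A" "z \<in> R.El Z"
  shows "z \<sqsubseteq>\<^bsub>Fib R Z\<^esub> Re R m (FMap F A \<beta>)"
  by (rule R.Re_le_apply[OF FMap_mono[OF assms(1), where B = "OMap F A"] assms(2)]) (use assms in simp_all)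

lemma rel_image_refl:
  assumes r: "P.reflexive_on A \<rho>" and [simp]: "A \<in> Obj P"
  shows "R.reflexive_on (OMap F A) (rel_image F A \<rho>)"
proof -
  have \<rho>: "\<rho> \<in> P.El (Prod P A A)" "Re P (tuple P (Ide P A) (Ide P A)) \<rho> = \<top>\<^bsub>Fib P A\<^esub>"
    using P.reflexive_onD[OF r] by simp_all
  have *: "Re R (tuple R (Ide R (OMap F A)) (Ide R (OMap F A))) (rel_image F A \<rho>) = \<top>\<^bsub>Fib R (OMap F A)\<^esub>"
    using FMap_tuple[of "Ide P A" "Ide P A" A \<rho>] \<rho> by (simp del: FMap_tuple)
  show ?thesis
    unfolding R.reflexive_on_def
  proof (intro conjI ballI impI)
    fix f assume [simp]: "f \<in> Arr R" "Cod R f = OMap F A"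
    show "Re R (tuple R f f) (rel_image F A \<rho>) = \<top>\<^bsub>Fib R (Dom R f)\<^esub>"
      using arg_cong[OF *, of "Re R f"] \<rho> by simp
  qed (use \<rho> in simp)
qed

text \<open>Symmetry is an entailment over \<open>A \<times> A\<close> and transitivity one over \<open>(A \<times> A) \<times> A\<close>; a triple of elements
  of \<open>F A\<close> factors through \<open>F\<close> of the latter.\<close>

lemma rel_image_equivalence:
  assumes e: "equivalence_rel P A \<rho>" and A [simp]: "A \<in> Obj P"
  shows "equivalence_rel R (OMap F A) (rel_image F A \<rho>)"
proof (rule R.equivalence_relI)
  show "R.reflexive_on (OMap F A) (rel_image F A \<rho>)"
    by (rule rel_image_refl[OF P.equivalence_rel_reflexive_on[OF A e] A])
next
  have \<rho> [simp]: "\<rho> \<in> P.El (Prod P A A)" using e by (rule P.equivalence_rel_el)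
  fix z Z f g assume le: "z \<sqsubseteq>\<^bsub>Fib R Z\<^esub> Re R (tuple R f g) (rel_image F A \<rho>)" and [simp]: "z \<in> R.El Z"
    and a: "f \<in> Arr R" "g \<in> Arr R" "Dom R f = Z" "Dom R g = Z" "Cod R f = OMap F A" "Cod R g = OMap F A"
  obtain m where m [simp]: "m \<in> Arr R" "Dom R m = Z" "Cod R m = OMap F (Prod P A A)"
    and fg: "f = Comp R (AMap F (Pr1 P A A)) m" "g = Comp R (AMap F (Pr2 P A A)) m"
    by (rule pair_factor[OF a A A])
  have s: "\<rho> \<sqsubseteq>\<^bsub>Fib P (Prod P A A)\<^esub> Re P (tuple P (Pr2 P A A) (Pr1 P A A)) \<rho>"
    by (rule P.equivalence_rel_sym[OF e]) simp_all
  have "z \<sqsubseteq>\<^bsub>Fib R Z\<^esub> Re R m (FMap F (Prod P A A) \<rho>)"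
    using le fg by (simp add: Re_rel_image[symmetric])
  from FMap_le_apply[OF s this]
  show "z \<sqsubseteq>\<^bsub>Fib R Z\<^esub> Re R (tuple R g f) (rel_image F A \<rho>)"
    by (simp add: fg)
next
  have \<rho> [simp]: "\<rho> \<in> P.El (Prod P A A)" using e by (rule P.equivalence_rel_el)
  fix z Z f g h
  assume le: "z \<sqsubseteq>\<^bsub>Fib R Z\<^esub> Re R (tuple R f g) (rel_image F A \<rho>)"
    "z \<sqsubseteq>\<^bsub>Fib R Z\<^esub> Re R (tuple R g h) (rel_image F A \<rho>)" and [simp]: "z \<in> R.El Z"
    and a: "f \<in> Arr R" "g \<in> Arr R" "h \<in> Arr R" "Dom R f = Z" "Dom R g = Z" "Dom R h = Z"
      "Cod R f = OMap F A" "Cod R g = OMap F A" "Cod R h = OMap F A"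
  obtain m where m: "m \<in> Arr R" "Dom R m = Z" "Cod R m = OMap F (Prod P A A)"
    and fg: "f = Comp R (AMap F (Pr1 P A A)) m" "g = Comp R (AMap F (Pr2 P A A)) m"
    by (rule pair_factor[OF a(1,2,4,5,7,8) A A])
  let ?AA = "Prod P A A" and ?T = "Prod P (Prod P A A) A"
  let ?p = "Pr1 P ?AA A" and ?q = "Pr2 P ?AA A"
  obtain n where n [simp]: "n \<in> Arr R" "Dom R n = Z" "Cod R n = OMap F ?T"
    and mh: "m = Comp R (AMap F ?p) n" "h = Comp R (AMap F ?q) n"
    by (rule pair_factor[OF m(1) a(3) m(2) a(6) m(3) a(9)]) simp_all
  let ?f = "Comp P (Pr1 P A A) ?p" and ?g = "Comp P (Pr2 P A A) ?p"
  have s: "Re P (tuple P ?f ?g) \<rho> \<sqinter>\<^bsub>Fib P ?T\<^esub> Re P (tuple P ?g ?q) \<rho> \<sqsubseteq>\<^bsub>Fib P ?T\<^esub> Re P (tuple P ?f ?q) \<rho>"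
    by (rule P.leI, simp_all, rule P.equivalence_rel_trans[OF e, where g = ?g]) simp_all
  have "z \<sqsubseteq>\<^bsub>Fib R Z\<^esub> Re R n (FMap F ?T (Re P (tuple P ?f ?g) \<rho> \<sqinter>\<^bsub>Fib P ?T\<^esub> Re P (tuple P ?g ?q) \<rho>))"
    using le R.arr_simps(1)[of n] by (simp add: fg mh del: P.tuple_eta)
  from FMap_le_apply[OF s this]
  show "z \<sqsubseteq>\<^bsub>Fib R Z\<^esub> Re R (tuple R f h) (rel_image F A \<rho>)"
    by (simp add: fg mh del: P.tuple_eta)
qed simp

lemma FMap_Des:
  assumes d: "\<alpha> \<in> Des P A \<rho>" and [simp]: "A \<in> Obj P" "\<rho> \<in> P.El (Prod P A A)"
  shows "FMap F A \<alpha> \<in> Des R (OMap F A) (rel_image F A \<rho>)"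
proof (rule R.DesI)
  have [simp]: "\<alpha> \<in> P.El A" using d by (rule P.Des_el)
  show "FMap F A \<alpha> \<in> R.El (OMap F A)" by simp
  let ?B = "OMap F A"
  let ?BB = "Prod R ?B ?B"
  fix z assume [simp]: "z \<in> R.El ?BB" and z: "z \<sqsubseteq>\<^bsub>Fib R ?BB\<^esub> Re R (Pr1 R ?B ?B) (FMap F A \<alpha>)"
    "z \<sqsubseteq>\<^bsub>Fib R ?BB\<^esub> rel_image F A \<rho>"
  obtain m where m [simp]: "m \<in> Arr R" "Dom R m = ?BB" "Cod R m = OMap F (Prod P A A)"
    and pq: "Pr1 R ?B ?B = Comp R (AMap F (Pr1 P A A)) m" "Pr2 R ?B ?B = Comp R (AMap F (Pr2 P A A)) m"
    by (rule pair_factor[of "Pr1 R ?B ?B" "Pr2 R ?B ?B" ?BB A A]) simp_all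
  have s: "Re P (Pr1 P A A) \<alpha> \<sqinter>\<^bsub>Fib P (Prod P A A)\<^esub> \<rho> \<sqsubseteq>\<^bsub>Fib P (Prod P A A)\<^esub> Re P (Pr2 P A A) \<alpha>"
    using d by (simp add: Des_def)
  have "z \<sqsubseteq>\<^bsub>Fib R ?BB\<^esub> Re R (tuple R (Pr1 R ?B ?B) (Pr2 R ?B ?B)) (rel_image F A \<rho>)" using z by simp
  then have "z \<sqsubseteq>\<^bsub>Fib R ?BB\<^esub> Re R m (FMap F (Prod P A A) (Re P (Pr1 P A A) \<alpha> \<sqinter>\<^bsub>Fib P (Prod P A A)\<^esub> \<rho>))"
    using z by (simp add: pq Re_rel_image[symmetric] del: R.tuple_Pr)
  from FMap_le_apply[OF s this]
  show "z \<sqsubseteq>\<^bsub>Fib R ?BB\<^esub> Re R (Pr2 R ?B ?B) (FMap F A \<alpha>)" by (simp add: pq)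
qed simp_all

text \<open>Image relations are compatible with products; hence the completion of a 1-cell preserves
  products.\<close>

lemma rel_image_prod_q:
  assumes X [simp]: "X \<in> Obj (Tq0 P)" and Y [simp]: "Y \<in> Obj (Tq0 P)"
    and a [simp]: "h \<in> Arr R" "k \<in> Arr R" "Dom R h = Z" "Dom R k = Z"
      "Cod R h = OMap F (Prod P (under X) (under Y))" "Cod R k = OMap F (Prod P (under X) (under Y))"
  defines "p \<equiv> AMap F (Pr1 P (under X) (under Y))" and "q \<equiv> AMap F (Pr2 P (under X) (under Y))"
  shows "Re R (tuple R h k) (rel_image F (Prod P (under X) (under Y)) (elt (prod_q P X Y))) =
     Re R (tuple R (Comp R p h) (Comp R p k)) (rel_image F (under X) (elt X)) \<sqinter>\<^bsub>Fib R Z\<^esub>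
     Re R (tuple R (Comp R q h) (Comp R q k)) (rel_image F (under Y) (elt Y))"
proof -
  let ?A = "under X" and ?B = "under Y"
  let ?AB = "Prod P ?A ?B"
  let ?h = "Pr1 P ?AB ?AB" and ?k = "Pr2 P ?AB ?AB"
  obtain m where m [simp]: "m \<in> Arr R" "Dom R m = Z" "Cod R m = OMap F (Prod P ?AB ?AB)"
    and hk: "h = Comp R (AMap F ?h) m" "k = Comp R (AMap F ?k) m"
    by (rule pair_factor[of h k Z ?AB ?AB]) simp_all
  note [simp] = P.elt_prod_q_El
  have "Re R (tuple R h k) (rel_image F ?AB (elt (prod_q P X Y))) = Re R m (FMap F (Prod P ?AB ?AB) (Re P (tuple P ?h ?k) (elt (prod_q P X Y))))"
    by (simp add: hk Re_rel_image[symmetric] del: P.Re_elt_prod_q)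
  also have "\<dots> = Re R m (FMap F (Prod P ?AB ?AB) (
      Re P (tuple P (Comp P (Pr1 P ?A ?B) ?h) (Comp P (Pr1 P ?A ?B) ?k)) (elt X) \<sqinter>\<^bsub>Fib P (Prod P ?AB ?AB)\<^esub>
      Re P (tuple P (Comp P (Pr2 P ?A ?B) ?h) (Comp P (Pr2 P ?A ?B) ?k)) (elt Y)))"
    by (simp del: P.tuple_Pr)
  also have "\<dots> = Re R (tuple R (Comp R p h) (Comp R p k)) (rel_image F (under X) (elt X)) \<sqinter>\<^bsub>Fib R Z\<^esub>
     Re R (tuple R (Comp R q h) (Comp R q k)) (rel_image F (under Y) (elt Y))"
    by (simp add: hk p_def q_def)
  finally show ?thesis .
qed

lemma rel_image_strict:
  assumes [simp]: "A \<in> Obj P" "\<rho> \<in> P.El (Prod P A A)"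
    and s: "OMap F (Prod P A A) = Prod R (OMap F A) (OMap F A)"
      "AMap F (Pr1 P A A) = Pr1 R (OMap F A) (OMap F A)" "AMap F (Pr2 P A A) = Pr2 R (OMap F A) (OMap F A)"
  shows "rel_image F A \<rho> = FMap F (Prod P A A) \<rho>"
  by (rule rel_image_unique) (use s in simp_all)

end

section \<open>The completions on 1-cells\<close>

lemma ed_doctrineI: "elementary_doctrine P \<Longrightarrow> ed_doctrine P"
  by (simp add: ed_doctrine_def elementary_doctrineD)

lemma ed_cellI:
  assumes "cell1_in P R F"
  shows "ed_cell P R F"
  by (intro ed_cell.intro ed_cell_axioms.intro ed_doctrineI assms cell1_inD(1,2)[OF assms])

context ed_cell
begin

text \<open>The conditions for a 1-cell between lifted categories that involve only underlying arrows hold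
  because \<open>F\<close> is a 1-cell. This leaves, for each completion, the action on objects, the closure of
  arrows under the action and the behaviour on fibres.\<close>

lemma lifted_cell:
  assumes TP: "elementary_doctrine TP" "lifted_category P TP" and TR: "elementary_doctrine TR" "lifted_category R TR"
    and under: "\<And>X. under (ob X) = OMap F (under X)"
    and ob: "\<And>X. X \<in> Obj TP \<Longrightarrow> ob X \<in> Obj TR"
    and arr: "\<And>u. u \<in> Arr TP \<Longrightarrow> AExt (ob (asrc u)) (AMap F (aunder u)) (ob (atgt u)) \<in> Arr TR"
    and prod: "\<And>X Y Z h. \<lbrakk>X \<in> Obj TP; Y \<in> Obj TP;
      AExt Z (Comp R (AMap F (Pr1 P (under X) (under Y))) h) (ob X) \<in> Arr TR;
      AExt Z (Comp R (AMap F (Pr2 P (under X) (under Y))) h) (ob Y) \<in> Arr TR;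
      h \<in> Arr R; Dom R h = under Z; Cod R h = OMap F (Prod P (under X) (under Y))\<rbrakk>
      \<Longrightarrow> AExt Z h (ob (Prod TP X Y)) \<in> Arr TR"
    and hom: "\<And>X. X \<in> Obj TP \<Longrightarrow> infsl_hom (Fib TP X) (Fib TR (ob X)) (FMap F (under X))"
    and nat: "\<And>u \<gamma>. u \<in> Arr TP \<Longrightarrow> \<gamma> \<in> carrier (Fib TP (atgt u)) \<Longrightarrow> FMap F (under (asrc u)) (Re TP u \<gamma>)
      = Re TR (AExt (ob (asrc u)) (AMap F (aunder u)) (ob (atgt u))) (FMap F (under (atgt u)) \<gamma>)"
    and delta: "\<And>X. X \<in> Obj TP \<Longrightarrow> FMap F (Prod P (under X) (under X)) (delta TP X) =
      Re TR (AExt (ob (Prod TP X X)) (tuple R (AMap F (Pr1 P (under X) (under X))) (AMap F (Pr2 P (under X) (under X))))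
        (Prod TR (ob X) (ob X))) (delta TR (ob X))"
  shows "cell1_in TP TR (mk1 TP TR ob (\<lambda>u. AExt (ob (asrc u)) (AMap F (aunder u)) (ob (atgt u))) (\<lambda>X. FMap F (under X)))"
proof -
  interpret TP: lifted_category P TP by (rule TP(2))
  interpret TR: lifted_category R TR by (rule TR(2))
  let ?a = "\<lambda>u. AExt (ob (asrc u)) (AMap F (aunder u)) (ob (atgt u))"
  note TPs = TP.sel_D TP.under_Prod
  have U: "u \<in> Arr TP \<Longrightarrow> aunder u \<in> Arr P \<and> Dom P (aunder u) = under (asrc u) \<and> Cod P (aunder u) = under (atgt u)" for u
    by (erule TP.Arr_DE) simp
  have p: "AExt (ob (Prod TP X Y)) (AMap F (Pr1 P (under X) (under Y))) (ob X) \<in> Arr TR"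
    "AExt (ob (Prod TP X Y)) (AMap F (Pr2 P (under X) (under Y))) (ob Y) \<in> Arr TR"
    if "X \<in> Obj TP" "Y \<in> Obj TP" for X Y
    using arr[OF TP.Pr_D(1)[OF that]] arr[OF TP.Pr_D(2)[OF that]] by (simp_all add: TPs)
  show ?thesis
  proof (rule cell1_mk1I[OF TP(1) TR(1)])
    show "is_functor TP TR ob ?a"
      by (rule TR.is_functorI[where U = "\<lambda>u. AMap F (aunder u)", OF TP.prod_category_D])
        (simp_all add: ob arr TPs TP.Obj_under under U)
    show "preserves_products TP TR ob ?a"
      unfolding preserves_products_def
    proof (intro ballI)
      fix X Y assume XY: "X \<in> Obj TP" "Y \<in> Obj TP"
      have "is_product TR (ob X) (ob Y) (ob (Prod TP X Y))
        (AExt (ob (Prod TP X Y)) (AMap F (Pr1 P (under X) (under Y))) (ob X))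
        (AExt (ob (Prod TP X Y)) (AMap F (Pr2 P (under X) (under Y))) (ob Y))"
        by (rule TR.is_product_D) (use XY p prod[OF XY] in \<open>simp_all add: ob under TPs TP.Prod_D image_product TP.Obj_under\<close>)
      then show "is_product TR (ob X) (ob Y) (ob (Prod TP X Y)) (?a (Pr1 TP X Y)) (?a (Pr2 TP X Y))"
        by (simp add: TPs)
    qed
  next
    fix X assume X: "X \<in> Obj TP"
    show "FMap F (under (Prod TP X X)) (delta TP X) = Re TR (tuple TR (?a (Pr1 TP X X)) (?a (Pr2 TP X X))) (delta TR (ob X))"
      using delta[OF X] TR.tuple_D(1)[OF p(1)[OF X X] p(2)[OF X X]] by (simp add: TPs)
  qed (simp_all add: hom nat TPs)
qed

end

lemma Tc0_ArrD [simp]: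
  assumes "u \<in> Arr (Tc0 P)"
  shows "asrc u \<in> Obj (Tc0 P)" "atgt u \<in> Obj (Tc0 P)" "aunder u \<in> Arr P"
    "Dom P (aunder u) = under (asrc u)" "Cod P (aunder u) = under (atgt u)"
    "AExt (asrc u) (aunder u) (atgt u) \<in> Arr (Tc0 P)"
  using Tc0_Arr_AExt[OF assms] assms by (auto simp: Tc0_Arr)

lemma Tc0_Arr_le: "u \<in> Arr (Tc0 P) \<Longrightarrow>
    elt (asrc u) \<sqsubseteq>\<^bsub>Fib P (under (asrc u))\<^esub> Re P (aunder u) (elt (atgt u))"
  using Tc0_Arr_AExt[of u P] by (auto simp: Tc0_Arr)

lemma Tq0_ArrD [simp]:
  assumes "u \<in> Arr (Tq0 P)"
  shows "asrc u \<in> Obj (Tq0 P)" "atgt u \<in> Obj (Tq0 P)" "aunder u \<in> Arr P"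
    "Dom P (aunder u) = under (asrc u)" "Cod P (aunder u) = under (atgt u)"
    "AExt (asrc u) (aunder u) (atgt u) \<in> Arr (Tq0 P)"
  using Tq0_Arr_AExt[OF assms] assms by (auto simp: Tq0_Arr)

lemma AExt_aunder: "u \<in> Arr (Tc0 P) \<or> u \<in> Arr (Tq0 P) \<Longrightarrow> AExt (asrc u) (aunder u) (atgt u) = u"
  using Tc0_Arr_AExt[of u P] Tq0_Arr_AExt[of u P] by auto

lemma Re_Tc0: "Re (Tc0 P) u \<gamma> = Re P (aunder u) \<gamma> \<sqinter>\<^bsub>Fib P (under (asrc u))\<^esub> elt (asrc u)"
  by (simp add: Tc0_def)

lemma Re_Tq0: "Re (Tq0 P) u = Re P (aunder u)"
  by (simp add: Tq0_def)

lemma Tc1_sel [simp]: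
  "Src1 F = P \<Longrightarrow> X \<in> Obj (Tc0 P) \<Longrightarrow> OMap (Tc1 F) X = obj_c F X"
  "Src1 F = P \<Longrightarrow> u \<in> Arr (Tc0 P) \<Longrightarrow>
    AMap (Tc1 F) u = AExt (obj_c F (asrc u)) (AMap F (aunder u)) (obj_c F (atgt u))"
  "Src1 F = P \<Longrightarrow> X \<in> Obj (Tc0 P) \<Longrightarrow> \<gamma> \<in> carrier (Fib P (under X)) \<Longrightarrow>
    \<gamma> \<sqsubseteq>\<^bsub>Fib P (under X)\<^esub> elt X \<Longrightarrow> FMap (Tc1 F) X \<gamma> = FMap F (under X) \<gamma>"
  "Src1 (Tc1 F) = Tc0 (Src1 F)" "Tgt1 (Tc1 F) = Tc0 (Tgt1 F)"
  by (simp_all add: Tc1_def)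

lemma Tq1_sel [simp]:
  "Src1 F = P \<Longrightarrow> X \<in> Obj (Tq0 P) \<Longrightarrow> OMap (Tq1 F) X = obj_q F X"
  "Src1 F = P \<Longrightarrow> u \<in> Arr (Tq0 P) \<Longrightarrow>
    AMap (Tq1 F) u = AExt (obj_q F (asrc u)) (AMap F (aunder u)) (obj_q F (atgt u))"
  "Src1 F = P \<Longrightarrow> X \<in> Obj (Tq0 P) \<Longrightarrow> \<gamma> \<in> Des P (under X) (elt X) \<Longrightarrow>
    FMap (Tq1 F) X \<gamma> = FMap F (under X) \<gamma>"
  "Src1 (Tq1 F) = Tq0 (Src1 F)" "Tgt1 (Tq1 F) = Tq0 (Tgt1 F)"
  by (simp_all add: Tq1_def)

lemma obj_c_Ext: "obj_c F X = Ext (OMap F (under X)) (FMap F (under X) (elt X))"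
  by (simp add: obj_c_def)

lemma obj_q_Ext: "obj_q F X = Ext (OMap F (under X)) (rel_image F (under X) (elt X))"
  by (simp add: obj_q_def rel_image_def Let_def)

context ed_cell
begin

lemma obj_c_Obj [simp]: "X \<in> Obj (Tc0 P) \<Longrightarrow> obj_c F X \<in> Obj (Tc0 R)"
  by (simp add: obj_c_Ext)

lemma obj_q_Obj [simp]: "X \<in> Obj (Tq0 P) \<Longrightarrow> obj_q F X \<in> Obj (Tq0 R)"
  by (simp add: obj_q_Ext rel_image_equivalence)

lemma Tc1_arr:
  assumes u: "u \<in> Arr (Tc0 P)"
  shows "AExt (obj_c F (asrc u)) (AMap F (aunder u)) (obj_c F (atgt u)) \<in> Arr (Tc0 R)"
  using FMap_mono[OF Tc0_Arr_le[OF u]] u by (simp add: Tc0_Arr FMap_Re)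

lemma Tq1_arr:
  assumes u: "u \<in> Arr (Tq0 P)"
  shows "AExt (obj_q F (asrc u)) (AMap F (aunder u)) (obj_q F (atgt u)) \<in> Arr (Tq0 R)"
proof (rule R.Tq0_ArrI)
  let ?X = "asrc u" and ?Y = "atgt u" and ?f = "aunder u"
  let ?A = "under ?X"
  note [simp] = u
  fix z Z h k assume le: "z \<sqsubseteq>\<^bsub>Fib R Z\<^esub> Re R (tuple R h k) (elt (obj_q F ?X))" and Z [simp]: "Z \<in> Obj R" "z \<in> R.El Z"
    and a: "h \<in> Arr R" "k \<in> Arr R" "Dom R h = Z" "Dom R k = Z" "Cod R h = under (obj_q F ?X)" "Cod R k = under (obj_q F ?X)"
  obtain m where m [simp]: "m \<in> Arr R" "Dom R m = Z" "Cod R m = OMap F (Prod P ?A ?A)"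
    and hk: "h = Comp R (AMap F (Pr1 P ?A ?A)) m" "k = Comp R (AMap F (Pr2 P ?A ?A)) m"
    by (rule pair_factor[OF a(1-4), of ?A ?A]) (use a in simp_all)
  have uu: "AExt ?X ?f ?Y \<in> Arr (Tq0 P)" by simp
  have s: "elt ?X \<sqsubseteq>\<^bsub>Fib P (Prod P ?A ?A)\<^esub> Re P (tuple P (Comp P ?f (Pr1 P ?A ?A)) (Comp P ?f (Pr2 P ?A ?A))) (elt ?Y)"
    by (rule P.Tq0_Arr_apply[OF uu]) simp_all
  have "z \<sqsubseteq>\<^bsub>Fib R Z\<^esub> Re R m (FMap F (Prod P ?A ?A) (elt ?X))"
    using le by (simp add: hk Re_rel_image[symmetric])
  from FMap_le_apply[OF s this]
  show "z \<sqsubseteq>\<^bsub>Fib R Z\<^esub> Re R (tuple R (Comp R (AMap F ?f) h) (Comp R (AMap F ?f) k)) (elt (obj_q F ?Y))"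
    by (simp add: hk)
qed (use u in simp_all)

lemma Tc1_cell: "cell1_in (Tc0 P) (Tc0 R) (Tc1 F)"
  unfolding Tc1_def Src_Tgt
proof (rule lifted_cell[OF P.Tc0_elementary P.Tc0_lifted R.Tc0_elementary R.Tc0_lifted])
  fix X assume X [simp]: "X \<in> Obj (Tc0 P)"
  let ?A = "under X"
  show "infsl_hom (Fib (Tc0 P) X) (Fib (Tc0 R) (obj_c F X)) (FMap F (under X))"
    by (auto simp: infsl_hom_def FMap_mono)
  show "FMap F (Prod P ?A ?A) (delta (Tc0 P) X) = Re (Tc0 R) (AExt (obj_c F (Prod (Tc0 P) X X))
      (tuple R (AMap F (Pr1 P ?A ?A)) (AMap F (Pr2 P ?A ?A))) (Prod (Tc0 R) (obj_c F X) (obj_c F X))) (delta (Tc0 R) (obj_c F X))"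
    unfolding P.Tc0_delta[OF X] R.Tc0_delta[OF obj_c_Obj[OF X]] Tc0_sel
    by (rule R.eqI[of "OMap F (Prod P ?A ?A)"]) (auto simp: FMap_delta)
next
  fix u \<gamma> assume "u \<in> Arr (Tc0 P)" "\<gamma> \<in> carrier (Fib (Tc0 P) (atgt u))"
  then show "FMap F (under (asrc u)) (Re (Tc0 P) u \<gamma>) =
    Re (Tc0 R) (AExt (obj_c F (asrc u)) (AMap F (aunder u)) (obj_c F (atgt u))) (FMap F (under (atgt u)) \<gamma>)"
    by (simp add: Re_Tc0 FMap_Re)
qed (use Tc1_arr in \<open>auto simp: Tc0_Arr\<close>)

lemma Tq1_cell: "cell1_in (Tq0 P) (Tq0 R) (Tq1 F)"
  unfolding Tq1_def Src_Tgt
proof (rule lifted_cell[OF P.Tq0_elementary P.Tq0_lifted R.Tq0_elementary R.Tq0_lifted])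
  fix X Y Z h assume X [simp]: "X \<in> Obj (Tq0 P)" and Y [simp]: "Y \<in> Obj (Tq0 P)"
    and u: "AExt Z (Comp R (AMap F (Pr1 P (under X) (under Y))) h) (obj_q F X) \<in> Arr (Tq0 R)"
      "AExt Z (Comp R (AMap F (Pr2 P (under X) (under Y))) h) (obj_q F Y) \<in> Arr (Tq0 R)"
    and h [simp]: "h \<in> Arr R" "Dom R h = under Z" "Cod R h = OMap F (Prod P (under X) (under Y))"
  from u(1) have [simp]: "Z \<in> Obj (Tq0 R)" by (simp add: Tq0_Arr)
  show "AExt Z h (obj_q F (Prod (Tq0 P) X Y)) \<in> Arr (Tq0 R)"
  proof (rule R.Tq0_ArrI)
    fix z V i j assume le: "z \<sqsubseteq>\<^bsub>Fib R V\<^esub> Re R (tuple R i j) (elt Z)"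
      and [simp]: "V \<in> Obj R" "z \<in> R.El V" "i \<in> Arr R" "j \<in> Arr R" "Dom R i = V" "Dom R j = V"
      "Cod R i = under Z" "Cod R j = under Z"
    show "z \<sqsubseteq>\<^bsub>Fib R V\<^esub> Re R (tuple R (Comp R h i) (Comp R h j)) (elt (obj_q F (Prod (Tq0 P) X Y)))"
      using R.Tq0_Arr_apply[OF u(1) le] R.Tq0_Arr_apply[OF u(2) le]
      by (simp add: rel_image_prod_q[of X Y "Comp R h i" "Comp R h j" V])
  qed simp_all
next
  fix X assume X [simp]: "X \<in> Obj (Tq0 P)"
  show "infsl_hom (Fib (Tq0 P) X) (Fib (Tq0 R) (obj_q F X)) (FMap F (under X))"
    by (auto simp: infsl_hom_def FMap_Des P.Des_el)
  show "FMap F (Prod P (under X) (under X)) (delta (Tq0 P) X) = Re (Tq0 R) (AExt (obj_q F (Prod (Tq0 P) X X))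
      (tuple R (AMap F (Pr1 P (under X) (under X))) (AMap F (Pr2 P (under X) (under X))))
      (Prod (Tq0 R) (obj_q F X) (obj_q F X))) (delta (Tq0 R) (obj_q F X))"
    unfolding P.Tq0_delta[OF X] R.Tq0_delta[OF obj_q_Obj[OF X]] by (simp add: Re_rel_image)
next
  fix u \<gamma> assume "u \<in> Arr (Tq0 P)" "\<gamma> \<in> carrier (Fib (Tq0 P) (atgt u))"
  then show "FMap F (under (asrc u)) (Re (Tq0 P) u \<gamma>) =
    Re (Tq0 R) (AExt (obj_q F (asrc u)) (AMap F (aunder u)) (obj_q F (atgt u))) (FMap F (under (atgt u)) \<gamma>)"
    by (simp add: Re_Tq0 FMap_Re P.Des_el)
qed (use Tq1_arr in auto)

end

section \<open>2-cells and 2-functoriality\<close>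

lemma comp1_sel [simp]:
  "Src1 (G \<odot> F) = Src1 F" "Tgt1 (G \<odot> F) = Tgt1 G"
  "A \<in> Obj (Src1 F) \<Longrightarrow> OMap (G \<odot> F) A = OMap G (OMap F A)"
  "f \<in> Arr (Src1 F) \<Longrightarrow> AMap (G \<odot> F) f = AMap G (AMap F f)"
  "A \<in> Obj (Src1 F) \<Longrightarrow> \<alpha> \<in> carrier (Fib (Src1 F) A) \<Longrightarrow> FMap (G \<odot> F) A \<alpha> = FMap G (OMap F A) (FMap F A \<alpha>)"
  by (simp_all add: comp1_def)

lemma id1_sel [simp]:
  "Src1 (id1 P) = P" "Tgt1 (id1 P) = P"
  "A \<in> Obj P \<Longrightarrow> OMap (id1 P) A = A" "f \<in> Arr P \<Longrightarrow> AMap (id1 P) f = f"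
  "A \<in> Obj P \<Longrightarrow> \<alpha> \<in> carrier (Fib P A) \<Longrightarrow> FMap (id1 P) A \<alpha> = \<alpha>"
  by (simp_all add: id1_def)

lemma mk2_sel [simp]:
  "Src2 (mk2 F G t) = F" "Tgt2 (mk2 F G t) = G"
  "A \<in> Obj (Src1 F) \<Longrightarrow> Cmp (mk2 F G t) A = t A"
  by (simp_all add: mk2_def)

lemma mk2_eqI:
  "F = F' \<Longrightarrow> G = G' \<Longrightarrow> (\<And>A. A \<in> Obj (Src1 F) \<Longrightarrow> t A = t' A) \<Longrightarrow> mk2 F G t = mk2 F' G' t'"
  by (auto simp: mk2_def restrict_def)

lemma cell2_mk2I:
  assumes F: "cell1_in P R F" and G: "cell1_in P R G"
    and "\<And>A. A \<in> Obj P \<Longrightarrow> t A \<in> hom R (OMap F A) (OMap G A)"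
    and "\<And>f. f \<in> Arr P \<Longrightarrow> Comp R (t (Cod P f)) (AMap F f) = Comp R (AMap G f) (t (Dom P f))"
    and "\<And>A \<alpha>. A \<in> Obj P \<Longrightarrow> \<alpha> \<in> carrier (Fib P A) \<Longrightarrow>
        FMap F A \<alpha> \<sqsubseteq>\<^bsub>Fib R (OMap F A)\<^esub> Re R (t A) (FMap G A \<alpha>)"
  shows "cell2_in P R F G (mk2 F G t)"
proof -
  interpret P: elem_doctrine P by (rule elementary_doctrineD[OF cell1_inD(1)[OF F]])
  have S: "Src1 F = P" by (rule cell1_inD(3)[OF F])
  have "mk2 F G t = mk2 F G (Cmp (mk2 F G t))" by (rule mk2_eqI) simp_all
  then show ?thesis unfolding cell2_in_def using assms by (simp add: S)
qed

lemma cell2_inD: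
  assumes "cell2_in P R F G \<theta>"
  shows "cell1_in P R F" "cell1_in P R G" "Src2 \<theta> = F" "Tgt2 \<theta> = G"
proof -
  have eq: "\<theta> = mk2 F G (Cmp \<theta>)" and "cell1_in P R F" "cell1_in P R G" using assms by (simp_all add: cell2_in_def)
  then show "cell1_in P R F" "cell1_in P R G" by simp_all
  show "Src2 \<theta> = F" "Tgt2 \<theta> = G" by (subst eq, simp)+
qed

locale ed_cell2 = F: ed_cell P R F + G: ed_cell P R G
  for P R :: "('o, 'a, 'p) ed" and F G +
  fixes \<theta> :: "('o, 'a, 'p) ed2"
  assumes cell2: "cell2_in P R F G \<theta>"
begin

lemma Src2_Tgt2 [simp]: "Src2 \<theta> = F" "Tgt2 \<theta> = G"
  using cell2_inD[OF cell2] by simp_all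

lemma Cmp_simps [simp]:
  "A \<in> Obj P \<Longrightarrow> Cmp \<theta> A \<in> Arr R" "A \<in> Obj P \<Longrightarrow> Dom R (Cmp \<theta> A) = OMap F A"
  "A \<in> Obj P \<Longrightarrow> Cod R (Cmp \<theta> A) = OMap G A"
  using cell2 by (simp_all add: cell2_in_def hom_def)

lemma Cmp_natural:
  "f \<in> Arr P \<Longrightarrow> Comp R (Cmp \<theta> (Cod P f)) (AMap F f) = Comp R (AMap G f) (Cmp \<theta> (Dom P f))"
  using cell2 by (simp add: cell2_in_def)

lemma Cmp_le:
  "A \<in> Obj P \<Longrightarrow> \<alpha> \<in> F.P.El A \<Longrightarrow> FMap F A \<alpha> \<sqsubseteq>\<^bsub>Fib R (OMap F A)\<^esub> Re R (Cmp \<theta> A) (FMap G A \<alpha>)"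
  using cell2 by (simp add: cell2_in_def)

lemma Tc2_arr:
  assumes X [simp]: "X \<in> Obj (Tc0 P)"
  shows "AExt (obj_c F X) (Cmp \<theta> (under X)) (obj_c G X) \<in> Arr (Tc0 R)"
  by (simp add: Tc0_Arr Cmp_le)

text \<open>A pair of elements of \<open>F A\<close> comes from one element \<open>m\<close> of \<open>F (A \<times> A)\<close>, at which \<open>F \<rho>\<close> entails
  \<open>G \<rho>\<close> along the component of \<open>\<theta>\<close> at \<open>A \<times> A\<close>. By naturality at the two projections that component
  acts on the pair as the component at \<open>A\<close> does on each entry.\<close>

lemma Tq2_arr:
  assumes X [simp]: "X \<in> Obj (Tq0 P)"
  shows "AExt (obj_q F X) (Cmp \<theta> (under X)) (obj_q G X) \<in> Arr (Tq0 R)"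
proof (rule F.R.Tq0_ArrI)
  let ?A = "under X"
  let ?AA = "Prod P ?A ?A"
  fix z Z h k assume le: "z \<sqsubseteq>\<^bsub>Fib R Z\<^esub> Re R (tuple R h k) (elt (obj_q F X))" and Z [simp]: "Z \<in> Obj R" "z \<in> F.R.El Z"
    and a: "h \<in> Arr R" "k \<in> Arr R" "Dom R h = Z" "Dom R k = Z" "Cod R h = under (obj_q F X)" "Cod R k = under (obj_q F X)"
  obtain m where m [simp]: "m \<in> Arr R" "Dom R m = Z" "Cod R m = OMap F ?AA"
    and hk: "h = Comp R (AMap F (Pr1 P ?A ?A)) m" "k = Comp R (AMap F (Pr2 P ?A ?A)) m"
    by (rule F.pair_factor[OF a(1-4), of ?A ?A]) (use a in simp_all)
  have "z \<sqsubseteq>\<^bsub>Fib R Z\<^esub> Re R m (FMap F ?AA (elt X))"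
    using le by (simp add: hk F.Re_rel_image[symmetric])
  from F.R.Re_le_apply[OF Cmp_le this]
  have 1: "z \<sqsubseteq>\<^bsub>Fib R Z\<^esub> Re R m (Re R (Cmp \<theta> ?AA) (FMap G ?AA (elt X)))" by simp
  have "Comp R (Comp R (AMap G (Pr1 P ?A ?A)) (Cmp \<theta> ?AA)) m = Comp R (Cmp \<theta> ?A) h"
    "Comp R (Comp R (AMap G (Pr2 P ?A ?A)) (Cmp \<theta> ?AA)) m = Comp R (Cmp \<theta> ?A) k"
    using Cmp_natural[of "Pr1 P ?A ?A"] Cmp_natural[of "Pr2 P ?A ?A"]
    by (simp_all add: hk flip: F.R.arr_simps(11))
  with 1 show "z \<sqsubseteq>\<^bsub>Fib R Z\<^esub> Re R (tuple R (Comp R (Cmp \<theta> ?A) h) (Comp R (Cmp \<theta> ?A) k)) (elt (obj_q G X))"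
    by (simp add: G.Re_rel_image[symmetric])
qed simp_all

lemma Tc2_le:
  assumes X: "X \<in> Obj (Tc0 P)" and \<gamma>: "\<gamma> \<in> carrier (Fib (Tc0 P) X)"
  shows "FMap F (under X) \<gamma> \<sqsubseteq>\<^bsub>Fib (Tc0 R) (obj_c F X)\<^esub>
     Re (Tc0 R) (AExt (obj_c F X) (Cmp \<theta> (under X)) (obj_c G X)) (FMap G (under X) \<gamma>)"
  using assms by (simp add: Cmp_le F.FMap_mono)

lemma Tq2_le:
  assumes X: "X \<in> Obj (Tq0 P)" and \<gamma>: "\<gamma> \<in> carrier (Fib (Tq0 P) X)"
  shows "FMap F (under X) \<gamma> \<sqsubseteq>\<^bsub>Fib (Tq0 R) (obj_q F X)\<^esub>
     Re (Tq0 R) (AExt (obj_q F X) (Cmp \<theta> (under X)) (obj_q G X)) (FMap G (under X) \<gamma>)"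
  using assms by (simp add: Cmp_le F.P.Des_el)

end

lemma ed_cell2I: "cell2_in P R F G \<theta> \<Longrightarrow> ed_cell2 P R F G \<theta>"
  by (intro ed_cell2.intro ed_cell2_axioms.intro ed_cellI) (auto dest: cell2_inD)

text \<open>If \<open>i\<close> and \<open>j\<close> invert the comparisons of \<open>F\<close> and \<open>G\<close>, then \<open>G(i) \<circ> j\<close> inverts that of the
  composite.\<close>

lemma rel_image_comp:
  assumes F: "cell1_in P R F" and G: "cell1_in R S G" and A [simp]: "A \<in> Obj P"
    and \<rho> [simp]: "\<rho> \<in> carrier (Fib P (Prod P A A))"
  shows "rel_image (G \<odot> F) A \<rho> = rel_image G (OMap F A) (rel_image F A \<rho>)"
proof -
  interpret F: ed_cell P R F by (rule ed_cellI[OF F])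
  interpret G: ed_cell R S G by (rule ed_cellI[OF G])
  let ?B = "OMap F A"
  let ?f = "tuple R (AMap F (Pr1 P A A)) (AMap F (Pr2 P A A))"
  let ?g = "tuple S (AMap G (Pr1 R ?B ?B)) (AMap G (Pr2 R ?B ?B))"
  let ?gf = "tuple S (AMap G (AMap F (Pr1 P A A))) (AMap G (AMap F (Pr2 P A A)))"
  obtain i where i [simp]: "i \<in> Arr R" "Dom R i = Prod R ?B ?B" "Cod R i = OMap F (Prod P A A)"
    "Comp R (AMap F (Pr1 P A A)) i = Pr1 R ?B ?B" "Comp R (AMap F (Pr2 P A A)) i = Pr2 R ?B ?B"
    and i': "Comp R i ?f = Ide R (OMap F (Prod P A A))" "inv_arr R ?f = i"
    using F.R.is_product_iso[OF F.image_product[OF A A]] by metis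
  obtain j where j [simp]: "j \<in> Arr S" "Dom S j = Prod S (OMap G ?B) (OMap G ?B)" "Cod S j = OMap G (Prod R ?B ?B)"
    "Comp S (AMap G (Pr1 R ?B ?B)) j = Pr1 S (OMap G ?B) (OMap G ?B)" "Comp S (AMap G (Pr2 R ?B ?B)) j = Pr2 S (OMap G ?B) (OMap G ?B)"
    and j': "Comp S j ?g = Ide S (OMap G (Prod R ?B ?B))" "inv_arr S ?g = j"
    using G.R.is_product_iso[OF G.image_product[of ?B ?B]] by (metis A F.functor_simps(1))
  have [simp]: "Comp S (AMap G (AMap F (Pr1 P A A))) (AMap G i) = AMap G (Pr1 R ?B ?B)"
    "Comp S (AMap G (AMap F (Pr2 P A A))) (AMap G i) = AMap G (Pr2 R ?B ?B)"
    by (simp_all flip: G.functor_simps(6))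
  have c [simp]: "Comp S (AMap G (AMap F (Pr1 P A A))) (Comp S (AMap G i) j) = Pr1 S (OMap G ?B) (OMap G ?B)"
    "Comp S (AMap G (AMap F (Pr2 P A A))) (Comp S (AMap G i) j) = Pr2 S (OMap G ?B) (OMap G ?B)"
    by (subst G.R.arr_simps(11)[symmetric]; simp)+
  have gf: "Comp S ?g (AMap G ?f) = ?gf"
  proof -
    have "Comp S (AMap G (Pr1 R ?B ?B)) (AMap G ?f) = AMap G (AMap F (Pr1 P A A))"
      "Comp S (AMap G (Pr2 R ?B ?B)) (AMap G ?f) = AMap G (AMap F (Pr2 P A A))"
      by (simp_all flip: G.functor_simps(6))
    then show ?thesis by simp
  qed
  have "Comp S (Comp S (AMap G i) j) ?gf = Comp S (AMap G i) (Comp S (Comp S j ?g) (AMap G ?f))"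
    unfolding gf[symmetric] by (simp del: G.R.tuple_comp)
  also have "\<dots> = AMap G (Comp R i ?f)" unfolding j' by simp
  also have "\<dots> = Ide S (OMap G (OMap F (Prod P A A)))" unfolding i' by simp
  finally have "inv_arr S ?gf = Comp S (AMap G i) j"
    by (intro G.R.inv_arr_eq) simp_all
  then show ?thesis
    by (simp add: rel_image_def i' j' G.FMap_Re)
qed

text \<open>What the two completions have in common: arrows, elements and components of 2-cells of the
  completed data are those of the original data, and only the objects carry something new. The
  action \<open>ob\<close> on objects is thus the only thing for which functoriality has to be assumed.\<close>

locale lifting_two_functor =
  fixes T :: "('o, 'a, 'p) ed_monad" and ob :: "('o, 'a, 'p) ed1 \<Rightarrow> ('o, 'p) obj \<Rightarrow> ('o, 'p) obj"
  assumes on1_eq: "on1 T F = mk1 (on0 T (Src1 F)) (on0 T (Tgt1 F)) (ob F)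
      (\<lambda>u. AExt (ob F (asrc u)) (AMap F (aunder u)) (ob F (atgt u))) (\<lambda>X. FMap F (under X))"
    and on2_eq: "on2 T \<theta> = mk2 (on1 T (Src2 \<theta>)) (on1 T (Tgt2 \<theta>))
      (\<lambda>X. AExt (ob (Src2 \<theta>) X) (Cmp \<theta> (under X)) (ob (Tgt2 \<theta>) X))"
    and elementary: "elementary_doctrine P \<Longrightarrow> elementary_doctrine (on0 T P)"
    and lifted: "elementary_doctrine P \<Longrightarrow> lifted_category P (on0 T P)"
    and fibre: "elementary_doctrine P \<Longrightarrow> X \<in> Obj (on0 T P) \<Longrightarrow> \<gamma> \<in> carrier (Fib (on0 T P) X) \<Longrightarrow>
      \<gamma> \<in> carrier (Fib P (under X))"
    and on1_cell: "cell1_in P R F \<Longrightarrow> cell1_in (on0 T P) (on0 T R) (on1 T F)"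
    and on2_arr: "cell2_in P R F G \<theta> \<Longrightarrow> X \<in> Obj (on0 T P) \<Longrightarrow>
      AExt (ob F X) (Cmp \<theta> (under X)) (ob G X) \<in> Arr (on0 T R)"
    and on2_le: "cell2_in P R F G \<theta> \<Longrightarrow> X \<in> Obj (on0 T P) \<Longrightarrow> \<gamma> \<in> carrier (Fib (on0 T P) X) \<Longrightarrow>
      FMap F (under X) \<gamma> \<sqsubseteq>\<^bsub>Fib (on0 T R) (ob F X)\<^esub>
        Re (on0 T R) (AExt (ob F X) (Cmp \<theta> (under X)) (ob G X)) (FMap G (under X) \<gamma>)"
    and under_ob: "under (ob F X) = OMap F (under X)"
    and ob_id: "elementary_doctrine P \<Longrightarrow> X \<in> Obj (on0 T P) \<Longrightarrow> ob (id1 P) X = X"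
    and ob_comp: "cell1_in P R F \<Longrightarrow> cell1_in R S G \<Longrightarrow> X \<in> Obj (on0 T P) \<Longrightarrow>
      ob (G \<odot> F) X = ob G (ob F X)"
begin

lemma on1_sel [simp]:
  "Src1 (on1 T F) = on0 T (Src1 F)" "Tgt1 (on1 T F) = on0 T (Tgt1 F)"
  "X \<in> Obj (on0 T (Src1 F)) \<Longrightarrow> OMap (on1 T F) X = ob F X"
  "u \<in> Arr (on0 T (Src1 F)) \<Longrightarrow>
    AMap (on1 T F) u = AExt (ob F (asrc u)) (AMap F (aunder u)) (ob F (atgt u))"
  "X \<in> Obj (on0 T (Src1 F)) \<Longrightarrow> \<gamma> \<in> carrier (Fib (on0 T (Src1 F)) X) \<Longrightarrow>
    FMap (on1 T F) X \<gamma> = FMap F (under X) \<gamma>"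
  by (simp_all add: on1_eq)

lemma on2_sel [simp]:
  "Src2 (on2 T \<theta>) = on1 T (Src2 \<theta>)" "Tgt2 (on2 T \<theta>) = on1 T (Tgt2 \<theta>)"
  "X \<in> Obj (on0 T (Src1 (Src2 \<theta>))) \<Longrightarrow>
    Cmp (on2 T \<theta>) X = AExt (ob (Src2 \<theta>) X) (Cmp \<theta> (under X)) (ob (Tgt2 \<theta>) X)"
  by (simp_all add: on2_eq)

lemma on0_ArrE:
  assumes "elementary_doctrine P" "u \<in> Arr (on0 T P)"
  obtains X f Y where "u = AExt X f Y" "X \<in> Obj (on0 T P)" "Y \<in> Obj (on0 T P)" "f \<in> Arr P"
    "Dom P f = under X" "Cod P f = under Y"
  using lifted_category.Arr_DE[OF lifted[OF assms(1)] assms(2)] by metis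

lemma on0_sel:
  assumes "elementary_doctrine P"
  shows "Dom (on0 T P) = asrc" "Cod (on0 T P) = atgt" "Ide (on0 T P) = (\<lambda>X. AExt X (Ide P (under X)) X)"
    "Comp (on0 T P) = (\<lambda>v u. AExt (asrc u) (Comp P (aunder v) (aunder u)) (atgt v))"
  using lifted_category.sel_D[OF lifted[OF assms]] by simp_all

lemma under_Obj: "elementary_doctrine P \<Longrightarrow> X \<in> Obj (on0 T P) \<Longrightarrow> under X \<in> Obj P"
  using lifted_category.Obj_under[OF lifted] by blast

lemma ob_Obj: "cell1_in P R F \<Longrightarrow> X \<in> Obj (on0 T P) \<Longrightarrow> ob F X \<in> Obj (on0 T R)"
  using ed_cell.functor_simps(1)[OF ed_cellI[OF on1_cell], of P R F X] cell1_inD(3)[of P R F] by simp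

lemma on1_comp:
  assumes F: "cell1_in P R F" and G: "cell1_in R S G"
  shows "on1 T (G \<odot> F) = on1 T G \<odot> on1 T F"
proof -
  note e = cell1_inD[OF F] cell1_inD[OF G]
  interpret TF: ed_cell "on0 T P" "on0 T R" "on1 T F" by (rule ed_cellI[OF on1_cell[OF F]])
  note [simp] = e(3,4,8,9) under_Obj[OF e(1)] fibre[OF e(1)] ob_comp[OF F G] ob_Obj[OF F]
  have a: "AExt (ob F X) (AMap F f) (ob F Y) \<in> Arr (on0 T R)" if "AExt X f Y \<in> Arr (on0 T P)" for X f Y
    using TF.functor_simps(2)[OF that] that by simp
  have c: "FMap F (under X) \<gamma> \<in> carrier (Fib (on0 T R) (ob F X))" 
    if "X \<in> Obj (on0 T P)" "\<gamma> \<in> carrier (Fib (on0 T P) X)" for X \<gamma>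
    using TF.FMap_simps(1)[OF that] that by simp
  show ?thesis
    unfolding on1_eq[of "G \<odot> F"] comp1_def[of "on1 T G"] comp1_sel(1,2) on1_sel(1,2) e(3,4,8,9)
  proof (rule mk1_eqI)
    fix u assume u: "u \<in> Arr (on0 T P)"
    then show "AExt (ob (G \<odot> F) (asrc u)) (AMap (G \<odot> F) (aunder u)) (ob (G \<odot> F) (atgt u)) = AMap (on1 T G) (AMap (on1 T F) u)"
      by (rule on0_ArrE[OF e(1)]) (use u in \<open>auto simp: a\<close>)
  next
    fix X assume "X \<in> Obj (on0 T P)"
    then show "ob (G \<odot> F) X = OMap (on1 T G) (OMap (on1 T F) X)" by simp
  next
    fix X \<gamma> assume "X \<in> Obj (on0 T P)" "\<gamma> \<in> carrier (Fib (on0 T P) X)"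
    then show "FMap (G \<odot> F) (under X) \<gamma> = FMap (on1 T G) (OMap (on1 T F) X) (FMap (on1 T F) X \<gamma>)"
      by (simp add: c under_ob)
  qed
qed

lemma on2_cell:
  assumes t: "cell2_in P R F G \<theta>"
  shows "cell2_in (on0 T P) (on0 T R) (on1 T F) (on1 T G) (on2 T \<theta>)"
proof -
  interpret ed_cell2 P R F G \<theta> by (rule ed_cell2I[OF t])
  note sel = on0_sel[OF F.P.elementary_doctrine] on0_sel[OF F.R.elementary_doctrine]
  show ?thesis
    unfolding on2_eq Src2_Tgt2
  proof (rule cell2_mk2I[OF on1_cell[OF F.cell] on1_cell[OF G.cell]])
    fix X assume "X \<in> Obj (on0 T P)"
    then show "AExt (ob F X) (Cmp \<theta> (under X)) (ob G X) \<in> hom (on0 T R) (OMap (on1 T F) X) (OMap (on1 T G) X)"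
      using on2_arr[OF t] by (simp add: hom_def sel)
  next
    fix u assume u: "u \<in> Arr (on0 T P)"
    then show "Comp (on0 T R) (AExt (ob F (Cod (on0 T P) u)) (Cmp \<theta> (under (Cod (on0 T P) u))) (ob G (Cod (on0 T P) u))) (AMap (on1 T F) u)
     = Comp (on0 T R) (AMap (on1 T G) u) (AExt (ob F (Dom (on0 T P) u)) (Cmp \<theta> (under (Dom (on0 T P) u))) (ob G (Dom (on0 T P) u)))"
      by (rule on0_ArrE[OF F.P.elementary_doctrine]) (use u Cmp_natural[of "aunder u"] in \<open>simp add: sel\<close>)
  qed (simp_all add: on2_le[OF t])
qed

lemma two_functor: "two_functor T"
  unfolding two_functor_def
proof (intro conjI allI impI)
  fix P :: "('o, 'a, 'p) ed" assume P: "elementary_doctrine P"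
  show "elementary_doctrine (on0 T P)" using P by (rule elementary)
  show "on1 T (id1 P) = id1 (on0 T P)"
    unfolding on1_eq id1_def[of "on0 T P"] id1_sel
  proof (rule mk1_eqI)
    fix u assume u: "u \<in> Arr (on0 T P)"
    then show "AExt (ob (id1 P) (asrc u)) (AMap (id1 P) (aunder u)) (ob (id1 P) (atgt u)) = u"
      by (rule on0_ArrE[OF P]) (simp add: ob_id[OF P])
  qed (simp_all add: ob_id[OF P] under_Obj[OF P] fibre[OF P])
next
  fix P R F assume F: "cell1_in P R (F :: ('o, 'a, 'p) ed1)"
  show "cell1_in (on0 T P) (on0 T R) (on1 T F)" using F by (rule on1_cell)
  show "on2 T (id2 F) = id2 (on1 T F)"
    unfolding on2_eq id2_def[of "on1 T F"]
    by (rule mk2_eqI) (simp_all add: id2_def on0_sel cell1_inD(1-4)[OF F] under_Obj[OF cell1_inD(1)[OF F]] under_ob)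
next
  fix P R F G \<theta> assume "cell2_in P R F (G :: ('o, 'a, 'p) ed1) \<theta>"
  then show "cell2_in (on0 T P) (on0 T R) (on1 T F) (on1 T G) (on2 T \<theta>)" by (rule on2_cell)
next
  fix P R S F G assume "cell1_in P R F \<and> cell1_in R S (G :: ('o, 'a, 'p) ed1)"
  then show "on1 T (G \<odot> F) = on1 T G \<odot> on1 T F" using on1_comp by blast
next
  fix P R F G H \<theta> \<psi> assume "cell2_in P R F G \<theta> \<and> cell2_in P R G (H :: ('o, 'a, 'p) ed1) \<psi>"
  then have th: "cell2_in P R F G \<theta>" and ps: "cell2_in P R G H \<psi>" by auto
  note s [simp] = cell2_inD(3,4)[OF th] cell2_inD(3,4)[OF ps] cell1_inD(3,4)[OF cell2_inD(1)[OF th]]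
    cell1_inD(3,4)[OF cell2_inD(1)[OF ps]]
  note e = cell1_inD[OF cell2_inD(1)[OF th]]
  show "on2 T (vcomp \<psi> \<theta>) = vcomp (on2 T \<psi>) (on2 T \<theta>)"
    unfolding on2_eq[of "vcomp \<psi> \<theta>"] vcomp_def[of "on2 T \<psi>"]
    by (rule mk2_eqI) (simp_all add: vcomp_def on0_sel e(2) under_Obj[OF e(1)])
next
  fix P R S F G H K \<theta> \<psi> assume "cell2_in P R F G \<theta> \<and> cell2_in R S H (K :: ('o, 'a, 'p) ed1) \<psi>"
  then have th: "cell2_in P R F G \<theta>" and ps: "cell2_in R S H K \<psi>" by auto
  note F = cell2_inD(1)[OF th] and G = cell2_inD(2)[OF th] and H = cell2_inD(1)[OF ps] and K = cell2_inD(2)[OF ps]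
  note [simp] = cell2_inD(3,4)[OF th] cell2_inD(3,4)[OF ps] cell1_inD(3,4)[OF F] cell1_inD(3,4)[OF G]
    cell1_inD(3,4)[OF H] cell1_inD(3,4)[OF K]
  note e = cell1_inD[OF F] and e' = cell1_inD[OF H]
  interpret T: ed_cell2 "on0 T P" "on0 T R" "on1 T F" "on1 T G" "on2 T \<theta>" by (rule ed_cell2I[OF on2_cell[OF th]])
  have a: "AExt (ob F X) (Cmp \<theta> (under X)) (ob G X) \<in> Arr (on0 T R)" if "X \<in> Obj (on0 T P)" for X
    using T.Cmp_simps(1)[OF that] that by simp
  show "on2 T (hcomp \<psi> \<theta>) = hcomp (on2 T \<psi>) (on2 T \<theta>)"
    unfolding on2_eq[of "hcomp \<psi> \<theta>"] hcomp_def[of "on2 T \<psi>"]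
  proof (rule mk2_eqI)
    show "on1 T (Src2 (hcomp \<psi> \<theta>)) = Src2 (on2 T \<psi>) \<odot> Src2 (on2 T \<theta>)"
      "on1 T (Tgt2 (hcomp \<psi> \<theta>)) = Tgt2 (on2 T \<psi>) \<odot> Tgt2 (on2 T \<theta>)"
      by (simp_all add: hcomp_def on1_comp[OF F H] on1_comp[OF G K])
    fix X assume "X \<in> Obj (Src1 (on1 T (Src2 (hcomp \<psi> \<theta>))))"
    then have [simp]: "X \<in> Obj (on0 T P)" by (simp add: hcomp_def)
    show "AExt (ob (Src2 (hcomp \<psi> \<theta>)) X) (Cmp (hcomp \<psi> \<theta>) (under X)) (ob (Tgt2 (hcomp \<psi> \<theta>)) X) =
         Comp (Tgt1 (Src2 (on2 T \<psi>))) (AMap (Tgt2 (on2 T \<psi>)) (Cmp (on2 T \<theta>) X))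
          (Cmp (on2 T \<psi>) (OMap (Src2 (on2 T \<theta>)) X))"
      by (simp add: hcomp_def on0_sel[OF e'(2)] a ob_Obj[OF F] ob_comp[OF F H] ob_comp[OF G K] under_Obj[OF e(1)] under_ob)
  qed
qed

end

lemma Tc_sel [simp]:
  "on0 Tc = Tc0" "on1 Tc = Tc1" "on2 Tc = Tc2"
  "Unit Tc P = mk1 P (Tc0 P) (unit_c_obj P) (unit_arr P (unit_c_obj P)) (\<lambda>A \<alpha>. \<alpha>)"
  "Mult Tc P = mk1 (Tc0 (Tc0 P)) (Tc0 P) mult_obj mult_arr (\<lambda>X \<gamma>. \<gamma>)"
  by (simp_all add: Tc_def)

lemma Tq_sel [simp]:
  "on0 Tq = Tq0" "on1 Tq = Tq1" "on2 Tq = Tq2"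
  "Unit Tq P = mk1 P (Tq0 P) (unit_q_obj P) (unit_arr P (unit_q_obj P)) (\<lambda>A \<alpha>. \<alpha>)"
  "Mult Tq P = mk1 (Tq0 (Tq0 P)) (Tq0 P) mult_obj mult_arr (\<lambda>X \<gamma>. \<gamma>)"
  by (simp_all add: Tq_def)

lemma Tc_lifting: "lifting_two_functor (Tc :: ('o, 'a, 'p) ed_monad) obj_c"
proof (rule lifting_two_functor.intro, unfold Tc_sel)
  fix P :: "('o, 'a, 'p) ed" assume P: "elementary_doctrine P"
  then interpret P: ed_doctrine P by (rule ed_doctrineI)
  show "elementary_doctrine (Tc0 P)" "lifted_category P (Tc0 P)" by (rule P.Tc0_elementary P.Tc0_lifted)+
  fix X assume X: "X \<in> Obj (Tc0 P)"
  then show "obj_c (id1 P) X = X" by (simp add: obj_c_Ext)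
  show "\<gamma> \<in> carrier (Fib P (under X))" if "\<gamma> \<in> carrier (Fib (Tc0 P) X)" for \<gamma> using that by simp
next
  fix P R S F G and X :: "('o, 'p) obj" assume F: "cell1_in P R F" "cell1_in R S (G :: ('o, 'a, 'p) ed1)" "X \<in> Obj (Tc0 P)"
  then show "obj_c (G \<odot> F) X = obj_c G (obj_c F X)" by (simp add: obj_c_Ext cell1_inD(3))
qed (rule Tc1_def, rule Tc2_def, erule ed_cell.Tc1_cell[OF ed_cellI], erule (1) ed_cell2.Tc2_arr[OF ed_cell2I], erule (2) ed_cell2.Tc2_le[OF ed_cell2I], simp)

lemma Tq_lifting: "lifting_two_functor (Tq :: ('o, 'a, 'p) ed_monad) obj_q"
proof (rule lifting_two_functor.intro, unfold Tq_sel)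
  fix P :: "('o, 'a, 'p) ed" assume P: "elementary_doctrine P"
  then interpret P: ed_doctrine P by (rule ed_doctrineI)
  show "elementary_doctrine (Tq0 P)" "lifted_category P (Tq0 P)" by (rule P.Tq0_elementary P.Tq0_lifted)+
  fix X assume X: "X \<in> Obj (Tq0 P)"
  then show "obj_q (id1 P) X = X" by (simp add: obj_q_Ext rel_image_def)
  show "\<gamma> \<in> carrier (Fib P (under X))" if "\<gamma> \<in> carrier (Fib (Tq0 P) X)" for \<gamma> using that by (simp add: P.Des_el)
next
  fix P R S F G and X :: "('o, 'p) obj" assume F: "cell1_in P R F" "cell1_in R S (G :: ('o, 'a, 'p) ed1)" "X \<in> Obj (Tq0 P)"
  then show "obj_q (G \<odot> F) X = obj_q G (obj_q F X)"
    using rel_image_comp[OF F(1,2), of "under X" "elt X"] by (simp add: obj_q_Ext cell1_inD(3))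
qed (rule Tq1_def, rule Tq2_def, erule ed_cell.Tq1_cell[OF ed_cellI], erule (1) ed_cell2.Tq2_arr[OF ed_cell2I], erule (2) ed_cell2.Tq2_le[OF ed_cell2I], simp)

section \<open>Units and multiplications\<close>

text \<open>Units, multiplications and the distributive law are of this kind: 1-cells that preserve the chosen
  products on the nose and are the identity on elements. Their comparison arrows are identities,
  so that the quotient completion transports no relation along them.\<close>

definition retagging :: "('x, 'y, 'p) doctrine \<Rightarrow> ('x, 'y, 'p) doctrine \<Rightarrow> ('x, 'y, 'p) cell1 \<Rightarrow> bool" where
  "retagging P D F \<longleftrightarrow> cell1_in P D F \<and>
     (\<forall>A\<in>Obj P. \<forall>B\<in>Obj P. OMap F (Prod P A B) = Prod D (OMap F A) (OMap F B) \<and>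
       AMap F (Pr1 P A B) = Pr1 D (OMap F A) (OMap F B) \<and> AMap F (Pr2 P A B) = Pr2 D (OMap F A) (OMap F B)) \<and>
     (\<forall>A\<in>Obj P. \<forall>\<alpha>\<in>carrier (Fib P A). FMap F A \<alpha> = \<alpha>)"

lemma lifted_retagging:
  fixes P D :: "('o, 'a, 'p) ed" and C :: "(('o, 'p) obj, ('o, 'a, 'p) arr, 'm) pcat_scheme"
  assumes P: "elementary_doctrine P" and D: "elementary_doctrine D" and L: "lifted_category C D"
    and ob: "\<And>A. A \<in> Obj P \<Longrightarrow> h A \<in> Obj D"
    and Fa: "\<And>f. f \<in> Arr P \<Longrightarrow> Fa f = AExt (h (Dom P f)) (U f) (h (Cod P f)) \<and> Fa f \<in> Arr D"
    and id: "\<And>A. A \<in> Obj P \<Longrightarrow> U (Ide P A) = Ide C (under (h A))"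
    and comp: "\<And>f g. f \<in> Arr P \<Longrightarrow> g \<in> Arr P \<Longrightarrow> Dom P g = Cod P f \<Longrightarrow> U (Comp P g f) = Comp C (U g) (U f)"
    and prod: "\<And>A B. A \<in> Obj P \<Longrightarrow> B \<in> Obj P \<Longrightarrow> h (Prod P A B) = Prod D (h A) (h B) \<and>
      U (Pr1 P A B) = Pr1 C (under (h A)) (under (h B)) \<and> U (Pr2 P A B) = Pr2 C (under (h A)) (under (h B))"
    and fib: "\<And>A. A \<in> Obj P \<Longrightarrow> Fib P A = Fib D (h A)"
    and nat: "\<And>f \<alpha>. f \<in> Arr P \<Longrightarrow> \<alpha> \<in> carrier (Fib P (Cod P f)) \<Longrightarrow> Re P f \<alpha> = Re D (Fa f) \<alpha>"
    and delta: "\<And>A. A \<in> Obj P \<Longrightarrow> delta P A = delta D (h A)"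
  shows "retagging P D (mk1 P D h Fa (\<lambda>A \<alpha>. \<alpha>))"
proof -
  interpret P: elem_doctrine P by (rule elementary_doctrineD[OF P])
  interpret L: lifted_category C D by (rule L)
  have func: "is_functor P D h Fa"
    by (rule L.is_functorI[where U = U, OF P.prod_category_axioms ob _ id comp]) (use Fa in force)+
  have pr: "h (Prod P A B) = Prod D (h A) (h B) \<and> Fa (Pr1 P A B) = Pr1 D (h A) (h B) \<and> Fa (Pr2 P A B) = Pr2 D (h A) (h B)"
    if "A \<in> Obj P" "B \<in> Obj P" for A B
    using that prod[OF that] Fa[of "Pr1 P A B"] Fa[of "Pr2 P A B"] by (simp add: L.sel_D)
  have "cell1_in P D (mk1 P D h Fa (\<lambda>A \<alpha>. \<alpha>))"
  proof (rule cell1_strictI[OF P D func pr])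
    fix A assume "A \<in> Obj P"
    then show "infsl_hom (Fib P A) (Fib D (h A)) (\<lambda>\<alpha>. \<alpha>)" by (simp add: infsl_hom_def fib)
  qed (simp_all add: nat delta)
  then show ?thesis by (simp add: retagging_def pr)
qed

lemma retaggingD:
  assumes "retagging P D F"
  shows "cell1_in P D F"
    "\<And>A \<alpha>. A \<in> Obj P \<Longrightarrow> \<alpha> \<in> carrier (Fib P A) \<Longrightarrow> FMap F A \<alpha> = \<alpha>"
  using assms by (auto simp: retagging_def)

lemma rel_image_retagging:
  fixes P :: "('o, 'a, 'p) ed"
  assumes r: "retagging P D F" and A: "A \<in> Obj P" "\<rho> \<in> carrier (Fib P (Prod P A A))"
  shows "rel_image F A \<rho> = \<rho>"
proof -
  interpret ed_cell P D F by (rule ed_cellI[OF retaggingD(1)[OF r]])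
  show ?thesis
    using rel_image_strict[OF A] r A by (simp add: retagging_def)
qed

text \<open>The components of a composite 1-cell are only known on the elements of the carriers; this form
  reduces an equation between composites to one between objects, arrows and elements.\<close>

lemma mk1_comp1:
  assumes "cell1_in P R F"
  shows "mk1 R S Go Ga c \<odot> F = mk1 P S (\<lambda>A. Go (OMap F A)) (\<lambda>f. Ga (AMap F f)) (\<lambda>A \<alpha>. c (OMap F A) (FMap F A \<alpha>))"
proof -
  note c = cell1_inD[OF assms]
  have func: "is_functor P R (OMap F) (AMap F)" and hom: "\<And>A. A \<in> Obj P \<Longrightarrow> infsl_hom (Fib P A) (Fib R (OMap F A)) (FMap F A)"
    using assms by (simp_all add: cell1_in_def)
  show ?thesis
    unfolding comp1_def c(3) mk1_sel(2)
  proof (rule mk1_eqI)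
    fix A assume A: "A \<in> Obj P"
    then have [simp]: "OMap F A \<in> Obj R" using func by (simp add: is_functor_def)
    then show "OMap (mk1 R S Go Ga c) (OMap F A) = Go (OMap F A)" by simp
    fix \<alpha> assume "\<alpha> \<in> carrier (Fib P A)"
    then have "FMap F A \<alpha> \<in> carrier (Fib R (OMap F A))" using hom[OF A] by (auto simp: infsl_hom_def)
    then show "FMap (mk1 R S Go Ga c) (OMap F A) (FMap F A \<alpha>) = c (OMap F A) (FMap F A \<alpha>)" by simp
  next
    fix f assume "f \<in> Arr P"
    then have "AMap F f \<in> Arr R" using func by (simp add: is_functor_def hom_def)
    then show "AMap (mk1 R S Go Ga c) (AMap F f) = Ga (AMap F f)" by simp
  qed
qed

text \<open>The 2-dimensional condition is an equation between whiskerings, and each of these carries an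
  identity component. Once naturality for 1-cells is known, cancelling the identities leaves an
  equation between components.\<close>

lemma two_naturalI:
  fixes \<sigma> :: "('o, 'a, 'p) ed \<Rightarrow> ('o, 'a, 'p) ed1"
  assumes S: "\<And>P R F G \<theta>. cell2_in P R F G \<theta> \<Longrightarrow> cell2_in (on0 S P) (on0 S R) (on1 S F) (on1 S G) (on2 S \<theta>)"
    and T: "\<And>P R F G \<theta>. cell2_in P R F G \<theta> \<Longrightarrow> cell2_in (on0 T P) (on0 T R) (on1 T F) (on1 T G) (on2 T \<theta>)"
    and cell: "\<And>P. elementary_doctrine P \<Longrightarrow> cell1_in (on0 S P) (on0 T P) (\<sigma> P)"
    and nat1: "\<And>P R F. cell1_in P R F \<Longrightarrow> \<sigma> R \<odot> on1 S F = on1 T F \<odot> \<sigma> P"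
    and nat2: "\<And>P R F G \<theta> X. cell2_in P R F G \<theta> \<Longrightarrow> X \<in> Obj (on0 S P) \<Longrightarrow>
      AMap (\<sigma> R) (Cmp (on2 S \<theta>) X) = Cmp (on2 T \<theta>) (OMap (\<sigma> P) X)"
  shows "two_natural S T \<sigma>"
  unfolding two_natural_def
proof (intro conjI allI impI)
  fix P R F G \<theta> assume th: "cell2_in P R F (G :: ('o, 'a, 'p) ed1) \<theta>"
  note F = cell2_inD(1)[OF th] and G = cell2_inD(2)[OF th]
  interpret s: ed_cell2 "on0 S P" "on0 S R" "on1 S F" "on1 S G" "on2 S \<theta>" by (rule ed_cell2I[OF S[OF th]])
  interpret t: ed_cell2 "on0 T P" "on0 T R" "on1 T F" "on1 T G" "on2 T \<theta>" by (rule ed_cell2I[OF T[OF th]])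
  interpret p: ed_cell "on0 S P" "on0 T P" "\<sigma> P" by (rule ed_cellI[OF cell[OF cell1_inD(1)[OF F]]])
  interpret r: ed_cell "on0 S R" "on0 T R" "\<sigma> R" by (rule ed_cellI[OF cell[OF cell1_inD(2)[OF F]]])
  have o: "OMap (\<sigma> R) (OMap (on1 S F) X) = OMap (on1 T F) (OMap (\<sigma> P) X)"
    "OMap (\<sigma> R) (OMap (on1 S G) X) = OMap (on1 T G) (OMap (\<sigma> P) X)" if "X \<in> Obj (on0 S P)" for X
    using arg_cong[OF nat1[OF F], of "\<lambda>c. OMap c X"] arg_cong[OF nat1[OF G], of "\<lambda>c. OMap c X"] that by simp_all
  show "hcomp (id2 (\<sigma> R)) (on2 S \<theta>) = hcomp (on2 T \<theta>) (id2 (\<sigma> P))"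
    unfolding hcomp_def
  proof (rule mk2_eqI)
    show "Src2 (id2 (\<sigma> R)) \<odot> Src2 (on2 S \<theta>) = Src2 (on2 T \<theta>) \<odot> Src2 (id2 (\<sigma> P))"
      "Tgt2 (id2 (\<sigma> R)) \<odot> Tgt2 (on2 S \<theta>) = Tgt2 (on2 T \<theta>) \<odot> Tgt2 (id2 (\<sigma> P))"
      by (simp_all add: id2_def nat1[OF F] nat1[OF G])
    fix X assume "X \<in> Obj (Src1 (Src2 (id2 (\<sigma> R)) \<odot> Src2 (on2 S \<theta>)))"
    then have X [simp]: "X \<in> Obj (on0 S P)" by simp
    have a: "Cmp (on2 T \<theta>) (OMap (\<sigma> P) X) \<in> Arr (on0 T R)" "OMap (on1 T F) (OMap (\<sigma> P) X) \<in> Obj (on0 T R)"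
      "OMap (on1 T G) (OMap (\<sigma> P) X) \<in> Obj (on0 T R)" by simp_all
    show "Comp (Tgt1 (Src2 (id2 (\<sigma> R)))) (AMap (Tgt2 (id2 (\<sigma> R))) (Cmp (on2 S \<theta>) X)) (Cmp (id2 (\<sigma> R)) (OMap (Src2 (on2 S \<theta>)) X)) =
        Comp (Tgt1 (Src2 (on2 T \<theta>))) (AMap (Tgt2 (on2 T \<theta>)) (Cmp (id2 (\<sigma> P)) X)) (Cmp (on2 T \<theta>) (OMap (Src2 (id2 (\<sigma> P))) X))"
      by (simp add: id2_def nat2[OF th X] o)
  qed
qed (simp_all add: cell nat1)

lemma unit_c_obj_sel [simp]: "under (unit_c_obj P A) = A" "elt (unit_c_obj P A) = \<top>\<^bsub>Fib P A\<^esub>"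
  by (simp_all add: unit_c_obj_def)

lemma unit_q_obj_sel [simp]: "under (unit_q_obj P A) = A" "elt (unit_q_obj P A) = delta P A"
  by (simp_all add: unit_q_obj_def)

lemma mult_obj_sel [simp]: "under (mult_obj X) = under (under X)" "elt (mult_obj X) = elt X"
  by (simp_all add: mult_obj_def)

lemma obj_Ext_eqI: "under X = under Y \<Longrightarrow> elt X = elt Y \<Longrightarrow> X = Ext (under X) (elt X) \<Longrightarrow> Y = Ext (under Y) (elt Y) \<Longrightarrow> X = Y"
  by simp

context ed_doctrine
begin

lemma unit_c_Obj [simp]: "A \<in> Obj P \<Longrightarrow> unit_c_obj P A \<in> Obj (Tc0 P)"
  by (simp add: unit_c_obj_def)

lemma unit_q_Obj [simp]: "A \<in> Obj P \<Longrightarrow> unit_q_obj P A \<in> Obj (Tq0 P)"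
  by (simp add: unit_q_obj_def delta_equivalence_rel)

lemma unit_c_arr: "f \<in> Arr P \<Longrightarrow> unit_arr P (unit_c_obj P) f \<in> Arr (Tc0 P)"
  by (simp add: unit_arr_def Tc0_Arr)

lemma prod_q_unit:
  assumes [simp]: "A \<in> Obj P" "B \<in> Obj P"
  shows "unit_q_obj P (Prod P A B) = prod_q P (unit_q_obj P A) (unit_q_obj P B)"
  using delta_Prod[of A B] by (simp add: unit_q_obj_def prod_q_def Let_def)

text \<open>Every arrow respects equality. So each arrow \<open>f : V \<rightarrow> A\<close> of \<open>P\<close> is an arrow from the discrete
  object \<open>(V, \<delta>\<^sub>V)\<close> to \<open>(A, \<rho>)\<close>, over which every element of \<open>P(V)\<close> descends. A condition in the
  quotient completion may therefore be tested on arrows and elements of \<open>P\<close>.\<close>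

lemma discrete_arr:
  assumes [simp]: "f \<in> Arr P" "X \<in> Obj (Tq0 P)" "Cod P f = under X" "Dom P f = V"
  shows "AExt (unit_q_obj P V) f X \<in> Arr (Tq0 P)"
proof -
  have [simp]: "V \<in> Obj P" using arr_simps(1)[of f] by simp
  have "reflexive_on V (Re P (cross P f f) (elt X))"
    unfolding reflexive_on_def by (simp add: cross_tuple)
  then show ?thesis by (simp add: Tq0_Arr delta_le_iff_reflexive cross_tuple)
qed

lemma unit_q_arr: "f \<in> Arr P \<Longrightarrow> unit_arr P (unit_q_obj P) f \<in> Arr (Tq0 P)"
  by (simp add: unit_arr_def discrete_arr)

lemma unit_c_retagging: "retagging P (Tc0 P) (mk1 P (Tc0 P) (unit_c_obj P) (unit_arr P (unit_c_obj P)) (\<lambda>A \<alpha>. \<alpha>))"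
proof (rule lifted_retagging[where U = "\<lambda>f. f", OF elementary_doctrine Tc0_elementary Tc0_lifted])
  fix A assume "A \<in> Obj P"
  moreover have "{\<gamma> \<in> El A. \<gamma> \<sqsubseteq>\<^bsub>Fib P A\<^esub> \<top>\<^bsub>Fib P A\<^esub>} = El A" if "A \<in> Obj P" using that by auto
  ultimately show "Fib P A = Fib (Tc0 P) (unit_c_obj P A)" by simp
qed (use unit_c_arr in \<open>simp_all add: unit_arr_def Tc0_delta, simp_all add: unit_c_obj_def prod_c_def\<close>)

lemma unit_q_retagging: "retagging P (Tq0 P) (mk1 P (Tq0 P) (unit_q_obj P) (unit_arr P (unit_q_obj P)) (\<lambda>A \<alpha>. \<alpha>))"
  by (rule lifted_retagging[where U = "\<lambda>f. f", OF elementary_doctrine Tq0_elementary Tq0_lifted])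
    (use unit_q_arr in \<open>simp_all add: unit_arr_def Tq0_delta prod_q_unit Des_delta\<close>)

lemma ed_Tc0: "ed_doctrine (Tc0 P)" and ed_Tq0: "ed_doctrine (Tq0 P)"
  by (rule ed_doctrineI, rule Tc0_elementary Tq0_elementary)+

lemma TcTc_Obj:
  assumes "X \<in> Obj (Tc0 (Tc0 P))"
  shows "under X \<in> Obj (Tc0 P)" "elt X \<in> El (under (under X))" "elt X \<sqsubseteq>\<^bsub>Fib P (under (under X))\<^esub> elt (under X)"
    "mult_obj X \<in> Obj (Tc0 P)"
  using Tc0_ObjD(1,2)[OF assms] by (simp_all add: mult_obj_def)

text \<open>For \<open>\<gamma> \<sqsubseteq> \<alpha>\<close> and \<open>\<gamma>' \<sqsubseteq> \<beta>\<close>, reindexing \<open>\<gamma>\<close> and \<open>\<gamma>'\<close> along the projections in the completed doctrine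
  adds the conjunct \<open>\<alpha> \<times> \<beta>\<close>, which \<open>\<gamma> \<times> \<gamma>'\<close> already implies.\<close>

lemma mult_prod_c:
  assumes X: "X \<in> Obj (Tc0 (Tc0 P))" and Y: "Y \<in> Obj (Tc0 (Tc0 P))"
  shows "mult_obj (prod_c (Tc0 P) X Y) = prod_c P (mult_obj X) (mult_obj Y)"
proof -
  note [simp] = TcTc_Obj[OF X] TcTc_Obj[OF Y]
  let ?A = "under (under X)" and ?B = "under (under Y)"
  let ?AB = "Prod P ?A ?B"
  note [simp] = Re_mono[of "Pr1 P ?A ?B" ?A "elt X" "elt (under X)" ?AB]  Re_mono[of "Pr2 P ?A ?B" ?B "elt Y" "elt (under Y)" ?AB]
  have t: "z \<sqsubseteq>\<^bsub>Fib P ?AB\<^esub> Re P (Pr1 P ?A ?B) (elt (under X))" if "z \<sqsubseteq>\<^bsub>Fib P ?AB\<^esub> Re P (Pr1 P ?A ?B) (elt X)" "z \<in> El ?AB" for z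
    by (rule Re_le_apply[OF TcTc_Obj(3)[OF X] that(1)]) (use that in simp_all)
  have t': "z \<sqsubseteq>\<^bsub>Fib P ?AB\<^esub> Re P (Pr2 P ?A ?B) (elt (under Y))" if "z \<sqsubseteq>\<^bsub>Fib P ?AB\<^esub> Re P (Pr2 P ?A ?B) (elt Y)" "z \<in> El ?AB" for z
    by (rule Re_le_apply[OF TcTc_Obj(3)[OF Y] that(1)]) (use that in simp_all)
  have "elt (prod_c (Tc0 P) X Y) = elt (prod_c P (mult_obj X) (mult_obj Y))"
    by (simp add: meet_le, rule eqI[of ?AB]) (auto simp: t t')
  then show ?thesis by (rule_tac obj_Ext_eqI) (simp_all add: mult_obj_def prod_c_def Let_def)
qed

lemma mult_c_retagging: "retagging (Tc0 (Tc0 P)) (Tc0 P) (mk1 (Tc0 (Tc0 P)) (Tc0 P) mult_obj mult_arr (\<lambda>X \<gamma>. \<gamma>))"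
proof -
  interpret T: ed_doctrine "Tc0 P" by (rule ed_Tc0)
  have arr: "mult_arr u \<in> Arr (Tc0 P)" if u: "u \<in> Arr (Tc0 (Tc0 P))" for u
  proof -
    note X = TcTc_Obj[OF Tc0_ArrD(1)[OF u]] and Y = TcTc_Obj[OF Tc0_ArrD(2)[OF u]]
    note [simp] = X Y Tc0_ArrD[OF u] Tc0_ArrD[OF Tc0_ArrD(3)[OF u]]
    have d: "under (asrc (aunder u)) = under (under (asrc u))" "under (atgt (aunder u)) = under (under (atgt u))"
      using Tc0_ArrD(4,5)[OF u] by simp_all
    have "elt (asrc u) \<sqsubseteq>\<^bsub>Fib P (under (under (asrc u)))\<^esub> Re P (aunder (aunder u)) (elt (atgt u)) \<sqinter>\<^bsub>Fib P (under (under (asrc u)))\<^esub> elt (under (asrc u))"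
      using Tc0_Arr_le[OF u] Tc0_ArrD(4)[OF u] by (simp add: Re_Tc0)
    then show ?thesis by (simp add: mult_arr_def Tc0_Arr d)
  qed
  show ?thesis
  proof (rule lifted_retagging[where U = "\<lambda>u. aunder (aunder u)", OF T.Tc0_elementary Tc0_elementary Tc0_lifted])
    fix X assume X: "X \<in> Obj (Tc0 (Tc0 P))"
    note [simp] = TcTc_Obj[OF X]
    have "\<gamma> \<sqsubseteq>\<^bsub>Fib P (under (under X))\<^esub> elt (under X)"
      if "\<gamma> \<sqsubseteq>\<^bsub>Fib P (under (under X))\<^esub> elt X" "\<gamma> \<in> El (under (under X))" for \<gamma>
      by (rule le_trans[OF that(1)]) (use that in simp_all)
    then have "{\<gamma> \<in> {\<gamma> \<in> El (under (under X)). \<gamma> \<sqsubseteq>\<^bsub>Fib P (under (under X))\<^esub> elt (under X)}. \<gamma> \<sqsubseteq>\<^bsub>Fib P (under (under X))\<^esub> elt X}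
      = {\<gamma> \<in> El (under (under X)). \<gamma> \<sqsubseteq>\<^bsub>Fib P (under (under X))\<^esub> elt X}" by auto
    then show "Fib (Tc0 (Tc0 P)) X = Fib (Tc0 P) (mult_obj X)" by simp
    let ?A = "under (under X)"
    let ?AA = "Prod P ?A ?A"
    have t: "z \<sqsubseteq>\<^bsub>Fib P ?AA\<^esub> Re P (Pr1 P ?A ?A) (elt (under X))" if "z \<sqsubseteq>\<^bsub>Fib P ?AA\<^esub> Re P (Pr1 P ?A ?A) (elt X)" "z \<in> El ?AA" for z
      by (rule Re_le_apply[OF TcTc_Obj(3)[OF X] that(1)]) (use that in simp_all)
    have t': "z \<sqsubseteq>\<^bsub>Fib P ?AA\<^esub> Re P (Pr2 P ?A ?A) (elt (under X))" if "z \<sqsubseteq>\<^bsub>Fib P ?AA\<^esub> Re P (Pr2 P ?A ?A) (elt X)" "z \<in> El ?AA" for z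
      by (rule Re_le_apply[OF TcTc_Obj(3)[OF X] that(1)]) (use that in simp_all)
    show "delta (Tc0 (Tc0 P)) X = delta (Tc0 P) (mult_obj X)"
      by (simp add: T.Tc0_delta[OF X] Tc0_delta meet_le, rule eqI[of ?AA]) (auto simp: t t')
  next
    fix u \<gamma> assume u: "u \<in> Arr (Tc0 (Tc0 P))" and "\<gamma> \<in> carrier (Fib (Tc0 (Tc0 P)) (Cod (Tc0 (Tc0 P)) u))"
    note X = TcTc_Obj[OF Tc0_ArrD(1)[OF u]] and Y = TcTc_Obj[OF Tc0_ArrD(2)[OF u]]
    note [simp] = X Y Tc0_ArrD[OF u] Tc0_ArrD[OF Tc0_ArrD(3)[OF u]]
    have d [simp]: "asrc (aunder u) = under (asrc u)" "atgt (aunder u) = under (atgt u)"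
      using Tc0_ArrD(4,5)[OF u] by simp_all
    have [simp]: "\<gamma> \<in> El (under (under (atgt u)))" using \<open>\<gamma> \<in> _\<close> by simp
    have t: "z \<sqsubseteq>\<^bsub>Fib P (under (under (asrc u)))\<^esub> elt (under (asrc u))"
      if "z \<sqsubseteq>\<^bsub>Fib P (under (under (asrc u)))\<^esub> elt (asrc u)" "z \<in> El (under (under (asrc u)))" for z
      by (rule le_trans[OF that(1)]) (use that in simp_all)
    show "Re (Tc0 (Tc0 P)) u \<gamma> = Re (Tc0 P) (mult_arr u) \<gamma>"
      by (simp add: Re_Tc0 mult_arr_def meet_le, rule eqI[of "under (under (asrc u))"]) (auto simp: t)
  qed (use arr in \<open>simp_all add: mult_arr_def TcTc_Obj mult_prod_c\<close>)
qed

text \<open>An equivalence relation \<open>\<tau>\<close> on \<open>(A, \<rho>)\<close> in the completed doctrine is reflexive in the sense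
  \<open>\<rho> \<sqsubseteq> \<tau>\<close>. Evaluated at arrows out of discrete objects, its symmetry and transitivity are those of an
  equivalence relation on \<open>A\<close>.\<close>

lemma TqTq_Obj:
  assumes X: "X \<in> Obj (Tq0 (Tq0 P))"
  shows "under X \<in> Obj (Tq0 P)" "equivalence_rel P (under (under X)) (elt X)"
    "elt X \<in> El (Prod P (under (under X)) (under (under X)))"
    "elt (under X) \<sqsubseteq>\<^bsub>Fib P (Prod P (under (under X)) (under (under X)))\<^esub> elt X"
    "mult_obj X \<in> Obj (Tq0 P)"
proof -
  interpret T: ed_doctrine "Tq0 P" by (rule ed_Tq0)
  let ?X = "under X"
  let ?A = "under ?X"
  show X' [simp]: "under X \<in> Obj (Tq0 P)" using X by simp
  note e = Tq0_ObjD(2)[OF X]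
  have "elt X \<in> T.El (prod_q P ?X ?X)" using T.equivalence_rel_el[OF e] by (simp only: Tq0_sel)
  then show el [simp]: "elt X \<in> El (Prod P ?A ?A)" by (simp add: Des_el)
  show le: "elt (under X) \<sqsubseteq>\<^bsub>Fib P (Prod P ?A ?A)\<^esub> elt X"
    using e by (simp add: equivalence_rel_def Tq0_delta)
  note d = discrete_arr[OF _ X']
  have "equivalence_rel P ?A (elt X)"
  proof (rule equivalence_relI)
    show "reflexive_on ?A (elt X)"
    proof -
      have "delta P ?A \<sqsubseteq>\<^bsub>Fib P (Prod P ?A ?A)\<^esub> elt X"
        by (rule le_trans[OF _ le]) (use Tq0_ObjD(2)[OF X'] in \<open>simp_all add: equivalence_rel_def\<close>)
      then show ?thesis using delta_le_iff_reflexive[of ?A "elt X"] by simp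
    qed
  next
    fix z Y f g assume le: "z \<sqsubseteq>\<^bsub>Fib P Y\<^esub> Re P (tuple P f g) (elt X)" and [simp]: "z \<in> El Y"
      "f \<in> Arr P" "g \<in> Arr P" and a: "Dom P f = Y" "Dom P g = Y" "Cod P f = ?A" "Cod P g = ?A"
    have Y [simp]: "Y \<in> Obj P" using a by auto
    note f = d[of f Y] and g = d[of g Y]
    show "z \<sqsubseteq>\<^bsub>Fib P Y\<^esub> Re P (tuple P g f) (elt X)"
      using T.equivalence_rel_sym[OF e, of "unit_q_obj P Y" z "AExt (unit_q_obj P Y) f ?X" "AExt (unit_q_obj P Y) g ?X"] f g le a
      by (simp add: Tq0_tuple(1) Des_delta)
  next
    fix z Y f g h assume le: "z \<sqsubseteq>\<^bsub>Fib P Y\<^esub> Re P (tuple P f g) (elt X)" "z \<sqsubseteq>\<^bsub>Fib P Y\<^esub> Re P (tuple P g h) (elt X)"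
      and [simp]: "z \<in> El Y" "f \<in> Arr P" "g \<in> Arr P" "h \<in> Arr P"
      and a: "Dom P f = Y" "Dom P g = Y" "Dom P h = Y" "Cod P f = ?A" "Cod P g = ?A" "Cod P h = ?A"
    have Y [simp]: "Y \<in> Obj P" using a by auto
    note f = d[of f Y] and g = d[of g Y] and h = d[of h Y]
    show "z \<sqsubseteq>\<^bsub>Fib P Y\<^esub> Re P (tuple P f h) (elt X)"
      using T.equivalence_rel_trans[OF e, of "unit_q_obj P Y" z "AExt (unit_q_obj P Y) f ?X" "AExt (unit_q_obj P Y) g ?X" "AExt (unit_q_obj P Y) h ?X"] f g h le a
      by (simp add: Tq0_tuple(1) Des_delta)
  qed simp
  then show "equivalence_rel P (under (under X)) (elt X)" .
  then show "mult_obj X \<in> Obj (Tq0 P)" by (simp add: mult_obj_def)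
qed

text \<open>Since \<open>\<rho> \<sqsubseteq> \<tau>\<close>, an element that descends along \<open>\<tau>\<close> also descends along \<open>\<rho>\<close> and so lies in the fibre
  over \<open>(A, \<rho>)\<close>. The descent condition itself can be tested at arrows out of discrete objects.\<close>

lemma Des_TqTq:
  assumes X: "X \<in> Obj (Tq0 (Tq0 P))"
  shows "Des (Tq0 P) (under X) (elt X) = Des P (under (under X)) (elt X)"
proof -
  interpret T: ed_doctrine "Tq0 P" by (rule ed_Tq0)
  let ?X = "under X"
  let ?A = "under ?X"
  let ?AA = "Prod P ?A ?A"
  note [simp] = TqTq_Obj[OF X]
  have el: "elt X \<in> T.El (Prod (Tq0 P) ?X ?X)" using T.equivalence_rel_el[OF Tq0_ObjD(2)[OF X]] .
  note d = discrete_arr[OF _ TqTq_Obj(1)[OF X]]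
  show ?thesis
  proof (rule Set.equalityI; rule subsetI)
    fix \<alpha> assume \<alpha>: "\<alpha> \<in> Des (Tq0 P) ?X (elt X)"
    then have [simp]: "\<alpha> \<in> El ?A" using T.Des_el[OF \<alpha>] by (simp add: Des_el)
    show "\<alpha> \<in> Des P ?A (elt X)"
    proof (rule DesI)
      fix z assume z: "z \<in> El ?AA" "z \<sqsubseteq>\<^bsub>Fib P ?AA\<^esub> Re P (Pr1 P ?A ?A) \<alpha>" "z \<sqsubseteq>\<^bsub>Fib P ?AA\<^esub> elt X"
      note f = d[of "Pr1 P ?A ?A" ?AA] and g = d[of "Pr2 P ?A ?A" ?AA]
      show "z \<sqsubseteq>\<^bsub>Fib P ?AA\<^esub> Re P (Pr2 P ?A ?A) \<alpha>"
        using T.DesD[OF \<alpha>, of "unit_q_obj P ?AA" z "AExt (unit_q_obj P ?AA) (Pr1 P ?A ?A) ?X" "AExt (unit_q_obj P ?AA) (Pr2 P ?A ?A) ?X"] f g z el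
        by (simp add: Tq0_tuple(1) Des_delta)
    qed simp_all
  next
    fix \<alpha> assume \<alpha>: "\<alpha> \<in> Des P ?A (elt X)"
    then have [simp]: "\<alpha> \<in> El ?A" by (rule Des_el)
    have \<alpha>': "\<alpha> \<in> Des P ?A (elt ?X)"
    proof (rule DesI)
      fix z assume z: "z \<in> El ?AA" "z \<sqsubseteq>\<^bsub>Fib P ?AA\<^esub> Re P (Pr1 P ?A ?A) \<alpha>" "z \<sqsubseteq>\<^bsub>Fib P ?AA\<^esub> elt ?X"
      have "z \<sqsubseteq>\<^bsub>Fib P ?AA\<^esub> elt X" by (rule le_trans[OF z(3)]) (use z in simp_all)
      then show "z \<sqsubseteq>\<^bsub>Fib P ?AA\<^esub> Re P (Pr2 P ?A ?A) \<alpha>"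
        using DesD[OF \<alpha>, of ?AA z "Pr1 P ?A ?A" "Pr2 P ?A ?A"] z by simp
    qed simp_all
    show "\<alpha> \<in> Des (Tq0 P) ?X (elt X)"
    proof (rule T.DesI)
      show "\<alpha> \<in> T.El ?X" using \<alpha>' by simp
      show "elt X \<in> T.El (Prod (Tq0 P) ?X ?X)" by (rule el)
      fix z assume z: "z \<in> T.El (Prod (Tq0 P) ?X ?X)"
        "z \<sqsubseteq>\<^bsub>Fib (Tq0 P) (Prod (Tq0 P) ?X ?X)\<^esub> Re (Tq0 P) (Pr1 (Tq0 P) ?X ?X) \<alpha>"
        "z \<sqsubseteq>\<^bsub>Fib (Tq0 P) (Prod (Tq0 P) ?X ?X)\<^esub> elt X"
      then have "z \<in> El ?AA" by (simp add: Des_el)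
      then show "z \<sqsubseteq>\<^bsub>Fib (Tq0 P) (Prod (Tq0 P) ?X ?X)\<^esub> Re (Tq0 P) (Pr2 (Tq0 P) ?X ?X) \<alpha>"
        using DesD[OF \<alpha>, of ?AA z "Pr1 P ?A ?A" "Pr2 P ?A ?A"] z by simp
    qed simp
  qed
qed

lemma mult_prod_q:
  assumes X: "X \<in> Obj (Tq0 (Tq0 P))" and Y: "Y \<in> Obj (Tq0 (Tq0 P))"
  shows "mult_obj (prod_q (Tq0 P) X Y) = prod_q P (mult_obj X) (mult_obj Y)"
proof -
  interpret T: ed_doctrine "Tq0 P" by (rule ed_Tq0)
  note [simp] = TqTq_Obj[OF X] TqTq_Obj[OF Y]
  let ?X = "under X" and ?Y = "under Y"
  let ?A = "under ?X" and ?B = "under ?Y"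
  let ?XY = "prod_q P ?X ?Y"
  have p: "AExt ?XY (Pr1 P ?A ?B) ?X \<in> Arr (Tq0 P)" "AExt ?XY (Pr2 P ?A ?B) ?Y \<in> Arr (Tq0 P)"
    using T.prod_simps(2,3)[of ?X ?Y] by simp_all
  note c = lifted_category.cross_D(2)[OF Tq0_lifted p(1) p(1), unfolded Tq0_sel]
    lifted_category.cross_D(2)[OF Tq0_lifted p(2) p(2), unfolded Tq0_sel]
  have el: "elt X \<in> T.El (prod_q P ?X ?X)" "elt Y \<in> T.El (prod_q P ?Y ?Y)"
    using T.equivalence_rel_el[OF Tq0_ObjD(2)[OF X]] T.equivalence_rel_el[OF Tq0_ObjD(2)[OF Y]] by (simp_all only: Tq0_sel)
  have r: "Re P (cross P (Pr1 P ?A ?B) (Pr1 P ?A ?B)) (elt X) \<in> Des P (Prod P (Prod P ?A ?B) (Prod P ?A ?B)) (elt (prod_q P ?XY ?XY))"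
    "Re P (cross P (Pr2 P ?A ?B) (Pr2 P ?A ?B)) (elt Y) \<in> Des P (Prod P (Prod P ?A ?B) (Prod P ?A ?B)) (elt (prod_q P ?XY ?XY))"
    using Des_Re[OF c(1)] Des_Re[OF c(2)] el by simp_all
  have Q: "prod_q P ?XY ?XY \<in> Obj (Tq0 P)" by simp
  have "elt (prod_q (Tq0 P) X Y) = elt (prod_q P (mult_obj X) (mult_obj Y))"
    unfolding prod_q_sel(2) Tq0_sel(5-7) Tq0_cross(1)[OF p(1) p(1)] Tq0_cross(1)[OF p(2) p(2)] Tq0_sel(8)
    using Tq0_fibre(2)[OF Q] r by simp
  then show ?thesis by (rule_tac obj_Ext_eqI) (simp_all add: mult_obj_def prod_q_def Let_def)
qed

lemma mult_q_retagging: "retagging (Tq0 (Tq0 P)) (Tq0 P) (mk1 (Tq0 (Tq0 P)) (Tq0 P) mult_obj mult_arr (\<lambda>X \<gamma>. \<gamma>))"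
proof -
  interpret T: ed_doctrine "Tq0 P" by (rule ed_Tq0)
  interpret L: lifted_category P "Tq0 P" by (rule Tq0_lifted)
  have arr: "mult_arr u \<in> Arr (Tq0 P)" if u: "u \<in> Arr (Tq0 (Tq0 P))" for u
  proof -
    let ?X = "asrc u" and ?Y = "atgt u" and ?f = "aunder (aunder u)"
    note X = TqTq_Obj[OF Tq0_ArrD(1)[OF u]] and Y = TqTq_Obj[OF Tq0_ArrD(2)[OF u]]
    note [simp] = X Y Tq0_ArrD[OF u] Tq0_ArrD[OF Tq0_ArrD(3)[OF u]]
    have d [simp]: "asrc (aunder u) = under ?X" "atgt (aunder u) = under ?Y"
      using Tq0_ArrD(4,5)[OF u] by simp_all
    have uu: "AExt ?X (aunder u) ?Y \<in> Arr (Tq0 (Tq0 P))" by (rule Tq0_ArrD(6)[OF u])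
    have au: "AExt (under ?X) ?f (under ?Y) \<in> Arr (Tq0 P)" using Tq0_ArrD(6)[OF Tq0_ArrD(3)[OF u]] by simp
    have "AExt (mult_obj ?X) ?f (mult_obj ?Y) \<in> Arr (Tq0 P)"
    proof (rule Tq0_ArrI)
      fix z V h k assume le: "z \<sqsubseteq>\<^bsub>Fib P V\<^esub> Re P (tuple P h k) (elt (mult_obj ?X))"
        and [simp]: "V \<in> Obj P" "z \<in> El V" "h \<in> Arr P" "k \<in> Arr P" 
        and a: "Dom P h = V" "Dom P k = V" "Cod P h = under (mult_obj ?X)" "Cod P k = under (mult_obj ?X)"
      let ?V = "unit_q_obj P V"
      have h: "AExt ?V h (under ?X) \<in> Arr (Tq0 P)" and k: "AExt ?V k (under ?X) \<in> Arr (Tq0 P)"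
        using a by (simp_all add: discrete_arr)
      note fh = L.Comp_D[OF h au] and fk = L.Comp_D[OF k au]
      show "z \<sqsubseteq>\<^bsub>Fib P V\<^esub> Re P (tuple P (Comp P ?f h) (Comp P ?f k)) (elt (mult_obj ?Y))"
        using T.Tq0_Arr_apply[OF uu, of ?V z "AExt ?V h (under ?X)" "AExt ?V k (under ?X)"] le h k a
        by (simp add: Tq0_tuple(1)[OF h k] Tq0_tuple(1)[OF fh fk] Des_delta)
    qed simp_all
    then show ?thesis by (simp add: mult_arr_def)
  qed
  show ?thesis
  proof (rule lifted_retagging[where U = "\<lambda>u. aunder (aunder u)", OF T.Tq0_elementary Tq0_elementary Tq0_lifted])
    fix X assume X: "X \<in> Obj (Tq0 (Tq0 P))"
    then show "Fib (Tq0 (Tq0 P)) X = Fib (Tq0 P) (mult_obj X)" by (simp add: Des_TqTq)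
    show "delta (Tq0 (Tq0 P)) X = delta (Tq0 P) (mult_obj X)"
      using TqTq_Obj[OF X] by (simp add: T.Tq0_delta[OF X] Tq0_delta)
  next
    fix u \<gamma> assume u: "u \<in> Arr (Tq0 (Tq0 P))" 
    then show "Re (Tq0 (Tq0 P)) u \<gamma> = Re (Tq0 P) (mult_arr u) \<gamma>"
      by (simp add: Re_Tq0 mult_arr_def)
  qed (use arr in \<open>simp_all add: mult_arr_def TqTq_Obj mult_prod_q\<close>)
qed

end

context ed_cell
begin

text \<open>The image relation formed in the completed doctrines has, on underlying arrows, the property that
  characterizes the image relation in \<open>R\<close>; so the two coincide.\<close>

lemma rel_image_Tq1:
  assumes X [simp]: "X \<in> Obj (Tq0 P)" and \<tau>: "\<tau> \<in> Des P (Prod P (under X) (under X)) (elt (prod_q P X X))"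
  shows "rel_image (Tq1 F) X \<tau> = rel_image F (under X) \<tau>"
proof -
  interpret T: ed_cell "Tq0 P" "Tq0 R" "Tq1 F" by (rule ed_cellI[OF Tq1_cell])
  let ?A = "under X" and ?s = "rel_image (Tq1 F) X \<tau>"
  have [simp]: "\<tau> \<in> P.El (Prod P ?A ?A)" using \<tau> by (rule P.Des_el)
  have \<tau>': "\<tau> \<in> T.P.El (Prod (Tq0 P) X X)" using \<tau> by simp
  have p: "AExt (prod_q P X X) (Pr1 P ?A ?A) X \<in> Arr (Tq0 P)" "AExt (prod_q P X X) (Pr2 P ?A ?A) X \<in> Arr (Tq0 P)"
    using T.P.prod_simps(2,3)[of X X] by simp_all
  note t = R.Tq0_tuple(1)[OF Tq1_arr[OF p(1), unfolded arr.sel] Tq1_arr[OF p(2), unfolded arr.sel]]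
  have "Re (Tq0 R) (tuple (Tq0 R) (AMap (Tq1 F) (Pr1 (Tq0 P) X X)) (AMap (Tq1 F) (Pr2 (Tq0 P) X X))) ?s
    = FMap (Tq1 F) (Prod (Tq0 P) X X) \<tau>"
    by (rule T.Re_rel_image[OF X \<tau>'])
  then have "Re R (tuple R (AMap F (Pr1 P ?A ?A)) (AMap F (Pr2 P ?A ?A))) ?s = FMap F (Prod P ?A ?A) \<tau>"
    using \<tau> p by (simp add: t)
  moreover have "?s \<in> R.El (Prod R (OMap F ?A) (OMap F ?A))"
    using T.rel_image_El[OF X \<tau>'] by (simp add: R.Des_el)
  ultimately show ?thesis by (intro rel_image_unique[symmetric]) simp_all
qed

text \<open>As above. Reindexing now adds a conjunct \<open>F(\<alpha> \<times> \<alpha>)\<close>, which the image of \<open>\<tau> \<sqsubseteq> \<alpha> \<times> \<alpha>\<close> absorbs.\<close>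

lemma rel_image_Tc1:
  assumes X [simp]: "X \<in> Obj (Tc0 P)" and \<tau>: "\<tau> \<in> P.El (Prod P (under X) (under X))"
    "\<tau> \<sqsubseteq>\<^bsub>Fib P (Prod P (under X) (under X))\<^esub> elt (prod_c P X X)"
  shows "rel_image (Tc1 F) X \<tau> = rel_image F (under X) \<tau>"
proof -
  interpret T: ed_cell "Tc0 P" "Tc0 R" "Tc1 F" by (rule ed_cellI[OF Tc1_cell])
  let ?A = "under X" and ?s = "rel_image (Tc1 F) X \<tau>"
  have \<tau>': "\<tau> \<in> T.P.El (Prod (Tc0 P) X X)" using \<tau> by simp
  have p: "AExt (prod_c P X X) (Pr1 P ?A ?A) X \<in> Arr (Tc0 P)" "AExt (prod_c P X X) (Pr2 P ?A ?A) X \<in> Arr (Tc0 P)"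
    using T.P.prod_simps(2,3)[of X X] by simp_all
  note t = R.Tc0_tuple(1)[OF Tc1_arr[OF p(1), unfolded arr.sel] Tc1_arr[OF p(2), unfolded arr.sel]]
  let ?t = "tuple R (AMap F (Pr1 P ?A ?A)) (AMap F (Pr2 P ?A ?A))"
  have s: "?s \<in> R.El (Prod R (OMap F ?A) (OMap F ?A))"
    "?s \<sqsubseteq>\<^bsub>Fib R (Prod R (OMap F ?A) (OMap F ?A))\<^esub> elt (prod_c R (obj_c F X) (obj_c F X))"
    using T.rel_image_El[OF X \<tau>'] by simp_all
  have e: "Re R ?t (elt (prod_c R (obj_c F X) (obj_c F X))) = elt (obj_c F (prod_c P X X))" by simp
  have "Re R ?t ?s \<sqsubseteq>\<^bsub>Fib R (OMap F (Prod P ?A ?A))\<^esub> Re R ?t (elt (prod_c R (obj_c F X) (obj_c F X)))"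
    by (rule R.Re_mono[OF _ _ s(1) _ s(2)]) simp_all
  then have le: "Re R ?t ?s \<sqsubseteq>\<^bsub>Fib R (OMap F (Prod P ?A ?A))\<^esub> elt (obj_c F (prod_c P X X))" unfolding e .
  have "Re (Tc0 R) (tuple (Tc0 R) (AMap (Tc1 F) (Pr1 (Tc0 P) X X)) (AMap (Tc1 F) (Pr2 (Tc0 P) X X))) ?s
    = FMap (Tc1 F) (Prod (Tc0 P) X X) \<tau>"
    by (rule T.Re_rel_image[OF X \<tau>'])
  then have "Re R ?t ?s \<sqinter>\<^bsub>Fib R (OMap F (Prod P ?A ?A))\<^esub> elt (obj_c F (prod_c P X X)) = FMap F (Prod P ?A ?A) \<tau>"
    using \<tau> p by (simp add: t)
  then have "Re R ?t ?s = FMap F (Prod P ?A ?A) \<tau>"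
    using R.meet_absorb[OF _ _ _ le] s(1) by simp
  then show ?thesis using s(1) by (intro rel_image_unique[symmetric]) simp_all
qed

lemma obj_c_unit: "A \<in> Obj P \<Longrightarrow> obj_c F (unit_c_obj P A) = unit_c_obj R (OMap F A)"
  by (simp add: obj_c_Ext unit_c_obj_def)

lemma obj_q_unit: "A \<in> Obj P \<Longrightarrow> obj_q F (unit_q_obj P A) = unit_q_obj R (OMap F A)"
  by (simp add: obj_q_Ext unit_q_obj_def rel_image_unique FMap_delta)

lemma obj_c_mult: "X \<in> Obj (Tc0 (Tc0 P)) \<Longrightarrow> mult_obj (obj_c (Tc1 F) X) = obj_c F (mult_obj X)"
  using P.TcTc_Obj[of X] by (simp add: obj_c_Ext mult_obj_def)

lemma obj_q_mult:
  assumes X: "X \<in> Obj (Tq0 (Tq0 P))"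
  shows "mult_obj (obj_q (Tq1 F) X) = obj_q F (mult_obj X)"
proof -
  interpret T: ed_doctrine "Tq0 P" by (rule P.ed_Tq0)
  have "elt X \<in> T.El (Prod (Tq0 P) (under X) (under X))" by (rule T.equivalence_rel_el[OF Tq0_ObjD(2)[OF X]])
  then show ?thesis using P.TqTq_Obj[OF X] by (simp add: obj_q_Ext mult_obj_def rel_image_Tq1)
qed

end

section \<open>The two 2-monads\<close>

lemma id_fun2_sel [simp]: "on0 id_fun2 P = P" "on1 id_fun2 F = F" "on2 id_fun2 \<theta> = \<theta>"
  by (simp_all add: id_fun2_def)

lemma comp_fun2_sel [simp]:
  "on0 (comp_fun2 S T) P = on0 S (on0 T P)" "on1 (comp_fun2 S T) F = on1 S (on1 T F)"
  "on2 (comp_fun2 S T) \<theta> = on2 S (on2 T \<theta>)"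
  by (simp_all add: comp_fun2_def)

lemmas Tc_on2_cell = lifting_two_functor.on2_cell[OF Tc_lifting, unfolded Tc_sel]
lemmas Tq_on2_cell = lifting_two_functor.on2_cell[OF Tq_lifting, unfolded Tq_sel]
lemmas Tc2_sel [simp] = lifting_two_functor.on2_sel[OF Tc_lifting, unfolded Tc_sel]
lemmas Tq2_sel [simp] = lifting_two_functor.on2_sel[OF Tq_lifting, unfolded Tq_sel]

lemma mult_arr_sel [simp]:
  "asrc (mult_arr u) = mult_obj (asrc u)" "aunder (mult_arr u) = aunder (aunder u)"
  "atgt (mult_arr u) = mult_obj (atgt u)"
  by (simp_all add: mult_arr_def)

text \<open>The monad laws are equations between retaggings, and all sides act in the same way on underlying
  arrows and on elements. They thus hold as soon as they hold on objects, where they are equations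
  between pairs.\<close>

locale lifting_two_monad = lifting_two_functor T ob
  for T :: "('o, 'a, 'p) ed_monad" and ob +
  fixes h :: "('o, 'a, 'p) ed \<Rightarrow> ('o, 'p) obj \<Rightarrow> ('o, 'p) obj"
  assumes Unit_eq: "Unit T P = mk1 P (on0 T P) (h P) (unit_arr P (h P)) (\<lambda>A \<alpha>. \<alpha>)"
    and Mult_eq: "Mult T P = mk1 (on0 T (on0 T P)) (on0 T P) mult_obj mult_arr (\<lambda>X \<gamma>. \<gamma>)"
    and Unit_retagging: "elementary_doctrine P \<Longrightarrow> retagging P (on0 T P) (Unit T P)"
    and Mult_retagging: "elementary_doctrine P \<Longrightarrow> retagging (on0 T (on0 T P)) (on0 T P) (Mult T P)"
    and Ext_elt: "elementary_doctrine P \<Longrightarrow> X \<in> Obj (on0 T P) \<Longrightarrow> Ext (under X) (elt X) = X"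
    and ob_retagging: "retagging P D F \<Longrightarrow> X \<in> Obj (on0 T P) \<Longrightarrow> ob F X = Ext (OMap F (under X)) (elt X)"
    and under_unit: "under (h P A) = A"
    and elt_unit: "elementary_doctrine P \<Longrightarrow> X \<in> Obj (on0 T P) \<Longrightarrow> elt (h (on0 T P) X) = elt X"
    and ob_unit: "cell1_in P R F \<Longrightarrow> A \<in> Obj P \<Longrightarrow> ob F (h P A) = h R (OMap F A)"
    and ob_mult: "cell1_in P R F \<Longrightarrow> X \<in> Obj (on0 T (on0 T P)) \<Longrightarrow>
      mult_obj (ob (on1 T F) X) = ob F (mult_obj X)"
begin

lemma on0_ArrD:
  assumes "elementary_doctrine P" "u \<in> Arr (on0 T P)"
  shows "asrc u \<in> Obj (on0 T P)" "atgt u \<in> Obj (on0 T P)" "aunder u \<in> Arr P"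
    "Dom P (aunder u) = under (asrc u)" "Cod P (aunder u) = under (atgt u)"
    "AExt (asrc u) (aunder u) (atgt u) = u"
  by (rule on0_ArrE[OF assms]; simp)+

lemma Unit_natural: "two_natural id_fun2 T (Unit T)"
proof (rule two_naturalI, unfold id_fun2_sel)
  fix P :: "('o, 'a, 'p) ed" assume "elementary_doctrine P"
  then show "cell1_in P (on0 T P) (Unit T P)" by (rule retaggingD(1)[OF Unit_retagging])
next
  fix P R and F :: "('o, 'a, 'p) ed1" assume F: "cell1_in P R F"
  then interpret ed_cell P R F by (rule ed_cellI)
  note U = retaggingD(1)[OF Unit_retagging[OF P.elementary_doctrine]]
  show "Unit T R \<odot> F = on1 T F \<odot> Unit T P"
    unfolding Unit_eq[of R] mk1_comp1[OF F] on1_eq Src_Tgt mk1_comp1[OF U]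
    by (rule mk1_eqI) (simp_all add: Unit_eq ob_unit[OF F] unit_arr_def under_unit)
next
  fix P R F G \<theta> A assume t: "cell2_in P R F (G :: ('o, 'a, 'p) ed1) \<theta>" and A: "A \<in> Obj P"
  from t interpret ed_cell2 P R F G \<theta> by (rule ed_cell2I)
  interpret U: ed_cell P "on0 T P" "Unit T P"
    by (rule ed_cellI[OF retaggingD(1)[OF Unit_retagging[OF F.P.elementary_doctrine]]])
  have "h P A \<in> Obj (on0 T P)" using U.functor_simps(1)[OF A] A by (simp add: Unit_eq)
  with A show "AMap (Unit T R) (Cmp \<theta> A) = Cmp (on2 T \<theta>) (OMap (Unit T P) A)"
    by (simp add: Unit_eq unit_arr_def under_unit ob_unit[OF F.cell] ob_unit[OF G.cell])
qed (simp_all add: on2_cell)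

lemma Mult_natural: "two_natural (comp_fun2 T T) T (Mult T)"
proof (rule two_naturalI, unfold comp_fun2_sel)
  fix P :: "('o, 'a, 'p) ed" assume "elementary_doctrine P"
  then show "cell1_in (on0 T (on0 T P)) (on0 T P) (Mult T P)" by (rule retaggingD(1)[OF Mult_retagging])
next
  fix P R and F :: "('o, 'a, 'p) ed1" assume F: "cell1_in P R F"
  then interpret ed_cell P R F by (rule ed_cellI)
  note P = P.elementary_doctrine
  note M = retaggingD(1)[OF Mult_retagging[OF P]]
  show "Mult T R \<odot> on1 T (on1 T F) = on1 T F \<odot> Mult T P"
    unfolding Mult_eq[of R] mk1_comp1[OF on1_cell[OF on1_cell[OF F]]]
    unfolding on1_eq[of F] Src_Tgt mk1_comp1[OF M]
    unfolding on1_eq[of F, unfolded Src_Tgt, symmetric]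
    by (rule mk1_eqI)
      (simp_all add: Mult_eq ob_mult[OF F] mult_arr_def fibre[OF elementary[OF P]]
        on0_ArrD[OF elementary[OF P]] under_Obj[OF elementary[OF P]])
next
  fix P R F G \<theta> X assume t: "cell2_in P R F (G :: ('o, 'a, 'p) ed1) \<theta>" and X: "X \<in> Obj (on0 T (on0 T P))"
  from t interpret ed_cell2 P R F G \<theta> by (rule ed_cell2I)
  note P = F.P.elementary_doctrine
  interpret M: ed_cell "on0 T (on0 T P)" "on0 T P" "Mult T P"
    by (rule ed_cellI[OF retaggingD(1)[OF Mult_retagging[OF P]]])
  interpret t: ed_cell2 "on0 T (on0 T P)" "on0 T (on0 T R)" "on1 T (on1 T F)" "on1 T (on1 T G)" "on2 T (on2 T \<theta>)"
    by (rule ed_cell2I[OF on2_cell[OF on2_cell[OF t]]])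
  have "mult_obj X \<in> Obj (on0 T P)" using M.functor_simps(1)[OF X] X by (simp add: Mult_eq)
  with X t.Cmp_simps(1)[OF X]
  show "AMap (Mult T R) (Cmp (on2 T (on2 T \<theta>)) X) = Cmp (on2 T \<theta>) (OMap (Mult T P) X)"
    by (simp add: Mult_eq mult_arr_def ob_mult[OF F.cell] ob_mult[OF G.cell] under_Obj[OF elementary[OF P]])
qed (simp_all add: on2_cell)

lemma two_monad: "two_monad T"
  unfolding two_monad_def
proof (intro conjI allI impI two_functor Unit_natural Mult_natural)
  fix P :: "('o, 'a, 'p) ed" assume P: "elementary_doctrine P"
  note TP = elementary[OF P]
  note M = Mult_retagging[OF P] and U = Unit_retagging[OF P]
  note M' = retaggingD(1)[OF Mult_retagging[OF TP]] and U' = retaggingD(1)[OF Unit_retagging[OF TP]]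
  note o = ob_retagging[OF M] ob_retagging[OF U]
  note s = mult_arr_def unit_arr_def under_Obj[OF P] under_Obj[OF TP] under_Obj[OF elementary[OF TP]]
    fibre[OF P] fibre[OF TP] fibre[OF elementary[OF TP]] on0_ArrD[OF P] on0_ArrD[OF TP]
    on0_ArrD[OF elementary[OF TP]] on0_sel[OF P] Unit_eq Mult_eq
  show "Mult T P \<odot> Mult T (on0 T P) = Mult T P \<odot> on1 T (Mult T P)"
    unfolding Mult_eq[of P] mk1_comp1[OF M'] mk1_comp1[OF on1_cell[OF retaggingD(1)[OF M], unfolded Mult_eq]]
    by (rule mk1_eqI) (simp_all add: o[unfolded Mult_eq] s mult_obj_def)
  show "Mult T P \<odot> Unit T (on0 T P) = id1 (on0 T P)"
    unfolding Mult_eq[of P] mk1_comp1[OF U'] id1_def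
    by (rule mk1_eqI) (simp_all add: s mult_obj_def under_unit elt_unit[OF P] Ext_elt[OF P])
  show "Mult T P \<odot> on1 T (Unit T P) = id1 (on0 T P)"
    unfolding Mult_eq[of P] mk1_comp1[OF on1_cell[OF retaggingD(1)[OF U]]] id1_def
    by (rule mk1_eqI) (simp_all add: o[unfolded Unit_eq] s mult_obj_def under_unit Ext_elt[OF P])
qed

end

lemma AExt_Tc0 [simp]:
  assumes "u \<in> Arr (Tc0 P)"
  shows "AExt (Ext (under (asrc u)) (elt (asrc u))) (aunder u) (Ext (under (atgt u)) (elt (atgt u))) = u"
  using Tc0_ObjD(3)[OF Tc0_ArrD(1)[OF assms]] Tc0_ObjD(3)[OF Tc0_ArrD(2)[OF assms]] assms AExt_aunder[of u P]
  by simp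

lemma obj_c_retagging:
  "retagging P D F \<Longrightarrow> X \<in> Obj (Tc0 P) \<Longrightarrow> obj_c F X = Ext (OMap F (under X)) (elt X)"
  by (simp add: obj_c_Ext retaggingD(2))

lemma AExt_Tq0 [simp]:
  assumes "u \<in> Arr (Tq0 P)"
  shows "AExt (Ext (under (asrc u)) (elt (asrc u))) (aunder u) (Ext (under (atgt u)) (elt (atgt u))) = u"
  using Tq0_ObjD(4)[OF Tq0_ArrD(1)[OF assms]] Tq0_ObjD(4)[OF Tq0_ArrD(2)[OF assms]] assms AExt_aunder[of u P]
  by simp

lemma obj_q_retagging:
  "retagging P D F \<Longrightarrow> X \<in> Obj (Tq0 P) \<Longrightarrow> obj_q F X = Ext (OMap F (under X)) (elt X)"
  by (simp add: obj_q_Ext rel_image_retagging)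

lemma Tc_two_monad: "two_monad (Tc :: ('o, 'a, 'p) ed_monad)"
proof (rule lifting_two_monad.two_monad[OF lifting_two_monad.intro[OF Tc_lifting]], unfold_locales, unfold Tc_sel)
  fix P :: "('o, 'a, 'p) ed" assume "elementary_doctrine P"
  then interpret ed_doctrine P by (rule ed_doctrineI)
  show "retagging P (Tc0 P) (mk1 P (Tc0 P) (unit_c_obj P) (unit_arr P (unit_c_obj P)) (\<lambda>A \<alpha>. \<alpha>))"
    "retagging (Tc0 (Tc0 P)) (Tc0 P) (mk1 (Tc0 (Tc0 P)) (Tc0 P) mult_obj mult_arr (\<lambda>X \<gamma>. \<gamma>))"
    by (rule unit_c_retagging mult_c_retagging)+
  fix X assume "X \<in> Obj (Tc0 P)"
  then show "elt (unit_c_obj (Tc0 P) X) = elt X" by simp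
qed (auto simp: obj_c_retagging intro: ed_cell.obj_c_unit ed_cell.obj_c_mult ed_cellI)

lemma Tq_two_monad: "two_monad (Tq :: ('o, 'a, 'p) ed_monad)"
proof (rule lifting_two_monad.two_monad[OF lifting_two_monad.intro[OF Tq_lifting]], unfold_locales, unfold Tq_sel)
  fix P :: "('o, 'a, 'p) ed" assume "elementary_doctrine P"
  then interpret ed_doctrine P by (rule ed_doctrineI)
  show "retagging P (Tq0 P) (mk1 P (Tq0 P) (unit_q_obj P) (unit_arr P (unit_q_obj P)) (\<lambda>A \<alpha>. \<alpha>))"
    "retagging (Tq0 (Tq0 P)) (Tq0 P) (mk1 (Tq0 (Tq0 P)) (Tq0 P) mult_obj mult_arr (\<lambda>X \<gamma>. \<gamma>))"
    by (rule unit_q_retagging mult_q_retagging)+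
  fix X assume "X \<in> Obj (Tq0 P)"
  then show "elt (unit_q_obj (Tq0 P) X) = elt X" by (simp add: Tq0_delta)
qed (auto simp: obj_q_retagging intro: ed_cell.obj_q_unit ed_cell.obj_q_mult ed_cellI)

section \<open>The distributive law\<close>

text \<open>The object \<open>((A, \<rho>), \<alpha>)\<close> is a subobject of a quotient, with \<open>\<alpha>\<close> an element that descends along
  \<open>\<rho>\<close>. It goes to the quotient of the subobject \<open>(A, \<alpha>)\<close> by the restriction \<open>\<rho> \<sqinter> (\<alpha> \<times> \<alpha>)\<close>. The object
  \<open>(A, \<alpha>)\<close> is obtained with \<open>mult_obj\<close>, which forgets the middle layer of a pair of pairs.\<close>

definition law_obj :: "('o, 'a, 'p) ed \<Rightarrow> ('o, 'p) obj \<Rightarrow> ('o, 'p) obj" where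
  "law_obj P X = (let B = mult_obj X; A = under B in
     Ext B (elt (under X) \<sqinter>\<^bsub>Fib P (Prod P A A)\<^esub> elt (prod_c P B B)))"

definition law_arr :: "('o, 'a, 'p) ed \<Rightarrow> ('o, 'a, 'p) arr \<Rightarrow> ('o, 'a, 'p) arr" where
  "law_arr P u = AExt (law_obj P (asrc u)) (mult_arr u) (law_obj P (atgt u))"

definition law :: "('o, 'a, 'p) ed \<Rightarrow> ('o, 'a, 'p) ed1" where
  "law P = mk1 (Tc0 (Tq0 P)) (Tq0 (Tc0 P)) (law_obj P) (law_arr P) (\<lambda>X \<gamma>. \<gamma>)"

lemma law_obj_sel [simp]:
  "under (law_obj P X) = mult_obj X"
  "elt (law_obj P X) = elt (under X) \<sqinter>\<^bsub>Fib P (Prod P (under (under X)) (under (under X)))\<^esub> elt (prod_c P (mult_obj X) (mult_obj X))"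
  by (simp_all add: law_obj_def Let_def)

lemma law_obj_Ext: "law_obj P X = Ext (mult_obj X) (elt (law_obj P X))"
  by (simp add: law_obj_def Let_def)

lemma le_Fib_Tc0: "le (Fib (Tc0 P) X) = le (Fib P (under X))"
  by simp

context ed_doctrine
begin

lemma TcTq_Obj:
  assumes "X \<in> Obj (Tc0 (Tq0 P))"
  shows "under X \<in> Obj (Tq0 P)" "elt X \<in> Des P (under (under X)) (elt (under X))"
    "elt X \<in> El (under (under X))" "mult_obj X \<in> Obj (Tc0 P)"
  using Tc0_ObjD(1,2)[OF assms] by (simp_all add: mult_obj_def Des_el)

text \<open>Restricting \<open>\<rho>\<close> makes no difference to elements of the subobject: for arrows \<open>f, g\<close> from
  \<open>(Y, \<eta>)\<close> to \<open>(A, \<alpha>)\<close> and \<open>z \<sqsubseteq> \<eta>\<close>, both \<open>f\<close> and \<open>g\<close> satisfy \<open>\<alpha>\<close> at \<open>z\<close>. All properties of the restricted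
  relation in \<open>P\<^sub>c\<close> are hence those of \<open>\<rho>\<close> in \<open>P\<close>.\<close>

lemma restrict_apply:
  assumes f: "AExt Y f X \<in> Arr (Tc0 P)" and g: "AExt Y g X \<in> Arr (Tc0 P)"
    and \<rho>: "\<rho> \<in> El (Prod P (under X) (under X))" and z: "z \<in> El (under Y)" "z \<sqsubseteq>\<^bsub>Fib P (under Y)\<^esub> elt Y"
  shows "z \<sqsubseteq>\<^bsub>Fib P (under Y)\<^esub> Re (Tc0 P) (tuple (Tc0 P) (AExt Y f X) (AExt Y g X))
      (\<rho> \<sqinter>\<^bsub>Fib P (Prod P (under X) (under X))\<^esub> elt (prod_c P X X)) \<longleftrightarrow>
    z \<sqsubseteq>\<^bsub>Fib P (under Y)\<^esub> Re P (tuple P f g) \<rho>"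
proof -
  have [simp]: "Y \<in> Obj (Tc0 P)" "X \<in> Obj (Tc0 P)" "f \<in> Arr P" "Dom P f = under Y" "Cod P f = under X"
    "g \<in> Arr P" "Dom P g = under Y" "Cod P g = under X" using f g by (simp_all add: Tc0_Arr)
  note [simp] = \<rho> z
  have "z \<sqsubseteq>\<^bsub>Fib P (under Y)\<^esub> Re P f (elt X)" "z \<sqsubseteq>\<^bsub>Fib P (under Y)\<^esub> Re P g (elt X)"
    using f g le_trans[OF z(2), of "Re P f (elt X)"] le_trans[OF z(2), of "Re P g (elt X)"] by (simp_all add: Tc0_Arr)
  then show ?thesis by (simp add: Tc0_tuple(1)[OF f g])
qed

lemma elt_law_obj_El:
  assumes X: "X \<in> Obj (Tc0 (Tq0 P))"
  shows "elt (law_obj P X) \<in> carrier (Fib (Tc0 P) (prod_c P (mult_obj X) (mult_obj X)))"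
proof -
  note [simp] = TcTq_Obj[OF X]
  show ?thesis by (simp add: meet_le)
qed

lemma law_obj_Obj:
  assumes X: "X \<in> Obj (Tc0 (Tq0 P))"
  shows "law_obj P X \<in> Obj (Tq0 (Tc0 P))"
proof -
  interpret c: ed_doctrine "Tc0 P" by (rule ed_Tc0)
  note [simp] = TcTq_Obj[OF X]
  let ?B = "mult_obj X" and ?\<rho> = "elt (under X)"
  let ?A = "under ?B"
  let ?s = "?\<rho> \<sqinter>\<^bsub>Fib P (Prod P ?A ?A)\<^esub> elt (prod_c P ?B ?B)"
  have el: "?\<rho> \<in> El (Prod P ?A ?A)" by simp
  note ra = restrict_apply[OF _ _ el]
  note e = Tq0_ObjD(2)[OF TcTq_Obj(1)[OF X]]
  have s: "?s \<in> c.El (Prod (Tc0 P) ?B ?B)" using elt_law_obj_El[OF X] by simp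
  have "equivalence_rel (Tc0 P) ?B ?s"
  proof (rule c.equivalence_relI)
    show "c.reflexive_on ?B ?s"
      unfolding c.reflexive_on_def
    proof (intro conjI s ballI impI)
      fix u assume u: "u \<in> Arr (Tc0 P)" "Cod (Tc0 P) u = ?B"
      then obtain Y f where u': "u = AExt Y f ?B" using Tc0_Arr_AExt by fastforce
      note uu = u(1)[unfolded u']
      have [simp]: "Y \<in> Obj (Tc0 P)" "f \<in> Arr P" "Dom P f = under Y" "Cod P f = ?A"
        using uu by (simp_all add: Tc0_Arr)
      have "elt Y \<sqsubseteq>\<^bsub>Fib P (under Y)\<^esub> Re (Tc0 P) (tuple (Tc0 P) u u) ?s"
        unfolding u' by (subst ra[OF uu uu]) simp_all
      moreover have "Re (Tc0 P) (tuple (Tc0 P) u u) ?s \<in> c.El Y"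
        by (simp add: u' Tc0_tuple(1)[OF uu uu] meet_le)
      ultimately show "Re (Tc0 P) (tuple (Tc0 P) u u) ?s = \<top>\<^bsub>Fib (Tc0 P) (Dom (Tc0 P) u)\<^esub>"
        unfolding u' Tc0_sel(1) arr.sel Tc0_fibre(3)[OF \<open>Y \<in> _\<close>]
        by (intro le_antisym[of "under Y"]) simp_all
    qed
  next
    fix z Y u v assume le: "z \<sqsubseteq>\<^bsub>Fib (Tc0 P) Y\<^esub> Re (Tc0 P) (tuple (Tc0 P) u v) ?s" and z: "z \<in> c.El Y"
      and u: "u \<in> Arr (Tc0 P)" and v: "v \<in> Arr (Tc0 P)"
      and ty: "Dom (Tc0 P) u = Y" "Dom (Tc0 P) v = Y" "Cod (Tc0 P) u = ?B" "Cod (Tc0 P) v = ?B"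
    obtain f where u': "u = AExt Y f ?B" using Tc0_Arr_AExt[OF u] ty by auto
    obtain g where v': "v = AExt Y g ?B" using Tc0_Arr_AExt[OF v] ty by auto
    note uu = u[unfolded u'] and vv = v[unfolded v']
    have a: "f \<in> Arr P" "Dom P f = under Y" "Cod P f = ?A" "g \<in> Arr P" "Dom P g = under Y" "Cod P g = ?A"
      using uu vv by (simp_all add: Tc0_Arr)
    have z': "z \<in> El (under Y)" "z \<sqsubseteq>\<^bsub>Fib P (under Y)\<^esub> elt Y" using z by simp_all
    have "z \<sqsubseteq>\<^bsub>Fib P (under Y)\<^esub> Re P (tuple P f g) ?\<rho>"
      using le ra[OF uu vv z'] by (simp only: u' v' le_Fib_Tc0)
    then have "z \<sqsubseteq>\<^bsub>Fib P (under Y)\<^esub> Re P (tuple P g f) ?\<rho>"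
      by (rule equivalence_rel_sym[OF e]) (use a z' in simp_all)
    then show "z \<sqsubseteq>\<^bsub>Fib (Tc0 P) Y\<^esub> Re (Tc0 P) (tuple (Tc0 P) v u) ?s"
      using ra[OF vv uu z'] by (simp only: u' v' le_Fib_Tc0)
  next
    fix z Y u v w assume le: "z \<sqsubseteq>\<^bsub>Fib (Tc0 P) Y\<^esub> Re (Tc0 P) (tuple (Tc0 P) u v) ?s"
      "z \<sqsubseteq>\<^bsub>Fib (Tc0 P) Y\<^esub> Re (Tc0 P) (tuple (Tc0 P) v w) ?s" and z: "z \<in> c.El Y"
      and u: "u \<in> Arr (Tc0 P)" and v: "v \<in> Arr (Tc0 P)" and w: "w \<in> Arr (Tc0 P)"
      and ty: "Dom (Tc0 P) u = Y" "Dom (Tc0 P) v = Y" "Dom (Tc0 P) w = Y"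
        "Cod (Tc0 P) u = ?B" "Cod (Tc0 P) v = ?B" "Cod (Tc0 P) w = ?B"
    obtain f where u': "u = AExt Y f ?B" using Tc0_Arr_AExt[OF u] ty by auto
    obtain g where v': "v = AExt Y g ?B" using Tc0_Arr_AExt[OF v] ty by auto
    obtain h where w': "w = AExt Y h ?B" using Tc0_Arr_AExt[OF w] ty by auto
    note uu = u[unfolded u'] and vv = v[unfolded v'] and ww = w[unfolded w']
    have a: "f \<in> Arr P" "Dom P f = under Y" "Cod P f = ?A" "g \<in> Arr P" "Dom P g = under Y" "Cod P g = ?A"
      "h \<in> Arr P" "Dom P h = under Y" "Cod P h = ?A"
      using uu vv ww by (simp_all add: Tc0_Arr)
    have z': "z \<in> El (under Y)" "z \<sqsubseteq>\<^bsub>Fib P (under Y)\<^esub> elt Y" using z by simp_all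
    have l: "z \<sqsubseteq>\<^bsub>Fib P (under Y)\<^esub> Re P (tuple P f g) ?\<rho>" "z \<sqsubseteq>\<^bsub>Fib P (under Y)\<^esub> Re P (tuple P g h) ?\<rho>"
      using le ra[OF uu vv z'] ra[OF vv ww z'] by (simp_all only: u' v' w' le_Fib_Tc0)
    have "z \<sqsubseteq>\<^bsub>Fib P (under Y)\<^esub> Re P (tuple P f h) ?\<rho>"
      by (rule equivalence_rel_trans[OF e l]) (use a z' in simp_all)
    then show "z \<sqsubseteq>\<^bsub>Fib (Tc0 P) Y\<^esub> Re (Tc0 P) (tuple (Tc0 P) u w) ?s"
      using ra[OF uu ww z'] by (simp only: u' w' le_Fib_Tc0)
  qed simp
  then show ?thesis by (simp add: law_obj_def Let_def)
qed

lemma law_arr_Arr: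
  assumes u: "u \<in> Arr (Tc0 (Tq0 P))"
  shows "law_arr P u \<in> Arr (Tq0 (Tc0 P))" "mult_arr u \<in> Arr (Tc0 P)"
proof -
  interpret c: ed_doctrine "Tc0 P" by (rule ed_Tc0)
  interpret L: lifted_category P "Tc0 P" by (rule Tc0_lifted)
  let ?X = "asrc u" and ?Y = "atgt u" and ?f = "aunder (aunder u)"
  note X = Tc0_ArrD(1)[OF u] and Y = Tc0_ArrD(2)[OF u]
  note [simp] = TcTq_Obj[OF X] TcTq_Obj[OF Y] law_obj_Obj[OF X] law_obj_Obj[OF Y]
  have au: "aunder u \<in> Arr (Tq0 P)" by (rule Tc0_ArrD(3)[OF u])
  have d [simp]: "asrc (aunder u) = under ?X" "atgt (aunder u) = under ?Y"
    using Tc0_ArrD(4,5)[OF u] by simp_all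
  have f: "AExt (under ?X) ?f (under ?Y) \<in> Arr (Tq0 P)" using Tq0_ArrD(6)[OF au] by simp
  have [simp]: "?f \<in> Arr P" "Dom P ?f = under (under ?X)" "Cod P ?f = under (under ?Y)" using f by (simp_all add: Tq0_Arr)
  have le: "elt ?X \<sqsubseteq>\<^bsub>Fib P (under (under ?X))\<^esub> Re P ?f (elt ?Y)"
    using Tc0_Arr_le[OF u] by (simp add: Re_Tq0)
  then have m: "AExt (mult_obj ?X) ?f (mult_obj ?Y) \<in> Arr (Tc0 P)" by (simp add: Tc0_Arr)
  then show m': "mult_arr u \<in> Arr (Tc0 P)" by (simp add: mult_arr_def)
  have "AExt (law_obj P ?X) (mult_arr u) (law_obj P ?Y) \<in> Arr (Tq0 (Tc0 P))"
  proof (rule c.Tq0_ArrI)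
    fix z V h k assume le: "z \<sqsubseteq>\<^bsub>Fib (Tc0 P) V\<^esub> Re (Tc0 P) (tuple (Tc0 P) h k) (elt (law_obj P ?X))"
      and z: "z \<in> c.El V" and hk: "h \<in> Arr (Tc0 P)" "k \<in> Arr (Tc0 P)"
      and ty: "Dom (Tc0 P) h = V" "Dom (Tc0 P) k = V" "Cod (Tc0 P) h = under (law_obj P ?X)" "Cod (Tc0 P) k = under (law_obj P ?X)"
    obtain a where h': "h = AExt V a (mult_obj ?X)" using Tc0_Arr_AExt[OF hk(1)] ty by auto
    obtain b where k': "k = AExt V b (mult_obj ?X)" using Tc0_Arr_AExt[OF hk(2)] ty by auto
    note hh = hk(1)[unfolded h'] and kk = hk(2)[unfolded k']
    have z': "z \<in> El (under V)" "z \<sqsubseteq>\<^bsub>Fib P (under V)\<^esub> elt V" using z by simp_all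
    have ab: "a \<in> Arr P" "b \<in> Arr P" "Dom P a = under V" "Dom P b = under V" "Cod P a = under (under ?X)" "Cod P b = under (under ?X)"
      using hh kk by (simp_all add: Tc0_Arr)
    have "z \<sqsubseteq>\<^bsub>Fib P (under V)\<^esub> Re P (tuple P a b) (elt (under ?X))"
      using le restrict_apply[OF hh kk _ z', of "elt (under ?X)"] by (simp add: h' k' del: prod_c_sel)
    from Tq0_Arr_apply[OF f this] ab z'
    have "z \<sqsubseteq>\<^bsub>Fib P (under V)\<^esub> Re P (tuple P (Comp P ?f a) (Comp P ?f b)) (elt (under ?Y))" by simp
    then show "z \<sqsubseteq>\<^bsub>Fib (Tc0 P) V\<^esub> Re (Tc0 P) (tuple (Tc0 P) (Comp (Tc0 P) (mult_arr u) h) (Comp (Tc0 P) (mult_arr u) k)) (elt (law_obj P ?Y))"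
      using restrict_apply[OF L.Comp_D[OF hh m] L.Comp_D[OF kk m] _ z', of "elt (under ?Y)"]
      by (simp add: h' k' mult_arr_def del: prod_c_sel)
  qed (use m' in \<open>simp_all add: mult_arr_def\<close>)
  then show "law_arr P u \<in> Arr (Tq0 (Tc0 P))" by (simp add: law_arr_def)
qed

lemma elt_prod_c_Tq0:
  assumes X: "X \<in> Obj (Tc0 (Tq0 P))" and Y: "Y \<in> Obj (Tc0 (Tq0 P))"
  shows "elt (prod_c (Tq0 P) X Y) = elt (prod_c P (mult_obj X) (mult_obj Y))"
    and "elt (prod_c P (mult_obj X) (mult_obj Y)) \<in> Des P (Prod P (under (under X)) (under (under Y))) (elt (prod_q P (under X) (under Y)))"
proof -
  interpret q: ed_doctrine "Tq0 P" by (rule ed_Tq0)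
  let ?X = "under X" and ?Y = "under Y"
  note [simp] = TcTq_Obj[OF X] TcTq_Obj[OF Y]
  have p: "AExt (prod_q P ?X ?Y) (Pr1 P (under ?X) (under ?Y)) ?X \<in> Arr (Tq0 P)"
    "AExt (prod_q P ?X ?Y) (Pr2 P (under ?X) (under ?Y)) ?Y \<in> Arr (Tq0 P)"
    using q.prod_simps(2,3)[of ?X ?Y] by simp_all
  have d: "Re P (Pr1 P (under ?X) (under ?Y)) (elt X) \<in> Des P (Prod P (under ?X) (under ?Y)) (elt (prod_q P ?X ?Y))"
    "Re P (Pr2 P (under ?X) (under ?Y)) (elt Y) \<in> Des P (Prod P (under ?X) (under ?Y)) (elt (prod_q P ?X ?Y))"
    using Des_Re[OF p(1)] Des_Re[OF p(2)] by simp_all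
  show "elt (prod_c (Tq0 P) X Y) = elt (prod_c P (mult_obj X) (mult_obj Y))"
    unfolding prod_c_sel(2) Tq0_sel(5-8) using Tq0_fibre(2)[of "prod_q P ?X ?Y"] d by simp
  show "elt (prod_c P (mult_obj X) (mult_obj Y)) \<in> Des P (Prod P (under ?X) (under ?Y)) (elt (prod_q P ?X ?Y))"
    using Des_meet_top(2)[OF _ _ d] elt_prod_q_El[of ?X ?Y] by simp
qed

text \<open>Both sides are the product of the subobjects with a meet of the same four conditions: \<open>\<rho>\<close>
  and \<open>\<sigma>\<close> on the respective components, \<open>\<alpha> \<times> \<beta>\<close> on either argument.\<close>

lemma law_prod:
  assumes X: "X \<in> Obj (Tc0 (Tq0 P))" and Y: "Y \<in> Obj (Tc0 (Tq0 P))"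
  shows "law_obj P (prod_c (Tq0 P) X Y) = prod_q (Tc0 P) (law_obj P X) (law_obj P Y)"
    and "mult_obj (prod_c (Tq0 P) X Y) = prod_c P (mult_obj X) (mult_obj Y)"
proof -
  interpret c: ed_doctrine "Tc0 P" by (rule ed_Tc0)
  note [simp] = TcTq_Obj[OF X] TcTq_Obj[OF Y]
  let ?X = "mult_obj X" and ?Y = "mult_obj Y"
  let ?A = "under ?X" and ?B = "under ?Y"
  let ?M = "prod_c P ?X ?Y"
  show m: "mult_obj (prod_c (Tq0 P) X Y) = ?M"
  proof -
    have "mult_obj (prod_c (Tq0 P) X Y) = Ext (Prod P ?A ?B) (elt ?M)"
      unfolding mult_obj_def[of "prod_c (Tq0 P) X Y"] elt_prod_c_Tq0(1)[OF X Y] by simp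
    also have "\<dots> = ?M" by (simp add: prod_c_def Let_def)
    finally show ?thesis .
  qed
  have p: "AExt ?M (Pr1 P ?A ?B) ?X \<in> Arr (Tc0 P)" "AExt ?M (Pr2 P ?A ?B) ?Y \<in> Arr (Tc0 P)"
    using c.prod_simps(2,3)[of ?X ?Y] by simp_all
  let ?Q = "Prod P (Prod P ?A ?B) (Prod P ?A ?B)"
  have el: "elt (law_obj P (prod_c (Tq0 P) X Y)) = elt (prod_q (Tc0 P) (law_obj P X) (law_obj P Y))"
    unfolding law_obj_sel(2) m
    by (simp add: prod_q_sel(2) Tc0_cross(1)[OF p(1) p(1), simplified] Tc0_cross(1)[OF p(2) p(2), simplified]
        meet_le cross_tuple, rule eqI[of ?Q]) auto
  have "prod_q (Tc0 P) (law_obj P X) (law_obj P Y) = Ext ?M (elt (prod_q (Tc0 P) (law_obj P X) (law_obj P Y)))"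
    by (simp add: prod_q_def Let_def)
  then show "law_obj P (prod_c (Tq0 P) X Y) = prod_q (Tc0 P) (law_obj P X) (law_obj P Y)"
    using law_obj_Ext[of P "prod_c (Tq0 P) X Y"] unfolding m el by (simp only:)
qed

text \<open>The heart of the distributive law: subobjects of a quotient are quotients of subobjects, with the
  same elements. For \<open>\<gamma> \<sqsubseteq> \<alpha>\<close>, descent along \<open>\<rho> \<sqinter> (\<alpha> \<times> \<alpha>)\<close> is descent along \<open>\<rho>\<close>: given \<open>\<gamma>(a)\<close>
  and \<open>\<rho>(a, a')\<close> there is \<open>\<alpha>(a)\<close>, and since \<open>\<alpha>\<close> descends also \<open>\<alpha>(a')\<close>, so that \<open>a\<close> and \<open>a'\<close> are
  related by the restriction.\<close>

lemma Des_law_obj: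
  assumes X: "X \<in> Obj (Tc0 (Tq0 P))"
  shows "Des (Tc0 P) (mult_obj X) (elt (law_obj P X)) =
    {\<gamma> \<in> Des P (under (under X)) (elt (under X)). \<gamma> \<sqsubseteq>\<^bsub>Fib P (under (under X))\<^esub> elt X}" (is "?L = ?R")
proof -
  interpret c: ed_doctrine "Tc0 P" by (rule ed_Tc0)
  note T = TcTq_Obj[OF X]
  note [simp] = T
  let ?X = "mult_obj X" and ?\<rho> = "elt (under X)"
  let ?A = "under (under X)"
  let ?AA = "Prod P ?A ?A"
  have p: "AExt (prod_c P ?X ?X) (Pr1 P ?A ?A) ?X \<in> Arr (Tc0 P)" "AExt (prod_c P ?X ?X) (Pr2 P ?A ?A) ?X \<in> Arr (Tc0 P)"
    using c.prod_simps(2,3)[of ?X ?X] by simp_all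
  have el: "elt (law_obj P X) \<in> c.El (Prod (Tc0 P) ?X ?X)" using elt_law_obj_El[OF X] by simp
  show ?thesis
  proof (rule Set.equalityI; rule subsetI)
    fix \<gamma> assume \<gamma>: "\<gamma> \<in> ?L"
    then have le [simp]: "\<gamma> \<in> El ?A" "\<gamma> \<sqsubseteq>\<^bsub>Fib P ?A\<^esub> elt X" using c.Des_el[OF \<gamma>] by simp_all
    have "\<gamma> \<in> Des P ?A ?\<rho>"
    proof (rule DesI)
      fix z assume z [simp]: "z \<in> El ?AA" "z \<sqsubseteq>\<^bsub>Fib P ?AA\<^esub> Re P (Pr1 P ?A ?A) \<gamma>" "z \<sqsubseteq>\<^bsub>Fib P ?AA\<^esub> ?\<rho>"
      have 1: "z \<sqsubseteq>\<^bsub>Fib P ?AA\<^esub> Re P (Pr1 P ?A ?A) (elt X)"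
        by (rule Re_le_apply[OF le(2) z(2)]) simp_all
      have 2: "z \<sqsubseteq>\<^bsub>Fib P ?AA\<^esub> Re P (Pr2 P ?A ?A) (elt X)"
        by (rule DesD[OF T(2) 1]) simp_all
      have "z \<sqsubseteq>\<^bsub>Fib (Tc0 P) (prod_c P ?X ?X)\<^esub> Re (Tc0 P) (AExt (prod_c P ?X ?X) (Pr2 P ?A ?A) ?X) \<gamma>"
        by (rule c.DesD[OF \<gamma> _ _ _ el p]) (use 1 2 in \<open>simp_all add: Tc0_tuple(1)[OF p, simplified] meet_le\<close>)
      then show "z \<sqsubseteq>\<^bsub>Fib P ?AA\<^esub> Re P (Pr2 P ?A ?A) \<gamma>" using 1 2 by simp
    qed simp_all
    with le show "\<gamma> \<in> ?R" by simp
  next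
    fix \<gamma> assume "\<gamma> \<in> ?R"
    then have \<gamma>: "\<gamma> \<in> Des P ?A ?\<rho>" and [simp]: "\<gamma> \<sqsubseteq>\<^bsub>Fib P ?A\<^esub> elt X" by simp_all
    from \<gamma> have [simp]: "\<gamma> \<in> El ?A" by (rule Des_el)
    show "\<gamma> \<in> ?L"
    proof (rule c.DesI)
      show "\<gamma> \<in> c.El ?X" "elt (law_obj P X) \<in> c.El (Prod (Tc0 P) ?X ?X)" using el by simp_all
      fix z assume z: "z \<in> c.El (Prod (Tc0 P) ?X ?X)"
        "z \<sqsubseteq>\<^bsub>Fib (Tc0 P) (Prod (Tc0 P) ?X ?X)\<^esub> Re (Tc0 P) (Pr1 (Tc0 P) ?X ?X) \<gamma>"
        "z \<sqsubseteq>\<^bsub>Fib (Tc0 P) (Prod (Tc0 P) ?X ?X)\<^esub> elt (law_obj P X)"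
      then have z': "z \<in> El ?AA" "z \<sqsubseteq>\<^bsub>Fib P ?AA\<^esub> Re P (Pr1 P ?A ?A) \<gamma>" "z \<sqsubseteq>\<^bsub>Fib P ?AA\<^esub> ?\<rho>" by simp_all
      have "z \<sqsubseteq>\<^bsub>Fib P ?AA\<^esub> Re P (Pr2 P ?A ?A) \<gamma>"
        by (rule DesD[OF \<gamma> z'(2)]) (use z' in simp_all)
      then show "z \<sqsubseteq>\<^bsub>Fib (Tc0 P) (Prod (Tc0 P) ?X ?X)\<^esub> Re (Tc0 P) (Pr2 (Tc0 P) ?X ?X) \<gamma>"
        using z by simp
    qed simp
  qed
qed

lemma law_retagging: "retagging (Tc0 (Tq0 P)) (Tq0 (Tc0 P)) (law P)"
  unfolding law_def
proof -
  interpret c: ed_doctrine "Tc0 P" by (rule ed_Tc0)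
  interpret q: ed_doctrine "Tq0 P" by (rule ed_Tq0)
  show "retagging (Tc0 (Tq0 P)) (Tq0 (Tc0 P)) (mk1 (Tc0 (Tq0 P)) (Tq0 (Tc0 P)) (law_obj P) (law_arr P) (\<lambda>X \<gamma>. \<gamma>))"
  proof (rule lifted_retagging[where U = mult_arr, OF q.Tc0_elementary c.Tq0_elementary c.Tq0_lifted])
    fix X assume X: "X \<in> Obj (Tc0 (Tq0 P))"
    note [simp] = TcTq_Obj[OF X]
    show "Fib (Tc0 (Tq0 P)) X = Fib (Tq0 (Tc0 P)) (law_obj P X)"
      by (simp add: Des_law_obj[OF X, simplified])
    have "elt (under X) \<in> Des P (Prod P (under (under X)) (under (under X))) (elt (prod_q P (under X) (under X)))"
      using q.equivalence_rel_el[of "under X" "delta (Tq0 P) (under X)"] q.delta_equivalence_rel[of "under X"] by (simp add: Tq0_delta)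
    from Des_infsl(2)[OF _ _ this elt_prod_c_Tq0(2)[OF X X]] elt_prod_q_El[of "under X" "under X"]
    show "delta (Tc0 (Tq0 P)) X = delta (Tq0 (Tc0 P)) (law_obj P X)"
      unfolding q.Tc0_delta[OF X] Tq0_delta[OF TcTq_Obj(1)[OF X]] c.Tq0_delta[OF law_obj_Obj[OF X]] elt_prod_c_Tq0(1)[OF X X] law_obj_sel(2)
      by (simp del: prod_c_sel(2))
  next
    fix u \<gamma> assume u: "u \<in> Arr (Tc0 (Tq0 P))" and \<gamma>: "\<gamma> \<in> carrier (Fib (Tc0 (Tq0 P)) (Cod (Tc0 (Tq0 P)) u))"
    note X = Tc0_ArrD(1)[OF u]
    note [simp] = TcTq_Obj[OF X] Tc0_ArrD(3)[OF u]
    have d: "asrc (aunder u) = under (asrc u)" "atgt (aunder u) = under (atgt u)"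
      using Tc0_ArrD(4,5)[OF u] by simp_all
    have "Re P (aunder (aunder u)) \<gamma> \<in> Des P (under (under (asrc u))) (elt (under (asrc u)))"
      using Des_Re[OF Tq0_ArrD(6)[OF Tc0_ArrD(3)[OF u]]] \<gamma> by (simp add: d)
    then show "Re (Tc0 (Tq0 P)) u \<gamma> = Re (Tq0 (Tc0 P)) (law_arr P u) \<gamma>"
      by (simp add: Re_Tc0 Re_Tq0 law_arr_def mult_arr_def)
  qed (use law_arr_Arr(1) in \<open>simp_all add: law_obj_Obj law_prod, simp_all add: law_arr_def mult_arr_def law_prod\<close>)
qed

end

lemma (in ed_cell) mult_obj_c_Tq1:
  "X \<in> Obj (Tc0 (Tq0 P)) \<Longrightarrow> mult_obj (obj_c (Tq1 F) X) = obj_c F (mult_obj X)"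
  using P.TcTq_Obj[of X] by (simp add: mult_obj_def obj_c_Ext)

text \<open>A 1-cell preserves meets and reindexing, so the image of \<open>\<rho> \<sqinter> (\<alpha> \<times> \<alpha>)\<close> is the restriction of the
  image of \<open>\<rho>\<close> to the image of \<open>\<alpha>\<close>.\<close>

lemma (in ed_cell) law_obj_natural:
  assumes X: "X \<in> Obj (Tc0 (Tq0 P))"
  shows "law_obj R (obj_c (Tq1 F) X) = obj_q (Tc1 F) (law_obj P X)"
proof -
  note [simp] = P.TcTq_Obj[OF X]
  let ?B = "mult_obj X" and ?\<rho> = "elt (under X)"
  let ?A = "under (under X)"
  have s: "elt (law_obj P X) \<in> P.El (Prod P ?A ?A)"
    "elt (law_obj P X) \<sqsubseteq>\<^bsub>Fib P (Prod P ?A ?A)\<^esub> elt (prod_c P ?B ?B)"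
    using P.elt_law_obj_El[OF X] by simp_all
  note m = mult_obj_c_Tq1[OF X]
  have "rel_image F ?A (elt (law_obj P X)) =
    rel_image F ?A ?\<rho> \<sqinter>\<^bsub>Fib R (Prod R (OMap F ?A) (OMap F ?A))\<^esub> elt (prod_c R (obj_c F ?B) (obj_c F ?B))"
    by (rule rel_image_unique) (simp_all add: Re_rel_image del: R.tuple_comp)
  then have "obj_q (Tc1 F) (law_obj P X) = Ext (obj_c F ?B)
    (rel_image F ?A ?\<rho> \<sqinter>\<^bsub>Fib R (Prod R (OMap F ?A) (OMap F ?A))\<^esub> elt (prod_c R (obj_c F ?B) (obj_c F ?B)))"
    using rel_image_Tc1[of ?B "elt (law_obj P X)"] s by (simp add: obj_q_Ext del: law_obj_sel(2) prod_c_sel(2))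
  then show ?thesis by (simp add: law_obj_def m Let_def del: prod_c_sel(2))
qed

lemma law_sel [simp]:
  "Src1 (law P) = Tc0 (Tq0 P)" "Tgt1 (law P) = Tq0 (Tc0 P)"
  "X \<in> Obj (Tc0 (Tq0 P)) \<Longrightarrow> OMap (law P) X = law_obj P X"
  "u \<in> Arr (Tc0 (Tq0 P)) \<Longrightarrow> AMap (law P) u = law_arr P u"
  by (simp_all add: law_def)

lemma law_natural: "two_natural (comp_fun2 (Tc :: ('o, 'a, 'p) ed_monad) Tq) (comp_fun2 Tq Tc) law"
proof (rule two_naturalI, unfold comp_fun2_sel Tc_sel Tq_sel)
  fix P :: "('o, 'a, 'p) ed" assume "elementary_doctrine P"
  then interpret ed_doctrine P by (rule ed_doctrineI)
  show "cell1_in (Tc0 (Tq0 P)) (Tq0 (Tc0 P)) (law P)"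
    by (rule retaggingD[OF law_retagging])
next
  fix P R and F :: "('o, 'a, 'p) ed1" assume F: "cell1_in P R F"
  then interpret ed_cell P R F by (rule ed_cellI)
  interpret C: ed_cell "Tc0 P" "Tc0 R" "Tc1 F" by (rule ed_cellI[OF Tc1_cell])
  interpret Q: ed_cell "Tq0 P" "Tq0 R" "Tq1 F" by (rule ed_cellI[OF Tq1_cell])
  note L = retaggingD[OF P.law_retagging]
  show "law R \<odot> Tc1 (Tq1 F) = Tq1 (Tc1 F) \<odot> law P"
    unfolding law_def[of R] mk1_comp1[OF Q.Tc1_cell] 
    unfolding Tq1_def[of "Tc1 F"] C.Src_Tgt mk1_comp1[OF L(1)]
    by (rule mk1_eqI) (auto simp: law_obj_natural law_arr_def mult_obj_c_Tq1 P.law_arr_Arr(2) P.TcTq_Obj(4) L(2) P.Des_el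
        mult_arr_def[of "AExt _ _ _"])
next
  fix P R F G \<theta> A assume t: "cell2_in P R F (G :: ('o, 'a, 'p) ed1) \<theta>" and A [simp]: "A \<in> Obj (Tc0 (Tq0 P))"
  from t interpret ed_cell2 P R F G \<theta> by (rule ed_cell2I)
  interpret C: ed_cell2 "Tc0 P" "Tc0 R" "Tc1 F" "Tc1 G" "Tc2 \<theta>" by (rule ed_cell2I[OF Tc_on2_cell[OF t]])
  interpret Q: ed_cell2 "Tq0 P" "Tq0 R" "Tq1 F" "Tq1 G" "Tq2 \<theta>" by (rule ed_cell2I[OF Tq_on2_cell[OF t]])
  note [simp] = F.P.TcTq_Obj[OF A] F.P.law_obj_Obj[OF A]
  show "AMap (law R) (Cmp (Tc2 (Tq2 \<theta>)) A) = Cmp (Tq2 (Tc2 \<theta>)) (OMap (law P) A)"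
    using Q.Tc2_arr[OF A] F.law_obj_natural[OF A] G.law_obj_natural[OF A]
    by (simp add: law_arr_def mult_arr_def mult_obj_def obj_c_Ext)
next
  fix P R and F G :: "('o, 'a, 'p) ed1" and \<theta> assume t: "cell2_in P R F G \<theta>"
  show "cell2_in (Tc0 (Tq0 P)) (Tc0 (Tq0 R)) (Tc1 (Tq1 F)) (Tc1 (Tq1 G)) (Tc2 (Tq2 \<theta>))"
    by (rule Tc_on2_cell[OF Tq_on2_cell[OF t]])
  show "cell2_in (Tq0 (Tc0 P)) (Tq0 (Tc0 R)) (Tq1 (Tc1 F)) (Tq1 (Tc1 G)) (Tq2 (Tc2 \<theta>))"
    by (rule Tq_on2_cell[OF Tc_on2_cell[OF t]])
qed

lemma Tq0_Tc0_arr_eqI: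
  assumes v: "v \<in> Arr (Tq0 (Tc0 Q))" and w: "w \<in> Arr (Tq0 (Tc0 Q))"
    and eq: "asrc v = asrc w" "atgt v = atgt w" "aunder (aunder v) = aunder (aunder w)"
  shows "v = w"
proof -
  note vD = Tq0_ArrD[OF v] and wD = Tq0_ArrD[OF w]
  have "AExt (asrc (aunder v)) (aunder (aunder v)) (atgt (aunder v)) = aunder v"
    "AExt (asrc (aunder w)) (aunder (aunder w)) (atgt (aunder w)) = aunder w"
    using AExt_aunder[of "aunder v" Q] AExt_aunder[of "aunder w" Q] vD(3) wD(3) by simp_all
  moreover have "asrc (aunder v) = asrc (aunder w)" "atgt (aunder v) = atgt (aunder w)"
    using vD(4,5) wD(4,5) eq by simp_all
  ultimately have "aunder v = aunder w" using eq(3) by metis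
  then show ?thesis
    using AExt_aunder[of v "Tc0 Q"] AExt_aunder[of w "Tc0 Q"] eq v w by metis
qed

text \<open>A weaker notion than \<open>retagging\<close>, which both completions evidently preserve.\<close>

definition fibrewise_id :: "('x, 'y, 'p) cell1 \<Rightarrow> bool" where
  "fibrewise_id F \<longleftrightarrow> (\<forall>A\<in>Obj (Src1 F). \<forall>\<alpha>\<in>carrier (Fib (Src1 F) A). FMap F A \<alpha> = \<alpha>)"

lemma FMap_carrier:
  "cell1_in P R F \<Longrightarrow> A \<in> Obj P \<Longrightarrow> \<alpha> \<in> carrier (Fib P A) \<Longrightarrow> FMap F A \<alpha> \<in> carrier (Fib R (OMap F A))"
  by (auto simp: cell1_in_def infsl_hom_def)

lemma fibrewise_idD:
  assumes F: "cell1_in P R F" "fibrewise_id F" and A: "A \<in> Obj P" "\<alpha> \<in> carrier (Fib P A)"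
  shows "FMap F A \<alpha> = \<alpha>" "\<alpha> \<in> carrier (Fib R (OMap F A))"
  using assms FMap_carrier[OF F(1) A] cell1_inD(3)[OF F(1)] by (auto simp: fibrewise_id_def)

text \<open>Each of the two multiplication axioms compares a composite of two with a composite of three
  1-cells, all of which are the identity on elements. Arrows into \<open>(P\<^sub>c)\<^sub>q\<close> are determined by domain,
  codomain and doubly underlying arrow, so only objects and underlying arrows have to be compared.\<close>

lemma cells_into_Tq0_Tc0_eqI:
  fixes P D R R1 R2 :: "('o, 'a, 'p) ed"
  assumes F: "cell1_in P R F" "fibrewise_id F" and G: "cell1_in R D G" "fibrewise_id G"
    and J: "cell1_in P R1 J" "fibrewise_id J" and H: "cell1_in R1 R2 H" "fibrewise_id H"
    and K: "cell1_in R2 D K" "fibrewise_id K" and D: "D = Tq0 (Tc0 Q)"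
    and sel: "Dom P = asrc" "Cod P = atgt"
    and ob: "\<And>X. X \<in> Obj P \<Longrightarrow> OMap G (OMap F X) = OMap K (OMap H (OMap J X))"
    and ar: "\<And>u. u \<in> Arr P \<Longrightarrow> aunder (aunder (AMap G (AMap F u))) = aunder (aunder (AMap K (AMap H (AMap J u))))"
  shows "G \<odot> F = K \<odot> H \<odot> J"
proof -
  interpret F: ed_cell P R F by (rule ed_cellI[OF F(1)])
  interpret G: ed_cell R D G by (rule ed_cellI[OF G(1)])
  interpret J: ed_cell P R1 J by (rule ed_cellI[OF J(1)])
  interpret H: ed_cell R1 R2 H by (rule ed_cellI[OF H(1)])
  interpret K: ed_cell R2 D K by (rule ed_cellI[OF K(1)])
  have Dsel: "Dom D = asrc" "Cod D = atgt" by (simp_all add: D)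
  show ?thesis
    unfolding comp1_def[of G F] comp1_def[of K "H \<odot> J"] comp1_sel(1,2) F.Src_Tgt G.Src_Tgt J.Src_Tgt K.Src_Tgt
  proof (rule mk1_eqI)
    fix X assume X: "X \<in> Obj P"
    then show "OMap G (OMap F X) = OMap K (OMap (H \<odot> J) X)" by (simp add: ob)
    fix \<gamma> assume \<gamma>: "\<gamma> \<in> carrier (Fib P X)"
    note f = fibrewise_idD[OF F X \<gamma>] and j = fibrewise_idD[OF J X \<gamma>]
    note g = fibrewise_idD(1)[OF G _ f(2)] and h = fibrewise_idD[OF H _ j(2)]
    show "FMap G (OMap F X) (FMap F X \<gamma>) = FMap K (OMap (H \<odot> J) X) (FMap (H \<odot> J) X \<gamma>)"
      using X \<gamma> f(1) g j(1) h fibrewise_idD(1)[OF K _ h(2)] by simp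
  next
    fix u assume u: "u \<in> Arr P"
    have "AMap G (AMap F u) = AMap K (AMap H (AMap J u))"
    proof (rule Tq0_Tc0_arr_eqI)
      show "AMap G (AMap F u) \<in> Arr (Tq0 (Tc0 Q))" "AMap K (AMap H (AMap J u)) \<in> Arr (Tq0 (Tc0 Q))"
        using u by (simp_all flip: D)
      show "asrc (AMap G (AMap F u)) = asrc (AMap K (AMap H (AMap J u)))"
        "atgt (AMap G (AMap F u)) = atgt (AMap K (AMap H (AMap J u)))"
        using u ob by (simp_all flip: Dsel)
    qed (rule ar[OF u])
    then show "AMap G (AMap F u) = AMap K (AMap (H \<odot> J) u)" using u by simp
  qed
qed

lemma fibrewise_id_retagging: "retagging P D F \<Longrightarrow> fibrewise_id F"
  using cell1_inD(3)[OF retaggingD(1)[of P D F]] by (auto simp: fibrewise_id_def retaggingD(2))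

lemma fibrewise_id_Tc1: "fibrewise_id F \<Longrightarrow> fibrewise_id (Tc1 F)"
  by (auto simp: fibrewise_id_def)

lemma fibrewise_id_Tq1: "fibrewise_id F \<Longrightarrow> fibrewise_id (Tq1 F)"
  by (auto simp: fibrewise_id_def Des_def)

context ed_doctrine
begin

text \<open>On objects: restricting \<open>\<rho>\<close> to \<open>\<top>\<close> changes nothing.\<close>

lemma law_unit_c: "law P \<odot> Unit Tc (Tq0 P) = Tq1 (Unit Tc P)"
proof -
  interpret q: ed_doctrine "Tq0 P" by (rule ed_Tq0)
  note o = obj_q_retagging[OF unit_c_retagging]
  note U = retaggingD[OF q.unit_c_retagging] and U' = retaggingD[OF unit_c_retagging]
  have u: "unit_c_obj (Tq0 P) X = Ext X \<top>\<^bsub>Fib P (under X)\<^esub>" if "X \<in> Obj (Tq0 P)" for X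
    using Tq0_fibre(3)[OF that] by (simp add: unit_c_obj_def)
  have l: "law_obj P (Ext X \<top>\<^bsub>Fib P (under X)\<^esub>) = Ext (unit_c_obj P (under X)) (elt X)" if "X \<in> Obj (Tq0 P)" for X
    using that by (simp add: law_obj_def mult_obj_def unit_c_obj_def Let_def)
  show ?thesis
    unfolding Tc_sel law_def mk1_comp1[OF U(1)] unfolding Tq1_def mk1_sel(1,2)
    by (rule mk1_eqI) (auto simp: o u l law_arr_def mult_arr_def unit_arr_def mult_obj_def unit_c_obj_def[of P] U' Des_el)
qed

text \<open>On objects: the restriction of \<open>\<delta>\<^sub>A\<close> to \<open>\<alpha>\<close> is the equality of \<open>(A, \<alpha>)\<close>.\<close>

lemma law_unit_q: "law P \<odot> Tc1 (Unit Tq P) = Unit Tq (Tc0 P)"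
proof -
  interpret c: ed_doctrine "Tc0 P" by (rule ed_Tc0)
  note U = retaggingD[OF unit_q_retagging]
  note TU = ed_cell.Tc1_cell[OF ed_cellI[OF U(1)]]
  note o = obj_c_retagging[OF unit_q_retagging]
  have [simp]: "law_obj P (Ext (unit_q_obj P (under X)) (elt X)) = unit_q_obj (Tc0 P) X" if "X \<in> Obj (Tc0 P)" for X
    using that by (simp add: law_obj_def mult_obj_def unit_q_obj_def Tc0_delta Let_def)
  show ?thesis
    unfolding Tq_sel law_def mk1_comp1[OF TU]
    by (rule mk1_eqI) (auto simp: o law_arr_def mult_arr_def unit_arr_def mult_obj_def AExt_Tc0 U(2))
qed

lemma meet_meet_absorb:
  assumes "A \<in> Obj P" "x \<in> El A" "y \<in> El A" "w \<in> El A" "w \<sqsubseteq>\<^bsub>Fib P A\<^esub> y"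
  shows "(x \<sqinter>\<^bsub>Fib P A\<^esub> y) \<sqinter>\<^bsub>Fib P A\<^esub> w = x \<sqinter>\<^bsub>Fib P A\<^esub> w"
  by (rule eqI[OF assms(1)]) (use assms le_trans[OF _ assms(5)] in auto)

text \<open>On \<open>(((A, \<rho>), \<alpha>), \<beta>)\<close> with \<open>\<beta> \<sqsubseteq> \<alpha>\<close>, restricting \<open>\<rho>\<close> first to \<open>\<alpha>\<close> and then to \<open>\<beta>\<close> is restricting it
  to \<open>\<beta>\<close>.\<close>

lemma law_obj_mult_c:
  assumes X: "X \<in> Obj (Tc0 (Tc0 (Tq0 P)))"
  defines "Z \<equiv> Ext (law_obj P (under X)) (elt X)"
  assumes Z: "Z \<in> Obj (Tc0 (Tq0 (Tc0 P)))"
  shows "law_obj P (mult_obj X) = Ext (mult_obj (mult_obj Z)) (elt (law_obj (Tc0 P) Z))"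
proof -
  interpret c: ed_doctrine "Tc0 P" by (rule ed_Tc0)
  interpret q: ed_doctrine "Tq0 P" by (rule ed_Tq0)
  note qX = q.TcTc_Obj[OF X]
  note uX = TcTq_Obj[OF qX(1)] and cZ = c.TcTq_Obj[OF Z]
  let ?U = "mult_obj (under X)" and ?V = "mult_obj (mult_obj Z)"
  let ?A = "under ?U"
  let ?\<rho> = "elt (under (under X))"
  have V: "mult_obj (mult_obj X) = ?V" by (simp add: Z_def mult_obj_def)
  have Zs [simp]: "under Z = law_obj P (under X)" "elt Z = elt X" by (simp_all add: Z_def)
  have e: "elt (prod_c (Tc0 P) (mult_obj Z) (mult_obj Z)) = elt (prod_c P ?V ?V)"
    using arg_cong[OF mult_prod_c[OF cZ(4) cZ(4)], of elt] by simp
  have l1: "elt (prod_c P ?V ?V) \<in> El (Prod P ?A ?A)" 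
    "elt (prod_c P ?V ?V) \<sqsubseteq>\<^bsub>Fib P (Prod P ?A ?A)\<^esub> elt (prod_c P ?U ?U)"
    using c.prod_c_Obj[OF cZ(4) cZ(4), THEN Tc0_ObjD(2)] unfolding e by (simp_all del: prod_c_sel(2))
  have l2: "elt (law_obj P (under X)) \<in> El (Prod P ?A ?A)"
    "elt (law_obj P (under X)) \<sqsubseteq>\<^bsub>Fib P (Prod P ?A ?A)\<^esub> elt (prod_c P ?U ?U)"
    using elt_law_obj_El[OF qX(1)] by (simp_all del: prod_c_sel(2) law_obj_sel(2))
  have a1: "Prod P ?A ?A \<in> Obj P" and a2: "?\<rho> \<in> El (Prod P ?A ?A)" using uX by simp_all
  have a3: "elt (prod_c P ?U ?U) \<in> El (Prod P ?A ?A)"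
    using prod_c_Obj[OF uX(4) uX(4), THEN Tc0_ObjD(2)] by (simp del: prod_c_sel(2))
  have "elt (law_obj (Tc0 P) Z) = elt (law_obj P (under X)) \<sqinter>\<^bsub>Fib P (Prod P ?A ?A)\<^esub> elt (prod_c P ?V ?V)"
    unfolding law_obj_sel(2)[of "Tc0 P"] e
    using Tc0_fibre(2)[OF prod_c_Obj[OF uX(4) uX(4)]] l1 l2
    by (simp del: prod_c_sel(2) law_obj_sel(2))
  also have "\<dots> = ?\<rho> \<sqinter>\<^bsub>Fib P (Prod P ?A ?A)\<^esub> elt (prod_c P ?V ?V)"
    using meet_meet_absorb[OF a1 a2 a3 l1]
    by (simp del: prod_c_sel(2))
  finally show ?thesis by (simp add: law_obj_def[of P "mult_obj X"] Let_def V del: prod_c_sel(2) law_obj_sel(2))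
qed

text \<open>On \<open>(((A, \<rho>), \<tau>), \<alpha>)\<close> both sides carry \<open>\<tau> \<sqinter> (\<alpha> \<times> \<alpha>)\<close>, once computed in \<open>P\<close> and once in \<open>P\<^sub>q\<close>, whose
  fibres have the meets of \<open>P\<close>.\<close>

lemma law_obj_mult_q:
  assumes X: "X \<in> Obj (Tc0 (Tq0 (Tq0 P)))"
  shows "law_obj P (Ext (mult_obj (under X)) (elt X)) = Ext (mult_obj (mult_obj X)) (elt (law_obj (Tq0 P) X))"
proof -
  interpret q: ed_doctrine "Tq0 P" by (rule ed_Tq0)
  interpret qq: ed_doctrine "Tq0 (Tq0 P)" by (rule q.ed_Tq0)
  note qX = q.TcTq_Obj[OF X]
  note uX = TqTq_Obj[OF qX(1)] and mX = TcTq_Obj[OF qX(4)]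
  let ?V = "mult_obj (mult_obj X)"
  let ?A = "under ?V" and ?B = "under (mult_obj X)"
  have V: "mult_obj (Ext (mult_obj (under X)) (elt X)) = ?V" by (simp add: mult_obj_def)
  have B: "?B \<in> Obj (Tq0 P)" using uX(1) by simp
  have d: "elt (under X) \<in> Des P (Prod P ?A ?A) (elt (prod_q P ?B ?B))"
    using q.equivalence_rel_el[OF Tq0_ObjD(2)[OF qX(1)]] by simp
  have "elt (law_obj (Tq0 P) X) = elt (under X) \<sqinter>\<^bsub>Fib P (Prod P ?A ?A)\<^esub> elt (prod_c P ?V ?V)"
    unfolding law_obj_sel(2) elt_prod_c_Tq0(1)[OF qX(4) qX(4)]
    using Tq0_fibre(2)[OF prod_q_Obj[OF B B], of "elt (under X)" "elt (prod_c P ?V ?V)"] d elt_prod_c_Tq0(2)[OF qX(4) qX(4)]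
    by (simp del: prod_c_sel(2))
  then show ?thesis by (simp add: law_obj_def[of P] Let_def V del: prod_c_sel(2) law_obj_sel(2))
qed

lemma law_mult_c: "law P \<odot> Mult Tc (Tq0 P) = Tq1 (Mult Tc P) \<odot> law (Tc0 P) \<odot> Tc1 (law P)"
proof -
  interpret c: ed_doctrine "Tc0 P" by (rule ed_Tc0)
  interpret q: ed_doctrine "Tq0 P" by (rule ed_Tq0)
  let ?P = "Tc0 (Tc0 (Tq0 P))"
  note m = mult_c_retagging[folded Tc_sel(5)] and qm = q.mult_c_retagging[folded Tc_sel(5)]
  note cells = retaggingD(1)[OF m] retaggingD(1)[OF qm] retaggingD(1)[OF law_retagging] retaggingD(1)[OF c.law_retagging]
  interpret M: ed_cell ?P "Tc0 (Tq0 P)" "Mult Tc (Tq0 P)" by (rule ed_cellI[OF cells(2)])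
  interpret L: ed_cell "Tc0 (Tq0 P)" "Tq0 (Tc0 P)" "law P" by (rule ed_cellI[OF cells(3)])
  interpret J: ed_cell ?P "Tc0 (Tq0 (Tc0 P))" "Tc1 (law P)" by (rule ed_cellI[OF L.Tc1_cell])
  interpret H: ed_cell "Tc0 (Tq0 (Tc0 P))" "Tq0 (Tc0 (Tc0 P))" "law (Tc0 P)" by (rule ed_cellI[OF cells(4)])
  interpret K': ed_cell "Tc0 (Tc0 P)" "Tc0 P" "Mult Tc P" by (rule ed_cellI[OF cells(1)])
  show ?thesis
  proof (rule cells_into_Tq0_Tc0_eqI[where P = ?P and Q = P, OF M.cell _ L.cell _ J.cell _ H.cell _ K'.Tq1_cell _ refl])
    show "fibrewise_id (Mult Tc (Tq0 P))" "fibrewise_id (law P)" "fibrewise_id (Tc1 (law P))"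
      "fibrewise_id (law (Tc0 P))" "fibrewise_id (Tq1 (Mult Tc P))"
      using fibrewise_id_retagging[OF m] fibrewise_id_retagging[OF qm] fibrewise_id_retagging[OF law_retagging]
        fibrewise_id_retagging[OF c.law_retagging] fibrewise_id_Tc1 fibrewise_id_Tq1 by blast+
  next
    fix X assume X: "X \<in> Obj ?P"
    have Z: "obj_c (law P) X = Ext (law_obj P (under X)) (elt X)"
      using obj_c_retagging[OF law_retagging X] Tc0_ObjD(1)[OF X] by simp
    note Z' = L.obj_c_Obj[OF X]
    have "OMap (Tq1 (Mult Tc P)) (OMap (law (Tc0 P)) (OMap (Tc1 (law P)) X)) = obj_q (Mult Tc P) (law_obj (Tc0 P) (obj_c (law P) X))"
      using X Z' c.law_obj_Obj[OF Z'] by (simp add: Tq1_sel(1)[of _ "Tc0 (Tc0 P)"])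
    also have "\<dots> = Ext (mult_obj (mult_obj (obj_c (law P) X))) (elt (law_obj (Tc0 P) (obj_c (law P) X)))"
      using obj_q_retagging[OF m c.law_obj_Obj[OF Z']] c.TcTq_Obj(4)[OF Z'] by (simp del: law_obj_sel(2))
    also have "\<dots> = law_obj P (mult_obj X)"
      using law_obj_mult_c[OF X] Z' unfolding Z by (simp del: law_obj_sel(2))
    also have "\<dots> = OMap (law P) (OMap (Mult Tc (Tq0 P)) X)"
      using X q.TcTc_Obj(4)[OF X] by simp
    finally show "OMap (law P) (OMap (Mult Tc (Tq0 P)) X) = OMap (Tq1 (Mult Tc P)) (OMap (law (Tc0 P)) (OMap (Tc1 (law P)) X))" ..
  next
    fix u assume u: "u \<in> Arr ?P"
    note 1 = M.functor_simps(2)[OF u] and 2 = J.functor_simps(2)[OF u]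
    note 3 = H.functor_simps(2)[OF 2]
    have J: "aunder (AMap (Tc1 (law P)) u) = law_arr P (aunder u)" using u by simp
    have M: "AMap (Mult Tc (Tq0 P)) u = mult_arr u" using u by simp
    have H: "AMap (law (Tc0 P)) (AMap (Tc1 (law P)) u) = law_arr (Tc0 P) (AMap (Tc1 (law P)) u)"
      using 2 by (rule law_sel(4))
    have K: "aunder (AMap (Tq1 (Mult Tc P)) v) = mult_arr (aunder v)" if "v \<in> Arr (Tq0 (Tc0 (Tc0 P)))" for v
      using that by simp
    have L: "AMap (law P) (mult_arr u) = law_arr P (mult_arr u)" using 1 unfolding M by (rule law_sel(4))
    show "aunder (aunder (AMap (law P) (AMap (Mult Tc (Tq0 P)) u))) =
      aunder (aunder (AMap (Tq1 (Mult Tc P)) (AMap (law (Tc0 P)) (AMap (Tc1 (law P)) u))))"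
      unfolding K[OF 3] M L unfolding H by (simp add: law_arr_def J del: Tc1_sel(2))
  qed simp_all
qed

lemma law_mult_q: "law P \<odot> Tc1 (Mult Tq P) = Mult Tq (Tc0 P) \<odot> Tq1 (law P) \<odot> law (Tq0 P)"
proof -
  interpret c: ed_doctrine "Tc0 P" by (rule ed_Tc0)
  interpret q: ed_doctrine "Tq0 P" by (rule ed_Tq0)
  let ?P = "Tc0 (Tq0 (Tq0 P))"
  note m = mult_q_retagging[folded Tq_sel(5)] and cm = c.mult_q_retagging[folded Tq_sel(5)]
  note cells = retaggingD(1)[OF m] retaggingD(1)[OF cm] retaggingD(1)[OF law_retagging] retaggingD(1)[OF q.law_retagging]
  interpret M: ed_cell "Tq0 (Tq0 P)" "Tq0 P" "Mult Tq P" by (rule ed_cellI[OF cells(1)])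
  interpret F: ed_cell ?P "Tc0 (Tq0 P)" "Tc1 (Mult Tq P)" by (rule ed_cellI[OF M.Tc1_cell])
  interpret L: ed_cell "Tc0 (Tq0 P)" "Tq0 (Tc0 P)" "law P" by (rule ed_cellI[OF cells(3)])
  interpret J: ed_cell ?P "Tq0 (Tc0 (Tq0 P))" "law (Tq0 P)" by (rule ed_cellI[OF cells(4)])
  interpret H: ed_cell "Tq0 (Tc0 (Tq0 P))" "Tq0 (Tq0 (Tc0 P))" "Tq1 (law P)" by (rule ed_cellI[OF L.Tq1_cell])
  interpret K: ed_cell "Tq0 (Tq0 (Tc0 P))" "Tq0 (Tc0 P)" "Mult Tq (Tc0 P)" by (rule ed_cellI[OF cells(2)])
  show ?thesis
  proof (rule cells_into_Tq0_Tc0_eqI[where P = ?P and Q = P, OF F.cell _ L.cell _ J.cell _ H.cell _ K.cell _ refl])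
    show "fibrewise_id (Tc1 (Mult Tq P))" "fibrewise_id (law P)" "fibrewise_id (law (Tq0 P))"
      "fibrewise_id (Tq1 (law P))" "fibrewise_id (Mult Tq (Tc0 P))"
      using fibrewise_id_retagging[OF m] fibrewise_id_retagging[OF cm] fibrewise_id_retagging[OF law_retagging]
        fibrewise_id_retagging[OF q.law_retagging] fibrewise_id_Tc1 fibrewise_id_Tq1 by blast+
  next
    fix X assume X: "X \<in> Obj ?P"
    note W = q.law_obj_Obj[OF X]
    note W' = L.obj_q_Obj[OF W]
    have M: "obj_c (Mult Tq P) X = Ext (mult_obj (under X)) (elt X)"
      using obj_c_retagging[OF m X] Tc0_ObjD(1)[OF X] by simp
    have "OMap (Mult Tq (Tc0 P)) (OMap (Tq1 (law P)) (OMap (law (Tq0 P)) X)) = mult_obj (obj_q (law P) (law_obj (Tq0 P) X))"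
      using X W W' by (simp add: Tq1_sel(1)[of _ "Tc0 (Tq0 P)"])
    also have "\<dots> = Ext (mult_obj (mult_obj X)) (elt (law_obj (Tq0 P) X))"
      using obj_q_retagging[OF law_retagging W] q.TcTq_Obj(4)[OF X] by (simp add: mult_obj_def[of "Ext _ _"] del: law_obj_sel(2))
    also have "\<dots> = law_obj P (obj_c (Mult Tq P) X)"
      unfolding M by (rule law_obj_mult_q[OF X, symmetric])
    also have "\<dots> = OMap (law P) (OMap (Tc1 (Mult Tq P)) X)"
      using X M.obj_c_Obj[OF X] by (simp add: Tc1_sel(1)[of _ "Tq0 (Tq0 P)"])
    finally show "OMap (law P) (OMap (Tc1 (Mult Tq P)) X) = OMap (Mult Tq (Tc0 P)) (OMap (Tq1 (law P)) (OMap (law (Tq0 P)) X))" ..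
  next
    fix u assume u: "u \<in> Arr ?P"
    note 1 = F.functor_simps(2)[OF u] and 2 = J.functor_simps(2)[OF u]
    note 3 = H.functor_simps(2)[OF 2]
    have F: "aunder (AMap (Tc1 (Mult Tq P)) u) = mult_arr (aunder u)" using u by simp
    have J: "AMap (law (Tq0 P)) u = law_arr (Tq0 P) u" using u by simp
    have H: "aunder (AMap (Tq1 (law P)) (AMap (law (Tq0 P)) u)) = law_arr P (mult_arr u)"
      using 2 q.law_arr_Arr(2)[OF u] unfolding J by (simp add: law_arr_def[of "Tq0 P"])
    have K: "AMap (Mult Tq (Tc0 P)) v = mult_arr v" if "v \<in> Arr (Tq0 (Tq0 (Tc0 P)))" for v
      using that by simp
    have L: "aunder (AMap (law P) v) = mult_arr v" if "v \<in> Arr (Tc0 (Tq0 P))" for v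
      using that by (simp add: law_arr_def)
    show "aunder (aunder (AMap (law P) (AMap (Tc1 (Mult Tq P)) u))) =
      aunder (aunder (AMap (Mult Tq (Tc0 P)) (AMap (Tq1 (law P)) (AMap (law (Tq0 P)) u))))"
      unfolding K[OF 3] L[OF 1] mult_arr_sel F H by (simp add: law_arr_def)
  qed simp_all
qed

end

theorem theorem7p3:
  shows "\<exists>\<delta> :: ('o, 'a, 'p) ed \<Rightarrow> ('o, 'a, 'p) ed1. distributive_law Tc Tq \<delta>"
proof
  show "distributive_law Tc Tq (law :: ('o, 'a, 'p) ed \<Rightarrow> ('o, 'a, 'p) ed1)"
    unfolding distributive_law_def
  proof (intro conjI allI impI Tc_two_monad Tq_two_monad law_natural)
    fix P :: "('o, 'a, 'p) ed" assume "elementary_doctrine P"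
    then interpret ed_doctrine P by (rule ed_doctrineI)
    show "law P \<odot> Mult Tc (on0 Tq P) = on1 Tq (Mult Tc P) \<odot> law (on0 Tc P) \<odot> on1 Tc (law P)"
      using law_mult_c by (simp only: Tc_sel(1,2) Tq_sel(1,2))
    show "law P \<odot> on1 Tc (Mult Tq P) = Mult Tq (on0 Tc P) \<odot> on1 Tq (law P) \<odot> law (on0 Tq P)"
      using law_mult_q by (simp only: Tc_sel(1,2) Tq_sel(1,2))
    show "law P \<odot> Unit Tc (on0 Tq P) = on1 Tq (Unit Tc P)"
      using law_unit_c by (simp only: Tc_sel(1,2) Tq_sel(1,2))
    show "law P \<odot> on1 Tc (Unit Tq P) = Unit Tq (on0 Tc P)"
      using law_unit_q by (simp only: Tc_sel(1,2) Tq_sel(1,2))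
  qed
qed

end
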